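(* Let $G$ be a finitely generated para-$\mathfrak{Nil}$-Hamiltonian group containing a nilpotent subgroup of finite index. Then $\gamma_n(G)$ is finite for some positive integer $n$. Moreover, if $G$ is insoluble, then $G$ is finite.
   Context: A group is minimal non-nilpotent if it is not nilpotent but all its proper subgroups are nilpotent. A group $G$ is para-$\mathfrak{Nil}$-Hamiltonian if $G$ is non-nilpotent and every non-normal subgroup of $G$ is either nilpotent or minimal non-nilpotent. $\gamma_n(G)$ is the $n$-th term of the lower central series ($\gamma_1(G)=G$, $\gamma_{n+1}(G)=[\gamma_n(G),G]$). *)

theory Defs
  imports "HOL-Algebra.Solvable_Groups" "HOL-Algebra.Coset"
begin

definition commutator :: "('a, 'b) monoid_scheme \<Rightarrow> 'a \<Rightarrow> 'a \<Rightarrow> 'a" where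
  "commutator G x y = inv\<^bsub>G\<^esub> x \<otimes>\<^bsub>G\<^esub> inv\<^bsub>G\<^esub> y \<otimes>\<^bsub>G\<^esub> x \<otimes>\<^bsub>G\<^esub> y"

primrec lcs :: "('a, 'b) monoid_scheme \<Rightarrow> nat \<Rightarrow> 'a set" where
  "lcs G 0 = carrier G"
| "lcs G (Suc k) = generate G {commutator G x y | x y. x \<in> lcs G k \<and> y \<in> carrier G}"

text \<open>The paper's gamma_n (1-indexed): gamma_1 = G, gamma_(n+1) = [gamma_n, G].\<close>
definition gamma :: "('a, 'b) monoid_scheme \<Rightarrow> nat \<Rightarrow> 'a set" where
  "gamma G n = lcs G (n - 1)"

definition nilpotent_group :: "('a, 'b) monoid_scheme \<Rightarrow> bool" where
  "nilpotent_group G \<longleftrightarrow> group G \<and> (\<exists>c. lcs G c = {\<one>\<^bsub>G\<^esub>})"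

definition minimal_non_nilpotent :: "('a, 'b) monoid_scheme \<Rightarrow> bool" where
  "minimal_non_nilpotent G \<longleftrightarrow> group G \<and> \<not> nilpotent_group G \<and>
     (\<forall>H. subgroup H G \<and> H \<noteq> carrier G \<longrightarrow> nilpotent_group (G\<lparr>carrier := H\<rparr>))"

definition para_Nil_Hamiltonian :: "('a, 'b) monoid_scheme \<Rightarrow> bool" where
  "para_Nil_Hamiltonian G \<longleftrightarrow> group G \<and> \<not> nilpotent_group G \<and>
     (\<forall>H. subgroup H G \<and> \<not> (H \<lhd> G) \<longrightarrow>
        nilpotent_group (G\<lparr>carrier := H\<rparr>) \<or> minimal_non_nilpotent (G\<lparr>carrier := H\<rparr>))"

definition finitely_generated_group :: "('a, 'b) monoid_scheme \<Rightarrow> bool" where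
  "finitely_generated_group G \<longleftrightarrow> (\<exists>S. finite S \<and> S \<subseteq> carrier G \<and> generate G S = carrier G)"

end

theory Submission
  imports Defs "HOL-Algebra.FiniteProduct"
begin

text \<open>
  In a para-Nil-Hamiltonian group every subgroup that properly contains a non-nilpotent subgroup
  is normal.

  Let \<open>N\<close> be a normal nilpotent subgroup of finite index with lower central series \<open>N\<^sub>i\<close>. Going down
  this series, one shows that some \<open>\<gamma>\<^sub>n(G)\<close> is finite modulo \<open>N\<^sub>i\<close>. In \<open>G / N\<^sub>i\<^sub>+\<^sub>1\<close>, let \<open>A\<close> be a
  torsion-free subgroup \<open>(N\<^sub>i / N\<^sub>i\<^sub>+\<^sub>1)\<^sup>t\<close>. Each \<open>x\<close> acts on \<open>A\<close> with finite order \<open>k\<close>; put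
  \<open>D = [A, x]\<close>. The norm of \<open>x\<close> vanishes on \<open>D\<close>, so \<open>x\<close> has no nontrivial fixed points in \<open>D\<close>, and
  \<open>D\<^sup>m\<langle>x\<rangle>\<close> is not nilpotent unless \<open>D\<close> is trivial. If \<open>D\<^sup>m\<langle>x\<rangle>\<close> is normal, then
  \<open>[D, x] \<subseteq> D\<^sup>m\<close>, and the vanishing norm gives \<open>D\<^sup>k \<subseteq> D\<^sup>m\<close>; if it is not normal, its subgroups
  \<open>D\<^sup>m\<^sup>j\<langle>x\<rangle>\<close> cannot be proper. Either way \<open>D\<close> is divisible and finitely generated, hence trivial.
  So \<open>A\<close> is central, and the transfer into \<open>A\<close> shows that \<open>[\<gamma>\<^sub>n, G]\<close> meets \<open>A\<close> trivially.

  If \<open>G\<close> is infinite and \<open>F = \<gamma>\<^sub>n(G)\<close> is finite, take \<open>z\<close> of infinite order centralizing \<open>F\<close>. For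
  a non-nilpotent \<open>E \<le> F\<close> the subgroup \<open>E \<times> \<langle>z\<rangle>\<close> properly contains \<open>E \<times> \<langle>z\<^sup>2\<rangle>\<close>, so it is normal,
  and so is its torsion part \<open>E\<close>. A minimal non-nilpotent \<open>E \<le> F\<close> is soluble by Schmidt's theorem,
  and \<open>F / E\<close>, all of whose subgroups are normal, has class at most 2; thus \<open>G\<close> is soluble.
\<close>

section \<open>Lower central series relative to a subgroup\<close>

text \<open>The series of a subgroup is formed with the operations of the ambient group, so that
  terms for different subgroups can be compared without changing carriers. As for
  \<open>lcs\<close>, index 0 is the subgroup itself.\<close>

primrec lcs_in :: "('a, 'b) monoid_scheme \<Rightarrow> 'a set \<Rightarrow> nat \<Rightarrow> 'a set" where
  "lcs_in G H 0 = H"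
| "lcs_in G H (Suc k) = generate G {commutator G x y | x y. x \<in> lcs_in G H k \<and> y \<in> H}"

lemma lcs_in_carrier: "lcs_in G (carrier G) n = lcs G n"
  by (induction n) auto

context group
begin

lemma inv_mult_cancel [simp]:
  assumes "x \<in> carrier G" "y \<in> carrier G"
  shows "inv x \<otimes> (x \<otimes> y) = y" "x \<otimes> (inv x \<otimes> y) = y"
  using assms by (simp_all flip: m_assoc)

text \<open>Together with the simp rule \<open>inv_mult_cancel\<close> these rules bring group words
  into a reduced right-associated form, which settles the commutator identities below.\<close>

lemmas word_simps = m_assoc inv_mult_group commutator_def

lemma commutator_closed [simp]:
  "\<lbrakk>x \<in> carrier G; y \<in> carrier G\<rbrakk> \<Longrightarrow> commutator G x y \<in> carrier G"
  by (simp add: commutator_def)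

lemma commutator_mem:
  assumes "subgroup H G" "x \<in> H" "y \<in> H"
  shows "commutator G x y \<in> H"
  using assms by (simp add: commutator_def subgroup.m_closed subgroup.m_inv_closed)

lemma commutator_eq_conj:
  assumes "x \<in> carrier G" "y \<in> carrier G"
  shows "inv y \<otimes> x \<otimes> y = x \<otimes> commutator G x y"
  using assms by (simp add: word_simps)

lemma commutator_eq_one_iff:
  assumes "x \<in> carrier G" "y \<in> carrier G"
  shows "commutator G x y = \<one> \<longleftrightarrow> x \<otimes> y = y \<otimes> x"
proof -
  have "x \<otimes> y = y \<otimes> x \<otimes> commutator G x y"
    using assms by (simp add: word_simps)
  thus ?thesis
    using assms r_cancel_one[of "y \<otimes> x" "commutator G x y"] by auto
qed

lemma conj_hom:
  assumes "g \<in> carrier G"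
  shows "group_hom G G (\<lambda>x. inv g \<otimes> x \<otimes> g)"
  using assms by unfold_locales (auto simp: hom_def word_simps)

lemma normal_conjI:
  assumes "subgroup N G" "\<And>g h. \<lbrakk>g \<in> carrier G; h \<in> N\<rbrakk> \<Longrightarrow> inv g \<otimes> h \<otimes> g \<in> N"
  shows "N \<lhd> G"
proof (rule normal_invI)
  fix x h assume "x \<in> carrier G" "h \<in> N"
  thus "x \<otimes> h \<otimes> inv x \<in> N"
    using assms(2)[of "inv x" h] by simp
qed fact

lemma lcs_in_mono: "H \<subseteq> K \<Longrightarrow> lcs_in G H n \<subseteq> lcs_in G K n"
proof (induction n)
  case (Suc n)
  hence "{commutator G x y |x y. x \<in> lcs_in G H n \<and> y \<in> H}
      \<subseteq> {commutator G x y |x y. x \<in> lcs_in G K n \<and> y \<in> K}" by blast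
  thus ?case by (simp add: mono_generate)
qed simp

lemma lcs_in_subgroup_incl:
  assumes "subgroup H G"
  shows "subgroup (lcs_in G H n) G \<and> lcs_in G H n \<subseteq> H"
proof (induction n)
  case (Suc n)
  have "{commutator G x y |x y. x \<in> lcs_in G H n \<and> y \<in> H} \<subseteq> H"
    using Suc commutator_mem[OF assms] by blast
  from generate_subgroup_incl[OF this assms] generate_is_subgroup[OF subset_trans[OF this]]
  show ?case using subgroup.subset[OF assms] by simp
qed (use assms in simp)

lemmas lcs_in_subgroup = lcs_in_subgroup_incl[THEN conjunct1]
lemmas lcs_in_subset = lcs_in_subgroup_incl[THEN conjunct2]

lemma lcs_in_carrier_subset:
  "subgroup H G \<Longrightarrow> x \<in> lcs_in G H n \<Longrightarrow> x \<in> carrier G"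
  using lcs_in_subset subgroup.subset by blast

text \<open>Inverses and generated subgroups are the same in \<open>H\<close> and in
  \<open>G\<close>. This links nilpotency, which is defined by a change of carrier, with the
  relative series.\<close>

lemma lcs_subgroup_eq:
  assumes "subgroup H G"
  shows "lcs (G\<lparr>carrier := H\<rparr>) n = lcs_in G H n"
proof (induction n)
  case (Suc n)
  have "commutator (G\<lparr>carrier := H\<rparr>) x y = commutator G x y" if "x \<in> H" "y \<in> H" for x y
    using that m_inv_consistent[OF assms] by (simp add: commutator_def)
  hence eq: "{commutator (G\<lparr>carrier := H\<rparr>) x y |x y. x \<in> lcs_in G H n \<and> y \<in> H}
      = {commutator G x y |x y. x \<in> lcs_in G H n \<and> y \<in> H}"
    using lcs_in_subset[OF assms] by (metis (no_types, lifting) in_mono)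
  have "{commutator G x y |x y. x \<in> lcs_in G H n \<and> y \<in> H} \<subseteq> H"
    using lcs_in_subset[OF assms] commutator_mem[OF assms] by blast
  from generate_consistent[OF this assms] show ?case
    by (simp add: Suc eq)
qed simp

lemma nilpotent_subgroup_iff:
  assumes "subgroup H G"
  shows "nilpotent_group (G\<lparr>carrier := H\<rparr>) \<longleftrightarrow> (\<exists>c. lcs_in G H c \<subseteq> {\<one>})"
proof -
  have "lcs_in G H c \<subseteq> {\<one>} \<longleftrightarrow> lcs_in G H c = {\<one>}" for c
    using subgroup.one_closed[OF lcs_in_subgroup[OF assms]] by blast
  thus ?thesis
    using subgroup.subgroup_is_group[OF assms is_group]
    by (simp add: nilpotent_group_def lcs_subgroup_eq[OF assms])
qed

lemma commutator_lcs_in: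
  "\<lbrakk>x \<in> lcs_in G H n; y \<in> H\<rbrakk> \<Longrightarrow> commutator G x y \<in> lcs_in G H (Suc n)"
  unfolding lcs_in.simps by (rule generate.incl) blast

end

lemma (in group_hom) commutator_img:
  "\<lbrakk>x \<in> carrier G; y \<in> carrier G\<rbrakk> \<Longrightarrow> h (commutator G x y) = commutator H (h x) (h y)"
  by (simp add: commutator_def)

lemma (in group_hom) lcs_in_img:
  assumes "subgroup K G"
  shows "lcs_in H (h ` K) n = h ` lcs_in G K n"
proof (induction n)
  case (Suc n)
  have sub: "lcs_in G K n \<subseteq> carrier G" "K \<subseteq> carrier G"
    using G.lcs_in_subset[OF assms] subgroup.subset[OF assms] by auto
  have "{commutator H x y |x y. x \<in> lcs_in H (h ` K) n \<and> y \<in> h ` K}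
      = {commutator H (h a) (h b) |a b. a \<in> lcs_in G K n \<and> b \<in> K}"
    unfolding Suc by blast
  also have "\<dots> = {h (commutator G a b) |a b. a \<in> lcs_in G K n \<and> b \<in> K}"
    using sub commutator_img by (metis (no_types, opaque_lifting) subsetD)
  also have "\<dots> = h ` {commutator G a b |a b. a \<in> lcs_in G K n \<and> b \<in> K}" by blast
  finally have eq: "{commutator H x y |x y. x \<in> lcs_in H (h ` K) n \<and> y \<in> h ` K} = \<dots>" .
  have "{commutator G a b |a b. a \<in> lcs_in G K n \<and> b \<in> K} \<subseteq> carrier G"
    using sub by (auto intro!: G.commutator_closed)
  from generate_img[OF this] show ?case by (simp add: eq)
qed simp

context group
begin

text \<open>Conjugation by \<open>g\<close> is an endomorphism, so it carries the series of
  \<open>H\<close> to the series of the image of \<open>H\<close>, which lies in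
  \<open>H\<close>.\<close>

lemma lcs_in_conj:
  assumes H: "subgroup H G" and g: "g \<in> carrier G"
    and inv: "\<And>h. h \<in> H \<Longrightarrow> inv g \<otimes> h \<otimes> g \<in> H" and x: "x \<in> lcs_in G H n"
  shows "inv g \<otimes> x \<otimes> g \<in> lcs_in G H n"
proof -
  interpret c: group_hom G G "\<lambda>x. inv g \<otimes> x \<otimes> g" by (rule conj_hom[OF g])
  have "(\<lambda>x. inv g \<otimes> x \<otimes> g) ` lcs_in G H n = lcs_in G ((\<lambda>x. inv g \<otimes> x \<otimes> g) ` H) n"
    by (simp add: c.lcs_in_img[OF H])
  also have "\<dots> \<subseteq> lcs_in G H n" using inv by (intro lcs_in_mono) auto
  finally show ?thesis using x by blast
qed

lemma lcs_in_conj_self: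
  assumes H: "subgroup H G" and "g \<in> H" "x \<in> lcs_in G H n"
  shows "inv g \<otimes> x \<otimes> g \<in> lcs_in G H n"
proof (rule lcs_in_conj[OF H])
  show "g \<in> carrier G" by (rule subgroup.mem_carrier[OF H \<open>g \<in> H\<close>])
  show "inv g \<otimes> h \<otimes> g \<in> H" if "h \<in> H" for h
    using that \<open>g \<in> H\<close> subgroup.m_closed[OF H] subgroup.m_inv_closed[OF H] by simp
qed fact

lemma lcs_in_normal:
  assumes "N \<lhd> G"
  shows "lcs_in G N n \<lhd> G"
proof (rule normal_conjI)
  interpret normal N G by fact
  show "subgroup (lcs_in G N n) G" by (rule lcs_in_subgroup[OF subgroup_axioms])
  show "inv g \<otimes> h \<otimes> g \<in> lcs_in G N n" if "g \<in> carrier G" "h \<in> lcs_in G N n" for g h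
    using that inv_op_closed1 by (intro lcs_in_conj[OF subgroup_axioms])
qed

text \<open>A generating commutator is the inverse of \<open>x\<close> times a conjugate of
  \<open>x\<close> by an element of \<open>H\<close>, and each term is invariant under such
  conjugation.\<close>

lemma lcs_in_Suc_subset:
  assumes H: "subgroup H G"
  shows "lcs_in G H (Suc n) \<subseteq> lcs_in G H n"
proof -
  note sg = lcs_in_subgroup[OF H, of n]
  have "commutator G x y \<in> lcs_in G H n" if "x \<in> lcs_in G H n" "y \<in> H" for x y
  proof -
    have c: "x \<in> carrier G" "y \<in> carrier G"
      using that subgroup.subset[OF H] subgroup.subset[OF sg] by auto
    have "commutator G x y = inv x \<otimes> (inv y \<otimes> x \<otimes> y)" using c by (simp add: word_simps)
    thus ?thesis
      using lcs_in_conj_self[OF H that(2,1)] that(1) subgroup.m_closed[OF sg]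
        subgroup.m_inv_closed[OF sg] by simp
  qed
  thus ?thesis
    unfolding lcs_in.simps by (intro generate_subgroup_incl[OF _ sg]) blast
qed

lemma derived_subset_lcs_in:
  assumes "subgroup H G"
  shows "(derived G ^^ n) H \<subseteq> lcs_in G H n"
proof (induction n)
  case (Suc n)
  have sub: "(derived G ^^ n) H \<subseteq> H" using Suc lcs_in_subset[OF assms] by blast
  note sg = lcs_in_subgroup[OF assms, of "Suc n"]
  have "derived_set G ((derived G ^^ n) H) \<subseteq> lcs_in G H (Suc n)"
  proof safe
    fix x y assume xy: "x \<in> (derived G ^^ n) H" "y \<in> (derived G ^^ n) H"
    have H': "inv x \<in> lcs_in G H n" "inv y \<in> H"
      using xy Suc sub assms lcs_in_subgroup[OF assms, of n] by (auto simp: subgroup.m_inv_closed)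
    have c: "x \<in> carrier G" "y \<in> carrier G" using xy sub subgroup.subset[OF assms] by auto
    \<comment> \<open>\<open>derived_set\<close> uses the commutators \<open>x y x^-1 y^-1\<close>,
      which are values of \<open>commutator\<close> at the inverses.\<close>
    have "commutator G (inv x) (inv y) = x \<otimes> y \<otimes> inv x \<otimes> inv y"
      using c by (simp add: commutator_def)
    thus "x \<otimes> y \<otimes> inv x \<otimes> inv y \<in> lcs_in G H (Suc n)"
      using commutator_lcs_in[OF H'] by metis
  qed
  from generate_subgroup_incl[OF this sg] show ?case by (simp flip: derived_def)
qed simp

lemma nilpotent_imp_derived_trivial:
  assumes "subgroup H G" "nilpotent_group (G\<lparr>carrier := H\<rparr>)"
  shows "\<exists>n. (derived G ^^ n) H \<subseteq> {\<one>}"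
proof -
  obtain c where "lcs_in G H c \<subseteq> {\<one>}" using assms nilpotent_subgroup_iff by blast
  thus ?thesis using derived_subset_lcs_in[OF assms(1), of c] by blast
qed

lemma nilpotent_subgroup_mono:
  assumes "subgroup H G" "subgroup K G" "H \<subseteq> K" "nilpotent_group (G\<lparr>carrier := K\<rparr>)"
  shows "nilpotent_group (G\<lparr>carrier := H\<rparr>)"
proof -
  obtain c where "lcs_in G K c \<subseteq> {\<one>}" using assms nilpotent_subgroup_iff by blast
  hence "lcs_in G H c \<subseteq> {\<one>}" using lcs_in_mono[OF assms(3)] by blast
  thus ?thesis using nilpotent_subgroup_iff[OF assms(1)] by blast
qed

text \<open>The normalizer. Both conjugations are demanded because conjugation by \<open>g\<close>
  can map an infinite \<open>D\<close> properly into itself; this makes the set closed under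
  inverses.\<close>

definition normalizing :: "'a set \<Rightarrow> 'a set" where
  "normalizing D = {g \<in> carrier G. \<forall>d \<in> D. inv g \<otimes> d \<otimes> g \<in> D \<and> g \<otimes> d \<otimes> inv g \<in> D}"

lemma normalizing_subgroup:
  assumes "D \<subseteq> carrier G"
  shows "subgroup (normalizing D) G"
proof (rule subgroupI)
  show "normalizing D \<subseteq> carrier G" by (auto simp: normalizing_def)
  have "\<one> \<in> normalizing D" using assms by (auto simp: normalizing_def subset_iff)
  thus "normalizing D \<noteq> {}" by blast
  fix a b assume a: "a \<in> normalizing D" and b: "b \<in> normalizing D"
  show "inv a \<in> normalizing D" using a by (simp add: normalizing_def)
  have ab: "a \<in> carrier G" "b \<in> carrier G" using a b by (auto simp: normalizing_def)
  have "inv (a \<otimes> b) \<otimes> d \<otimes> (a \<otimes> b) \<in> D \<and> (a \<otimes> b) \<otimes> d \<otimes> inv (a \<otimes> b) \<in> D" if d: "d \<in> D" for d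
  proof -
    have "inv (a \<otimes> b) \<otimes> d \<otimes> (a \<otimes> b) = inv b \<otimes> (inv a \<otimes> d \<otimes> a) \<otimes> b"
      "(a \<otimes> b) \<otimes> d \<otimes> inv (a \<otimes> b) = a \<otimes> (b \<otimes> d \<otimes> inv b) \<otimes> inv a"
      using ab d assms by (simp_all add: m_assoc inv_mult_group subset_iff)
    thus ?thesis using a b d by (simp add: normalizing_def)
  qed
  thus "a \<otimes> b \<in> normalizing D" using ab by (simp add: normalizing_def)
qed

lemma subset_normalizing:
  assumes "subgroup D G"
  shows "D \<subseteq> normalizing D"
proof -
  interpret D: subgroup D G by fact
  show ?thesis by (auto simp: normalizing_def)
qed

lemma normal_if_normalizing:
  assumes "subgroup D G" "normalizing D = carrier G"
  shows "D \<lhd> G"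
  using assms(2) by (intro normal_conjI[OF assms(1)]) (auto simp: normalizing_def)

section \<open>Products of a subgroup with a cyclic group that normalizes it\<close>

definition mult_powers :: "'a set \<Rightarrow> 'a \<Rightarrow> 'a set" where
  "mult_powers E w = {e \<otimes> w [^] (i::int) | e i. e \<in> E}"

text \<open>Every power of \<open>w\<close> normalizes \<open>E\<close>, so powers can be moved past
  elements of \<open>E\<close> in products and inverses.\<close>

lemma mult_powers_subgroup:
  assumes E: "subgroup E G" and w: "w \<in> normalizing E"
  shows "subgroup (mult_powers E w) G"
proof -
  interpret E: subgroup E G by fact
  have wc: "w \<in> carrier G" using w by (simp add: normalizing_def)
  have conj: "w [^] (i::int) \<otimes> e \<otimes> w [^] (- i) \<in> E" if "e \<in> E" for e i
    using subgroup_int_pow_closed[OF normalizing_subgroup[OF E.subset] w, of i] that wc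
    by (simp add: normalizing_def int_pow_neg)
  show ?thesis
  proof (rule subgroupI)
    show "mult_powers E w \<subseteq> carrier G" using wc by (auto simp: mult_powers_def)
    show "mult_powers E w \<noteq> {}" using E.one_closed unfolding mult_powers_def by blast
    fix a b assume "a \<in> mult_powers E w" "b \<in> mult_powers E w"
    then obtain u v and i j :: int where a: "u \<in> E" "a = u \<otimes> w [^] i"
      and b: "v \<in> E" "b = v \<otimes> w [^] j" by (auto simp: mult_powers_def)
    have "a \<otimes> b = u \<otimes> (w [^] i \<otimes> v \<otimes> w [^] (- i)) \<otimes> w [^] (i + j)"
      using a b wc by (simp add: int_pow_mult int_pow_neg m_assoc)
    thus "a \<otimes> b \<in> mult_powers E w"
      using E.m_closed[OF a(1) conj[OF b(1), of i]] unfolding mult_powers_def by blast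
    have "inv a = (w [^] (- i) \<otimes> inv u \<otimes> w [^] (- (- i))) \<otimes> w [^] (- i)"
      using a wc by (simp add: inv_mult_group int_pow_neg m_assoc)
    thus "inv a \<in> mult_powers E w"
      using conj[OF E.m_inv_closed[OF a(1)], of "- i"] unfolding mult_powers_def by blast
  qed
qed

lemma subset_mult_powers:
  assumes "E \<subseteq> carrier G"
  shows "E \<subseteq> mult_powers E w"
proof
  fix e assume "e \<in> E"
  moreover from this have "e = e \<otimes> w [^] (0::int)" using assms by (simp add: subset_iff)
  ultimately show "e \<in> mult_powers E w" unfolding mult_powers_def by blast
qed

lemma mem_mult_powers:
  assumes "subgroup E G" "w \<in> carrier G"
  shows "w \<in> mult_powers E w"
proof -
  have "w = \<one> \<otimes> w [^] (1::int)" using assms(2) by (simp add: int_pow_1)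
  thus ?thesis using subgroup.one_closed[OF assms(1)] unfolding mult_powers_def by blast
qed

text \<open>The only consequence of being para-Nil-Hamiltonian that the proof uses; unlike the
  original property it passes to all quotients.\<close>
definition non_nilpotent_overgroups_normal :: bool where
  "non_nilpotent_overgroups_normal \<longleftrightarrow>
     (\<forall>H K. subgroup H G \<and> subgroup K G \<and> K \<subset> H \<and> \<not> nilpotent_group (G\<lparr>carrier := K\<rparr>)
        \<longrightarrow> H \<lhd> G)"

text \<open>If \<open>H\<close> were not normal, it would be nilpotent or minimal non-nilpotent, and
  in both cases its proper subgroup \<open>K\<close> would be nilpotent.\<close>

lemma para_Nil_Hamiltonian_imp_overgroups_normal:
  assumes "para_Nil_Hamiltonian G"
  shows non_nilpotent_overgroups_normal
  unfolding non_nilpotent_overgroups_normal_def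
proof (intro allI impI, elim conjE)
  fix H K assume H: "subgroup H G" and K: "subgroup K G" and KH: "K \<subset> H"
    and nn: "\<not> nilpotent_group (G\<lparr>carrier := K\<rparr>)"
  show "H \<lhd> G"
  proof (rule ccontr)
    assume "\<not> H \<lhd> G"
    moreover have "\<not> nilpotent_group (G\<lparr>carrier := H\<rparr>)"
      using nn nilpotent_subgroup_mono[OF K H] KH by blast
    ultimately have "minimal_non_nilpotent (G\<lparr>carrier := H\<rparr>)"
      using assms H by (auto simp: para_Nil_Hamiltonian_def)
    moreover have "subgroup K (G\<lparr>carrier := H\<rparr>)"
      using KH by (intro subgroup_incl K H) blast
    ultimately show False
      using nn KH by (auto simp: minimal_non_nilpotent_def)
  qed
qed

end

section \<open>Nilpotency and the overgroup property under homomorphisms\<close>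

context group_hom
begin

lemma nilpotent_img:
  assumes "subgroup K G" "nilpotent_group (G\<lparr>carrier := K\<rparr>)"
  shows "nilpotent_group (H\<lparr>carrier := h ` K\<rparr>)"
proof -
  obtain c where "lcs_in G K c \<subseteq> {\<one>}" using assms G.nilpotent_subgroup_iff by blast
  hence "lcs_in H (h ` K) c \<subseteq> {\<one>\<^bsub>H\<^esub>}" by (auto simp: lcs_in_img[OF assms(1)])
  thus ?thesis
    using H.nilpotent_subgroup_iff[OF subgroup_img_is_subgroup[OF assms(1)]] by blast
qed

lemma preimage_subgroup:
  assumes "subgroup K H"
  shows "subgroup {x \<in> carrier G. h x \<in> K} G"
proof -
  interpret K: subgroup K H by fact
  show ?thesis by (rule G.subgroupI) (auto intro: exI[of _ \<one>])
qed

lemma image_preimage: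
  assumes "h ` carrier G = carrier H" "subgroup K H"
  shows "h ` {x \<in> carrier G. h x \<in> K} = K"
proof -
  have "K \<subseteq> h ` carrier G" using assms(1) subgroup.subset[OF assms(2)] by simp
  thus ?thesis by blast
qed

text \<open>Argue with preimages: the preimage of \<open>K\<close> is not nilpotent since its image
  \<open>K\<close> is not, and surjectivity keeps the inclusion strict and sends normal subgroups to
  normal subgroups.\<close>

lemma overgroups_normal_img:
  assumes surj: "h ` carrier G = carrier H" and "G.non_nilpotent_overgroups_normal"
  shows "H.non_nilpotent_overgroups_normal"
  unfolding H.non_nilpotent_overgroups_normal_def
proof (intro allI impI, elim conjE)
  fix L K assume L: "subgroup L H" and K: "subgroup K H" and KL: "K \<subset> L"
    and nn: "\<not> nilpotent_group (H\<lparr>carrier := K\<rparr>)"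
  let ?p = "\<lambda>K. {x \<in> carrier G. h x \<in> K}"
  have "\<not> nilpotent_group (G\<lparr>carrier := ?p K\<rparr>)"
    using nilpotent_img[OF preimage_subgroup[OF K]] image_preimage[OF surj K] nn by auto
  moreover have "?p K \<subset> ?p L"
  proof
    show "?p K \<subseteq> ?p L" using KL by blast
    have "h ` ?p K \<noteq> h ` ?p L"
      unfolding image_preimage[OF surj K] image_preimage[OF surj L] using KL by (rule less_imp_neq)
    thus "?p K \<noteq> ?p L" by metis
  qed
  ultimately have "?p L \<lhd> G"
    using assms(2) preimage_subgroup[OF K] preimage_subgroup[OF L]
    unfolding G.non_nilpotent_overgroups_normal_def by blast
  from normal.surj_hom_normal_subgroup[OF this group_hom_axioms surj]
  show "L \<lhd> H" by (simp add: image_preimage[OF surj L])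
qed

end

section \<open>Finitely generated abelian groups\<close>

context comm_group
begin

text \<open>The products \<open>a [^] i \<otimes> c\<close> already form a subgroup. This
  decomposition drives the inductions on the generating set below.\<close>

lemma generate_insert_decomp:
  assumes a: "a \<in> carrier G" and S: "S \<subseteq> carrier G" and x: "x \<in> generate G (insert a S)"
  obtains i :: int and c where "c \<in> generate G S" "x = a [^] i \<otimes> c"
proof -
  interpret C: subgroup "generate G S" G by (rule generate_is_subgroup[OF S])
  let ?T = "{a [^] (i :: int) \<otimes> c | i c. c \<in> generate G S}"
  have "subgroup ?T G"
  proof (rule subgroupI)
    show "?T \<subseteq> carrier G" using a by auto
    show "?T \<noteq> {}" using C.one_closed by blast
    fix u v assume "u \<in> ?T" "v \<in> ?T"
    then obtain i j c d where u: "u = a [^] (i :: int) \<otimes> c" "c \<in> generate G S"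
      and v: "v = a [^] (j :: int) \<otimes> d" "d \<in> generate G S" by blast
    have "inv u = a [^] (- i) \<otimes> inv c"
      using u a by (simp add: inv_mult int_pow_neg)
    thus "inv u \<in> ?T" using u by blast
    have "u \<otimes> v = a [^] (i + j) \<otimes> (c \<otimes> d)"
      using u v a by (simp add: int_pow_mult m_ac)
    thus "u \<otimes> v \<in> ?T" using u v by blast
  qed
  moreover have "insert a S \<subseteq> ?T"
  proof -
    have "a = a [^] (1 :: int) \<otimes> \<one>" using a by (simp add: int_pow_1)
    moreover have "s = a [^] (0 :: int) \<otimes> s" if "s \<in> S" for s using that S by auto
    ultimately show ?thesis using C.one_closed generate.incl[of _ S G] by blast
  qed
  ultimately have "generate G (insert a S) \<subseteq> ?T" by (rule generate_subgroup_incl[rotated])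
  with x that show ?thesis by blast
qed

lemma int_pow_distrib:
  "\<lbrakk>x \<in> carrier G; y \<in> carrier G\<rbrakk> \<Longrightarrow> (x \<otimes> y) [^] (i :: int) = x [^] i \<otimes> y [^] i"
  by (rule int_pow_mult_distrib) (auto simp: m_comm)

lemma abs_pow_mem:
  assumes "subgroup C G" "a \<in> carrier G" "a [^] (i :: int) \<in> C"
  shows "a [^] nat \<bar>i\<bar> \<in> C"
proof -
  have "a [^] int (nat \<bar>i\<bar>) \<in> C"
    using assms subgroup.m_inv_closed[OF assms(1) assms(3)] by (cases "i \<ge> 0") (auto simp: int_pow_neg)
  thus ?thesis by (simp add: int_pow_int)
qed

text \<open>The newest generator \<open>a\<close> is redundant. A square root of \<open>a\<close>
  shows that a power of \<open>a\<close> with odd, hence nonzero, exponent lies in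
  \<open>generate G S\<close>; with \<open>r\<close> the absolute value of that exponent, an
  \<open>r\<close>-th root of \<open>a\<close> then puts \<open>a\<close> itself there.\<close>

lemma fg_divisible_trivial:
  assumes "finite S" "S \<subseteq> carrier G"
    and "\<And>(m :: nat) d. \<lbrakk>m > 0; d \<in> generate G S\<rbrakk> \<Longrightarrow> \<exists>e \<in> generate G S. e [^] m = d"
  shows "generate G S = {\<one>}"
  using assms
proof (induction S rule: finite_induct)
  case empty
  show ?case by (rule generate_empty)
next
  case (insert a S)
  hence a: "a \<in> carrier G" and S: "S \<subseteq> carrier G" by auto
  interpret C: subgroup "generate G S" G by (rule generate_is_subgroup[OF S])
  have aD: "a \<in> generate G (insert a S)" by (simp add: generate.incl)
  obtain e where e: "e \<in> generate G (insert a S)" "e [^] (2::nat) = a"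
    using insert.prems(2)[OF _ aD, of 2] by auto
  obtain s c where c: "c \<in> generate G S" "e = a [^] (s::int) \<otimes> c"
    using generate_insert_decomp[OF a S e(1)] .
  have "a = e [^] (2::int)" using e(2) by (simp flip: int_pow_int)
  also have "\<dots> = a [^] (s * 2) \<otimes> c [^] (2::int)"
    using a c by (simp add: int_pow_distrib int_pow_pow)
  finally have "a = a [^] (s * 2) \<otimes> c [^] (2::int)" .
  hence "a [^] (- (s * 2)) \<otimes> a = c [^] (2::int)"
    using a c by (metis C.mem_carrier int_pow_closed int_pow_neg inv_mult_cancel(1))
  moreover have "a [^] (- (s * 2)) \<otimes> a = a [^] (1 - s * 2)"
    using a int_pow_mult[OF a, of "- (s * 2)" 1] by (simp add: int_pow_1)
  ultimately have "a [^] (1 - s * 2) \<in> generate G S"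
    using c subgroup_int_pow_closed[OF C.subgroup_axioms] by simp
  hence r: "a [^] nat \<bar>1 - s * 2\<bar> \<in> generate G S"
    by (rule abs_pow_mem[OF C.subgroup_axioms a])
  define r where "r = nat \<bar>1 - s * 2\<bar>"
  have "1 - s * 2 \<noteq> 0" by presburger
  hence "r > 0" by (simp add: r_def)
  then obtain f where f: "f \<in> generate G (insert a S)" "f [^] r = a"
    using insert.prems(2)[OF _ aD] by blast
  obtain u c' where c': "c' \<in> generate G S" "f = a [^] (u::int) \<otimes> c'"
    using generate_insert_decomp[OF a S f(1)] .
  have "a = f [^] int r" using f(2) by (simp add: int_pow_int)
  also have "\<dots> = (a [^] int r) [^] u \<otimes> c' [^] int r"
    using a c' by (simp add: int_pow_distrib int_pow_pow mult.commute)
  also have "\<dots> \<in> generate G S"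
    using r c' subgroup_int_pow_closed[OF C.subgroup_axioms]
    by (intro C.m_closed) (simp_all add: int_pow_int r_def)
  finally have "insert a S \<subseteq> generate G S" using generate.incl[of _ S G] by blast
  hence "generate G (insert a S) \<subseteq> generate G S"
    by (rule generate_subgroup_incl[OF _ C.subgroup_axioms])
  hence eq: "generate G (insert a S) = generate G S" using mono_generate[of S "insert a S"] by blast
  show ?case using insert.IH[OF S] insert.prems(2) unfolding eq by blast
qed

text \<open>If some positive power \<open>b [^] r\<close> lies in \<open>generate G S\<close>, then
  so does every \<open>r\<close>-th power, and \<open>r * t\<close> serves. Otherwise the exponent
  of \<open>b\<close> in a torsion element is zero, and the old \<open>t\<close> serves.\<close>

lemma fg_torsion_bounded:
  assumes "finite S" "S \<subseteq> carrier G"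
  shows "\<exists>t::nat > 0. \<forall>a \<in> generate G S. \<forall>q::nat > 0. a [^] q = \<one> \<longrightarrow> a [^] t = \<one>"
  using assms
proof (induction S rule: finite_induct)
  case empty
  have "\<forall>a \<in> generate G {}. \<forall>q::nat > 0. a [^] q = \<one> \<longrightarrow> a [^] (1::nat) = \<one>"
    by (simp add: generate_empty)
  thus ?case using zero_less_one by blast
next
  case (insert b S)
  hence b: "b \<in> carrier G" and S: "S \<subseteq> carrier G" by auto
  interpret C: subgroup "generate G S" G by (rule generate_is_subgroup[OF S])
  obtain t :: nat where t: "t > 0"
    "\<And>a q. \<lbrakk>a \<in> generate G S; (q::nat) > 0; a [^] q = \<one>\<rbrakk> \<Longrightarrow> a [^] t = \<one>"
    using insert.IH[OF S] by blast
  show ?case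
  proof (cases "\<exists>r::nat > 0. b [^] r \<in> generate G S")
    case True
    then obtain r :: nat where r: "r > 0" "b [^] r \<in> generate G S" by blast
    have "a [^] (r * t) = \<one>" if a: "a \<in> generate G (insert b S)" and q: "(q::nat) > 0" "a [^] q = \<one>" for a q
    proof -
      obtain i c where c: "c \<in> generate G S" "a = b [^] (i::int) \<otimes> c"
        using generate_insert_decomp[OF b S a] .
      have ac: "a \<in> carrier G" using b c by simp
      have "a [^] r = (b [^] int r) [^] i \<otimes> c [^] int r"
        using b c by (simp add: int_pow_distrib int_pow_pow mult.commute flip: int_pow_int)
      also have "\<dots> \<in> generate G S"
        using subgroup_int_pow_closed[OF C.subgroup_axioms r(2), of i]
          subgroup_int_pow_closed[OF C.subgroup_axioms c(1), of "int r"]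
        by (intro C.m_closed) (simp_all add: int_pow_int)
      finally have "a [^] r \<in> generate G S" .
      moreover have "(a [^] r) [^] q = \<one>" 
        using ac q by (metis mult.commute nat_pow_one nat_pow_pow)
      ultimately have "(a [^] r) [^] t = \<one>" using t(2) q(1) by blast
      thus ?thesis using ac by (simp add: nat_pow_pow)
    qed
    thus ?thesis using r(1) t(1) by (intro exI[of _ "r * t"]) auto
  next
    case False
    have "a \<in> generate G S" if a: "a \<in> generate G (insert b S)" and q: "(q::nat) > 0" "a [^] q = \<one>" for a q
    proof -
      obtain i c where c: "c \<in> generate G S" "a = b [^] (i::int) \<otimes> c"
        using generate_insert_decomp[OF b S a] .
      have "\<one> = a [^] int q" using q by (simp add: int_pow_int)
      also have "\<dots> = b [^] (i * int q) \<otimes> c [^] int q"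
        using b c by (simp add: int_pow_distrib int_pow_pow)
      finally have "inv (b [^] (i * int q)) = c [^] int q"
        using b c by (metis C.mem_carrier int_pow_closed inv_equality inv_inv inv_closed)
      hence "b [^] (i * int q) = inv (c [^] int q)"
        using b by (metis int_pow_closed inv_inv)
      hence "b [^] (i * int q) \<in> generate G S"
        using c subgroup_int_pow_closed[OF C.subgroup_axioms] by simp
      hence "b [^] nat \<bar>i * int q\<bar> \<in> generate G S"
        by (rule abs_pow_mem[OF C.subgroup_axioms b])
      with False have "\<not> nat \<bar>i * int q\<bar> > 0" by metis
      hence "i = 0" using q(1) by simp
      thus ?thesis using c by simp
    qed
    thus ?thesis using t by blast
  qed
qed

lemma fg_torsion_finite:
  assumes "finite S" "S \<subseteq> carrier G" "\<And>a. a \<in> S \<Longrightarrow> \<exists>q::nat > 0. a [^] q = \<one>"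
  shows "finite (generate G S)"
  using assms
proof (induction S rule: finite_induct)
  case empty
  show ?case by (simp add: generate_empty)
next
  case (insert b S)
  hence b: "b \<in> carrier G" and S: "S \<subseteq> carrier G" by auto
  obtain q :: nat where q: "q > 0" "b [^] q = \<one>" using insert.prems by blast
  have "generate G (insert b S) \<subseteq> (\<lambda>(i, c). b [^] i \<otimes> c) ` ({..<q} \<times> generate G S)"
  proof
    fix x assume "x \<in> generate G (insert b S)"
    then obtain i c where c: "c \<in> generate G S" "x = b [^] (i::int) \<otimes> c"
      using generate_insert_decomp[OF b S] by blast
    have "b [^] i = b [^] (int q * (i div int q) + i mod int q)" by simp
    also have "\<dots> = (b [^] int q) [^] (i div int q) \<otimes> b [^] (i mod int q)"
      using b by (simp only: int_pow_mult int_pow_pow)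
    also have "b [^] int q = \<one>" using q by (simp add: int_pow_int)
    also have "b [^] (i mod int q) = b [^] nat (i mod int q)"
      using q(1) by (simp flip: int_pow_int)
    finally have "b [^] i = b [^] nat (i mod int q)" using b by (simp add: int_pow_one)
    moreover have "nat (i mod int q) < q"
      using q(1) by (simp add: nat_less_iff)
    ultimately show "x \<in> (\<lambda>(i, c). b [^] i \<otimes> c) ` ({..<q} \<times> generate G S)"
      using c by force
  qed
  moreover have "finite (generate G S)" using insert by auto
  ultimately show ?case using finite_subset by fastforce
qed

text \<open>Division of each exponent by \<open>t\<close> leaves a remainder below \<open>t\<close>,
  so finitely many products of remainders suffice.\<close>

lemma fg_finite_mod_powers:
  assumes "finite S" "S \<subseteq> carrier G" "(t::nat) > 0"
  shows "\<exists>R. finite R \<and> R \<subseteq> carrier G \<and>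
    (\<forall>a \<in> generate G S. \<exists>b \<in> generate G S. \<exists>r \<in> R. a = b [^] t \<otimes> r)"
  using assms
proof (induction S rule: finite_induct)
  case empty
  show ?case by (rule exI[of _ "{\<one>}"]) (simp add: generate_empty)
next
  case (insert b S)
  hence b: "b \<in> carrier G" and S: "S \<subseteq> carrier G" by auto
  interpret C: subgroup "generate G S" G by (rule generate_is_subgroup[OF S])
  interpret D: subgroup "generate G (insert b S)" G
    using b S by (intro generate_is_subgroup) auto
  obtain R where R: "finite R" "R \<subseteq> carrier G"
    "\<And>a. a \<in> generate G S \<Longrightarrow> \<exists>b \<in> generate G S. \<exists>r \<in> R. a = b [^] t \<otimes> r"
    using insert.IH[OF S insert.prems(2)] by blast
  let ?R = "(\<lambda>(i, r). b [^] (i::nat) \<otimes> r) ` ({..<t} \<times> R)"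
  have "\<exists>e \<in> generate G (insert b S). \<exists>r \<in> ?R. x = e [^] t \<otimes> r"
    if "x \<in> generate G (insert b S)" for x
  proof -
    from that obtain i c where c: "c \<in> generate G S" "x = b [^] (i::int) \<otimes> c"
      using generate_insert_decomp[OF b S] by blast
    obtain d r where d: "d \<in> generate G S" "r \<in> R" "c = d [^] t \<otimes> r" using R(3)[OF c(1)] by blast
    have rc: "r \<in> carrier G" "d \<in> carrier G" using d R by auto
    have "b [^] i = b [^] ((i div int t) * int t + i mod int t)" by simp
    also have "\<dots> = (b [^] (i div int t)) [^] int t \<otimes> b [^] (i mod int t)"
      using b by (simp only: int_pow_mult int_pow_pow)
    also have "b [^] (i mod int t) = b [^] nat (i mod int t)"
      using insert.prems(2) by (simp flip: int_pow_int)
    finally have "b [^] i = (b [^] (i div int t)) [^] t \<otimes> b [^] nat (i mod int t)"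
      by (simp add: int_pow_int)
    hence "x = (b [^] (i div int t) \<otimes> d) [^] t \<otimes> (b [^] nat (i mod int t) \<otimes> r)"
      using b d c rc by (simp add: pow_mult_distrib[OF m_comm] m_ac)
    moreover have "b [^] (i div int t) \<otimes> d \<in> generate G (insert b S)"
      using d mono_generate[of S "insert b S"] generate.incl[of b "insert b S" G]
        subgroup_int_pow_closed[OF D.subgroup_axioms] by (intro D.m_closed) auto
    moreover have "b [^] nat (i mod int t) \<otimes> r \<in> ?R"
    proof -
      have "nat (i mod int t) < t" using insert.prems(2) by (simp add: nat_less_iff)
      thus ?thesis using d(2) by (intro image_eqI[of _ _ "(nat (i mod int t), r)"]) auto
    qed
    ultimately show ?thesis by blast
  qed
  moreover have "finite ?R" "?R \<subseteq> carrier G" using R b by auto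
  ultimately show ?case by (intro exI[of _ ?R]) blast
qed

end

section \<open>Elements acting with finite order\<close>

lemma (in group) subgroup_nat_pow_closed:
  assumes "subgroup H G" "h \<in> H"
  shows "h [^] (n::nat) \<in> H"
  using subgroup_int_pow_closed[OF assms, of "int n"] by (simp add: int_pow_int)

text \<open>Conjugation by \<open>x\<close> makes \<open>A\<close> a module over a cyclic group
  whose order divides \<open>k\<close>. The element \<open>x\<close> itself may have infinite
  order.\<close>

locale finite_order_action = group +
  fixes A :: "'a set" and x :: 'a and k :: nat
  assumes normal: "A \<lhd> G"
    and comm: "\<And>a b. \<lbrakk>a \<in> A; b \<in> A\<rbrakk> \<Longrightarrow> a \<otimes> b = b \<otimes> a"
    and torsion_free: "\<And>a q. \<lbrakk>a \<in> A; (q::nat) > 0; a [^] q = \<one>\<rbrakk> \<Longrightarrow> a = \<one>"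
    and x_closed [simp]: "x \<in> carrier G"
    and k_pos: "k > 0"
    and pow_centralizes: "\<And>a. a \<in> A \<Longrightarrow> x [^] k \<otimes> a = a \<otimes> x [^] k"
begin

sublocale A: normal A G by (rule normal)

sublocale GA: comm_group "G\<lparr>carrier := A\<rparr>"
  by (rule group.group_comm_groupI[OF A.subgroup_is_group[OF is_group]]) (simp add: comm)

text \<open>In module notation \<open>\<delta>\<close> is \<open>x - 1\<close>, and its image
  \<open>D\<close> is \<open>[A, x]\<close>.\<close>

abbreviation "\<delta> a \<equiv> commutator G a x"

definition D where "D = \<delta> ` A"

definition conj_pow where "conj_pow j a = inv (x [^] (j::nat)) \<otimes> a \<otimes> x [^] j"

lemma conj_closed: "a \<in> A \<Longrightarrow> inv x \<otimes> a \<otimes> x \<in> A"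
  by (simp add: A.inv_op_closed1)

lemma \<delta>_closed: "a \<in> A \<Longrightarrow> \<delta> a \<in> A"
  using conj_closed[of a] by (simp add: commutator_def m_assoc)

lemma D_subset: "D \<subseteq> A"
  by (auto simp: D_def \<delta>_closed)

lemma D_carrier [simp]: "d \<in> D \<Longrightarrow> d \<in> carrier G"
  using D_subset A.subset by blast

lemma \<delta>_hom: "group_hom (G\<lparr>carrier := A\<rparr>) (G\<lparr>carrier := A\<rparr>) \<delta>"
proof (unfold_locales, rule homI)
  fix a b assume "a \<in> carrier (G\<lparr>carrier := A\<rparr>)" "b \<in> carrier (G\<lparr>carrier := A\<rparr>)"
  hence ab: "a \<in> A" "b \<in> A" by auto
  have "\<delta> (a \<otimes> b) = inv b \<otimes> \<delta> a \<otimes> inv x \<otimes> b \<otimes> x"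
    using ab by (simp add: word_simps)
  also have "\<dots> = \<delta> a \<otimes> inv b \<otimes> inv x \<otimes> b \<otimes> x"
    using comm[OF \<delta>_closed[OF ab(1)], of "inv b"] ab by simp
  also have "\<dots> = \<delta> a \<otimes> \<delta> b" using ab by (simp add: word_simps)
  finally show "\<delta> (a \<otimes>\<^bsub>G\<lparr>carrier := A\<rparr>\<^esub> b) = \<delta> a \<otimes>\<^bsub>G\<lparr>carrier := A\<rparr>\<^esub> \<delta> b" by simp
qed (simp add: \<delta>_closed)

lemma D_subgroup: "subgroup D G"
proof -
  interpret d: group_hom "G\<lparr>carrier := A\<rparr>" "G\<lparr>carrier := A\<rparr>" \<delta> by (rule \<delta>_hom)
  have "subgroup D (G\<lparr>carrier := A\<rparr>)"
    using d.img_is_subgroup by (simp add: D_def)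
  thus ?thesis using A.subgroup_axioms incl_subgroup by blast
qed

sublocale D: subgroup D G by (rule D_subgroup)

lemma conj_D: "d \<in> D \<Longrightarrow> inv x \<otimes> d \<otimes> x \<in> D"
proof -
  assume "d \<in> D"
  then obtain a where a: "a \<in> A" "d = \<delta> a" by (auto simp: D_def)
  have "inv x \<otimes> d \<otimes> x = \<delta> (inv x \<otimes> a \<otimes> x)" using a by (simp add: word_simps)
  thus ?thesis using conj_closed[OF a(1)] by (auto simp: D_def)
qed

text \<open>The partial norm \<open>1 + x + ... + x^(j-1)\<close> of the group ring, applied to
  \<open>d\<close>; for \<open>j = k\<close> it is the norm.\<close>

primrec norm_upto :: "nat \<Rightarrow> 'a \<Rightarrow> 'a" where
  "norm_upto 0 d = \<one>"
| "norm_upto (Suc j) d = norm_upto j d \<otimes> conj_pow j d"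

lemma conj_pow_Suc:
  "a \<in> carrier G \<Longrightarrow> conj_pow (Suc j) a = inv x \<otimes> conj_pow j a \<otimes> x"
  by (simp add: conj_pow_def word_simps)

text \<open>The telescoping identity
  \<open>(1 + x + ... + x^(j-1)) (x - 1) = x^j - 1\<close>.\<close>

lemma norm_upto_\<delta>:
  assumes "a \<in> A"
  shows "norm_upto j (\<delta> a) = inv a \<otimes> conj_pow j a"
proof (induction j)
  case (Suc j)
  have "conj_pow j (\<delta> a) = inv (conj_pow j a) \<otimes> conj_pow (Suc j) a"
    unfolding conj_pow_def nat_pow_Suc2[OF x_closed] using assms by (simp add: word_simps)
  moreover have "conj_pow i a \<in> carrier G" for i using assms by (simp add: conj_pow_def)
  ultimately show ?case using assms Suc by (simp add: m_assoc)
qed (use assms in \<open>simp add: conj_pow_def\<close>)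

lemma norm_trivial:
  assumes "d \<in> D" shows "norm_upto k d = \<one>"
proof -
  obtain a where a: "a \<in> A" "d = \<delta> a" using assms by (auto simp: D_def)
  have "conj_pow k a = a"
    using a pow_centralizes[OF a(1)] by (simp add: conj_pow_def m_assoc flip: pow_centralizes)
  thus ?thesis using a norm_upto_\<delta>[OF a(1)] by simp
qed

text \<open>Modulo the invariant subgroup \<open>E\<close> the element \<open>x\<close> fixes
  \<open>d\<close>, so the norm of \<open>d\<close> is \<open>d [^] k\<close> up to a factor from
  \<open>E\<close>; on \<open>D\<close> the norm vanishes.\<close>

lemma pow_k_mem:
  assumes E: "subgroup E G" "E \<subseteq> A" and inv: "\<And>e. e \<in> E \<Longrightarrow> inv x \<otimes> e \<otimes> x \<in> E"
    and d: "d \<in> D" "\<delta> d \<in> E"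
  shows "d [^] k \<in> E"
proof -
  interpret E: subgroup E G by fact
  have dA: "d \<in> A" using d D_subset by blast
  have conj: "\<exists>e \<in> E. conj_pow j d = d \<otimes> e" for j
  proof (induction j)
    case (Suc j)
    then obtain e where e: "e \<in> E" "conj_pow j d = d \<otimes> e" by blast
    have "conj_pow (Suc j) d = d \<otimes> (\<delta> d \<otimes> (inv x \<otimes> e \<otimes> x))"
      using d e by (simp add: conj_pow_Suc word_simps)
    thus ?case using d(2) inv[OF e(1)] by blast
  qed (use d in \<open>auto simp: conj_pow_def intro!: bexI[of _ \<one>]\<close>)
  have "\<exists>e \<in> E. norm_upto j d = d [^] j \<otimes> e" for j
  proof (induction j)
    case (Suc j)
    then obtain e where e: "e \<in> E" "norm_upto j d = d [^] j \<otimes> e" by blast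
    obtain f where f: "f \<in> E" "conj_pow j d = d \<otimes> f" using conj by blast
    have "e \<otimes> d = d \<otimes> e" using comm dA e E by blast
    hence "e \<otimes> (d \<otimes> f) = d \<otimes> (e \<otimes> f)" using d e f by (simp flip: m_assoc)
    hence "norm_upto (Suc j) d = d [^] Suc j \<otimes> (e \<otimes> f)"
      using d e f by (simp add: m_assoc)
    thus ?case using e f by blast
  qed (auto intro!: bexI[of _ \<one>])
  then obtain e where "e \<in> E" "d [^] k \<otimes> e = \<one>" using norm_trivial[OF d(1)] by metis
  hence "d [^] k = inv e" using d by (simp add: inv_equality)
  thus ?thesis using \<open>e \<in> E\<close> by simp
qed

text \<open>The case of trivial \<open>E\<close> in \<open>pow_k_mem\<close>, combined with
  torsion-freeness.\<close>

lemma D_fixed_trivial: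
  assumes "d \<in> D" "d \<otimes> x = x \<otimes> d"
  shows "d = \<one>"
proof -
  have "\<delta> d = \<one>" using assms by (simp add: commutator_eq_one_iff)
  hence "d [^] k \<in> {\<one>}"
    by (intro pow_k_mem) (use assms in \<open>auto simp: triv_subgroup\<close>)
  thus ?thesis using torsion_free[of d k] assms(1) D_subset k_pos by blast
qed

section \<open>The power subgroups \<open>Dpow m\<close> of \<open>D\<close> and their products with
  the powers of \<open>x\<close>\<close>

definition Dpow where "Dpow m = (\<lambda>d. d [^] (m::nat)) ` D"

lemma D_pow_distrib: "\<lbrakk>d \<in> D; e \<in> D\<rbrakk> \<Longrightarrow> (d \<otimes> e) [^] (m::nat) = d [^] m \<otimes> e [^] m"
  using D_subset by (intro pow_mult_distrib comm) auto

lemma D_pow_inj: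
  assumes "d \<in> D" "e \<in> D" "d [^] m = e [^] m" "(m::nat) > 0"
  shows "d = e"
proof -
  have "(d \<otimes> inv e) [^] m = e [^] m \<otimes> (inv e) [^] m"
    using assms by (simp add: D_pow_distrib)
  also have "\<dots> = \<one>" using assms by (simp add: nat_pow_inv)
  finally have "d \<otimes> inv e = \<one>"
    using torsion_free[of "d \<otimes> inv e" m] assms D_subset D.m_closed D.m_inv_closed by blast
  thus ?thesis using assms by (metis D_carrier inv_closed inv_equality inv_inv)
qed

lemma Dpow_subset: "Dpow m \<subseteq> D"
  by (auto simp: Dpow_def subgroup_nat_pow_closed[OF D_subgroup])

lemma Dpow_mem_D: "u \<in> Dpow m \<Longrightarrow> u \<in> D"
  using Dpow_subset by blast

lemma Dpow_subgroup: "subgroup (Dpow m) G"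
proof (rule subgroupI)
  show "Dpow m \<subseteq> carrier G" using Dpow_subset D.subset by blast
  show "Dpow m \<noteq> {}" using D.one_closed unfolding Dpow_def by blast
  fix u v assume "u \<in> Dpow m" "v \<in> Dpow m"
  then obtain d e where d: "d \<in> D" "u = d [^] m" and e: "e \<in> D" "v = e [^] m"
    by (auto simp: Dpow_def)
  have "u \<otimes> v = (d \<otimes> e) [^] m" using d e by (simp add: D_pow_distrib)
  thus "u \<otimes> v \<in> Dpow m" using d e unfolding Dpow_def by blast
  have "inv u = (inv d) [^] m" using d by (simp add: nat_pow_inv)
  thus "inv u \<in> Dpow m" using d unfolding Dpow_def by blast
qed

lemma conj_Dpow: "u \<in> Dpow m \<Longrightarrow> inv x \<otimes> u \<otimes> x \<in> Dpow m"
proof -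
  interpret c: group_hom G G "\<lambda>a. inv x \<otimes> a \<otimes> x" by (rule conj_hom) simp
  assume "u \<in> Dpow m"
  then obtain d where d: "d \<in> D" "u = d [^] m" by (auto simp: Dpow_def)
  have "inv x \<otimes> u \<otimes> x = (inv x \<otimes> d \<otimes> x) [^] m" using d c.hom_nat_pow by auto
  thus ?thesis using conj_D[OF d(1)] unfolding Dpow_def by blast
qed

text \<open>As \<open>x [^] k\<close> centralizes \<open>A\<close>, conjugation by the inverse of
  \<open>x\<close> agrees on \<open>A\<close> with the \<open>k - 1\<close> fold conjugation by
  \<open>x\<close>, which preserves \<open>Dpow m\<close>.\<close>

lemma conj_inv_Dpow:
  assumes "u \<in> Dpow m"
  shows "x \<otimes> u \<otimes> inv x \<in> Dpow m"
proof -
  have conj: "conj_pow j u \<in> Dpow m" for j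
  proof (induction j)
    case (Suc j)
    have "u \<in> carrier G" using Dpow_mem_D[OF assms] by simp
    thus ?case using conj_Dpow[OF Suc] by (simp add: conj_pow_Suc)
  qed (use assms Dpow_mem_D[OF assms] in \<open>simp add: conj_pow_def\<close>)
  obtain j where j: "k = Suc j" using k_pos gr0_implies_Suc by blast
  have u: "u \<in> A" "u \<in> carrier G" using Dpow_mem_D[OF assms] D_subset by auto
  have xu: "x \<otimes> u \<otimes> inv x \<in> A" using u A.inv_op_closed2 by simp
  have "conj_pow j u = conj_pow k (x \<otimes> u \<otimes> inv x)"
    unfolding j conj_pow_def nat_pow_Suc2[OF x_closed] using u by (simp add: word_simps)
  also have "\<dots> = x \<otimes> u \<otimes> inv x"
    using xu u by (simp add: conj_pow_def m_assoc flip: pow_centralizes)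
  finally show ?thesis using conj by metis
qed

lemma x_normalizing: "x \<in> normalizing (Dpow m)"
  using conj_Dpow conj_inv_Dpow by (simp add: normalizing_def)

definition Dx where "Dx m = mult_powers (Dpow m) x"

lemma Dx_subgroup: "subgroup (Dx m) G"
  unfolding Dx_def by (rule mult_powers_subgroup[OF Dpow_subgroup x_normalizing])

lemma Dpow_subset_Dx: "Dpow m \<subseteq> Dx m"
  unfolding Dx_def by (rule subset_mult_powers[OF subgroup.subset[OF Dpow_subgroup]])

lemma x_mem_Dx: "x \<in> Dx m"
  unfolding Dx_def by (rule mem_mult_powers[OF Dpow_subgroup x_closed])

text \<open>A power of \<open>x\<close> that lies in \<open>D\<close> commutes with
  \<open>x\<close>, so it is trivial by \<open>D_fixed_trivial\<close>.\<close>

lemma Dx_inter_D: "Dx m \<inter> D = Dpow m"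
proof (intro equalityI subsetI)
  fix d assume "d \<in> Dx m \<inter> D"
  then obtain u and i :: int where u: "u \<in> Dpow m" "d = u \<otimes> x [^] i" and d: "d \<in> D"
    by (auto simp: Dx_def mult_powers_def)
  have uD: "u \<in> D" using u Dpow_subset by blast
  have "x [^] i = inv u \<otimes> d" using u uD by simp
  hence "x [^] i \<in> D" using uD d by simp
  moreover have "x [^] i \<otimes> x = x \<otimes> x [^] i"
    by (metis add.commute int_pow_1 int_pow_mult x_closed)
  ultimately have "x [^] i = \<one>" by (rule D_fixed_trivial)
  thus "d \<in> Dpow m" using u uD by simp
qed (use Dpow_subset Dpow_subset_Dx in auto)

text \<open>Commutation with \<open>x\<close> maps \<open>D\<close> into itself and kills no
  nontrivial element there. Starting from a nontrivial element of \<open>Dpow m\<close>, every term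
  of the series keeps a nontrivial element of \<open>D\<close>.\<close>

lemma Dx_not_nilpotent:
  assumes "D \<noteq> {\<one>}" "m > 0"
  shows "\<not> nilpotent_group (G\<lparr>carrier := Dx m\<rparr>)"
proof -
  have "\<exists>e. e \<in> lcs_in G (Dx m) c \<and> e \<in> D \<and> e \<noteq> \<one>" for c
  proof (induction c)
    case 0
    obtain d where d: "d \<in> D" "d \<noteq> \<one>" using assms(1) D.one_closed by blast
    have "d [^] m \<noteq> \<one>" using torsion_free[of d m] d D_subset assms(2) by blast
    moreover have "d [^] m \<in> Dpow m" using d by (auto simp: Dpow_def)
    ultimately show ?case using Dpow_mem_D Dpow_subset_Dx[of m] by auto
  next
    case (Suc c)
    then obtain e where e: "e \<in> lcs_in G (Dx m) c" "e \<in> D" "e \<noteq> \<one>" by blast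
    have "\<delta> e \<in> lcs_in G (Dx m) (Suc c)" by (rule commutator_lcs_in[OF e(1) x_mem_Dx])
    moreover have "\<delta> e \<in> D" using e(2) D_subset by (auto simp: D_def)
    moreover have "\<delta> e \<noteq> \<one>" using D_fixed_trivial[OF e(2)] e by (auto simp: commutator_eq_one_iff)
    ultimately show ?case by blast
  qed
  thus ?thesis unfolding nilpotent_subgroup_iff[OF Dx_subgroup] by blast
qed

lemma D_divisible:
  assumes P: non_nilpotent_overgroups_normal and m: "m > 0" and d: "d \<in> D"
  shows "\<exists>e \<in> D. e [^] (m::nat) = d"
proof (cases "D = {\<one>}")
  case False
  \<comment> \<open>The factor \<open>k\<close> absorbs the exponent from \<open>pow_k_mem\<close>:
    \<open>d [^] k = e [^] (k * m)\<close> gives \<open>d = e [^] m\<close>, because powers are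
    injective on \<open>D\<close>.\<close>
  let ?M = "k * m"
  have M: "?M > 0" "?M * m > 0" using k_pos m by auto
  have "d [^] k \<in> Dpow ?M \<or> d [^] ?M \<in> Dpow (?M * m)"
  proof (cases "Dx ?M \<lhd> G")
    case True
    interpret n: normal "Dx ?M" G by (rule True)
    have "inv d \<otimes> inv x \<otimes> d \<in> Dx ?M"
      using n.inv_op_closed1[OF _ n.m_inv_closed[OF x_mem_Dx], of d] d by simp
    hence "\<delta> d \<in> Dx ?M" unfolding commutator_def by (rule n.m_closed) (rule x_mem_Dx)
    moreover have "\<delta> d \<in> D" using d D_subset by (auto simp: D_def)
    ultimately have "\<delta> d \<in> Dpow ?M" using Dx_inter_D by blast
    hence "d [^] k \<in> Dpow ?M"
      using Dpow_subset D_subset by (intro pow_k_mem d Dpow_subgroup conj_Dpow) auto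
    thus ?thesis by blast
  next
    case nn: False
    have "Dpow (?M * m) \<subseteq> Dpow ?M"
    proof
      fix u assume "u \<in> Dpow (?M * m)"
      then obtain e where e: "e \<in> D" "u = e [^] (?M * m)" by (auto simp: Dpow_def)
      have "u = (e [^] m) [^] ?M" using e by (simp add: nat_pow_pow mult.commute)
      thus "u \<in> Dpow ?M"
        using subgroup_nat_pow_closed[OF D_subgroup e(1)] unfolding Dpow_def by blast
    qed
    hence "Dx (?M * m) \<subseteq> Dx ?M" unfolding Dx_def mult_powers_def by blast
    \<comment> \<open>The smaller subgroup is not nilpotent, so a proper inclusion would make
      \<open>Dx ?M\<close> normal. Intersecting both with \<open>D\<close> then compares the power
      subgroups.\<close>
    with nn have "Dx (?M * m) = Dx ?M"
      using P Dx_not_nilpotent[OF False M(2)] Dx_subgroup[of ?M] Dx_subgroup[of "?M * m"]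
      unfolding non_nilpotent_overgroups_normal_def by blast
    hence "Dpow (?M * m) = Dpow ?M" using Dx_inter_D by metis
    thus ?thesis using d by (auto simp: Dpow_def)
  qed
  then obtain e where e: "e \<in> D" "d [^] k = e [^] ?M \<or> d [^] ?M = e [^] (?M * m)"
    by (auto simp: Dpow_def)
  have em: "e [^] m \<in> D" by (rule subgroup_nat_pow_closed[OF D_subgroup e(1)])
  have "d [^] k = (e [^] m) [^] k \<or> d [^] ?M = (e [^] m) [^] ?M"
    using e by (simp add: nat_pow_pow mult.commute)
  hence "d = e [^] m" using D_pow_inj[OF d em] k_pos M by blast
  thus ?thesis using e(1) by blast
qed (use d in \<open>auto intro!: bexI[of _ \<one>]\<close>)

text \<open>As a homomorphic image of \<open>A\<close>, the group \<open>D\<close> is finitely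
  generated; being also divisible it is trivial, so all commutators with \<open>x\<close>
  vanish.\<close>

lemma fg_imp_centralizes:
  assumes P: non_nilpotent_overgroups_normal
    and S: "finite S" "S \<subseteq> carrier G" "generate G S = A" and a: "a \<in> A"
  shows "a \<otimes> x = x \<otimes> a"
proof -
  interpret d: group_hom "G\<lparr>carrier := A\<rparr>" "G\<lparr>carrier := A\<rparr>" \<delta> by (rule \<delta>_hom)
  have SA: "S \<subseteq> A" using generate.incl[of _ S G] S(3) by blast
  have dS: "\<delta> ` S \<subseteq> A" using SA \<delta>_closed by blast
  have gS: "generate (G\<lparr>carrier := A\<rparr>) S = A"
    using generate_consistent[OF SA A.subgroup_axioms] S(3) by simp
  have gD: "generate (G\<lparr>carrier := A\<rparr>) (\<delta> ` S) = D"
    using d.generate_img[of S] SA by (simp add: gS D_def)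
  have "generate (G\<lparr>carrier := A\<rparr>) (\<delta> ` S) = {\<one>\<^bsub>G\<lparr>carrier := A\<rparr>\<^esub>}"
  proof (rule GA.fg_divisible_trivial)
    fix m :: nat and d
    assume "m > 0" "d \<in> generate (G\<lparr>carrier := A\<rparr>) (\<delta> ` S)"
    thus "\<exists>e\<in>generate (G\<lparr>carrier := A\<rparr>) (\<delta> ` S). e [^]\<^bsub>G\<lparr>carrier := A\<rparr>\<^esub> m = d"
      using D_divisible[OF P, of m d] unfolding gD by (simp add: nat_pow_consistent[symmetric])
  qed (use S(1) dS in auto)
  hence "D = {\<one>}" using gD by simp
  hence "\<delta> a = \<one>" using a by (auto simp: D_def)
  thus ?thesis using a by (simp add: commutator_eq_one_iff)
qed

end

section \<open>Transfer into a central subgroup\<close>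

text \<open>Transfer from a normal subgroup \<open>L\<close> into a central subgroup \<open>A\<close> that has finitely many
  cosets meeting \<open>L\<close>. It is invariant under conjugation by all of \<open>G\<close>, hence kills \<open>[L, G]\<close>,
  while on \<open>L \<inter> A\<close> it is a power map.\<close>
locale central_transfer = group +
  fixes A L :: "'a set"
  assumes A_subgroup: "subgroup A G"
    and central: "\<And>a g. \<lbrakk>a \<in> A; g \<in> carrier G\<rbrakk> \<Longrightarrow> a \<otimes> g = g \<otimes> a"
    and L_normal: "L \<lhd> G"
    and finite_cosets: "finite ((\<lambda>l. A #> l) ` L)"
begin

sublocale A: subgroup A G by (rule A_subgroup)
sublocale L: normal L G by (rule L_normal)
sublocale GA: comm_group "G\<lparr>carrier := A\<rparr>"
  by (rule group.group_comm_groupI[OF A.subgroup_is_group[OF is_group]]) (simp add: central)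

definition C where "C = (\<lambda>l. A #> l) ` L"

lemma finite_C: "finite C"
  by (simp add: C_def finite_cosets)

lemma coset_eq_iff:
  assumes "a \<in> carrier G" "b \<in> carrier G"
  shows "A #> a = A #> b \<longleftrightarrow> a \<otimes> inv b \<in> A"
  by (metis A.rcos_module A.subgroup_axioms assms is_group rcos_self repr_independence)

lemma coset_mult: "\<lbrakk>y \<in> carrier G; l \<in> carrier G\<rbrakk> \<Longrightarrow> (A #> y) #> l = A #> (y \<otimes> l)"
  by (rule coset_mult_assoc[OF A.subset])

lemma C_mult_closed: "\<lbrakk>c \<in> C; l \<in> L\<rbrakk> \<Longrightarrow> c #> l \<in> C"
  by (auto simp: C_def coset_mult)

lemma C_mult_inj: "l \<in> L \<Longrightarrow> inj_on (\<lambda>c. c #> l) C"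
proof (rule inj_on_inverseI[where g = "\<lambda>c. c #> inv l"])
  fix c assume "l \<in> L" "c \<in> C"
  thus "c #> l #> inv l = c" by (auto simp: C_def coset_mult m_assoc)
qed

lemma C_mult_image: "l \<in> L \<Longrightarrow> (\<lambda>c. c #> l) ` C = C"
  using endo_inj_surj[OF finite_C _ C_mult_inj] C_mult_closed by blast

section \<open>The transfer: multiplicativity, independence of representatives, invariance\<close>

definition transversal where
  "transversal \<tau> \<longleftrightarrow> (\<forall>c \<in> C. \<tau> c \<in> carrier G \<and> A #> \<tau> c = c)"

lemma transversalD:
  assumes "transversal \<tau>" "c \<in> C"
  shows "\<tau> c \<in> carrier G" "A #> \<tau> c = c"
  using assms by (auto simp: transversal_def)

lemma transversal_exists: "\<exists>\<tau>. transversal \<tau>"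
proof -
  have "\<forall>c \<in> C. \<exists>t. t \<in> carrier G \<and> A #> t = c"
    using L.subset by (auto simp: C_def)
  from bchoice[OF this] show ?thesis by (auto simp: transversal_def)
qed

text \<open>The discrepancy between \<open>\<tau> c \<otimes> l\<close> and the representative of
  the coset reached from \<open>c\<close> by \<open>l\<close>.\<close>

definition factor where "factor \<tau> l c = \<tau> c \<otimes> l \<otimes> inv (\<tau> (c #> l))"

lemma factor_mem:
  assumes "transversal \<tau>" "l \<in> L" "c \<in> C"
  shows "factor \<tau> l c \<in> A"
proof -
  note t = transversalD[OF assms(1,3)] transversalD[OF assms(1) C_mult_closed[OF assms(3,2)]]
  have "A #> (\<tau> c \<otimes> l) = A #> \<tau> (c #> l)" using t assms(2) by (simp flip: coset_mult)
  thus ?thesis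
    unfolding factor_def using t assms(2) coset_eq_iff[of "\<tau> c \<otimes> l" "\<tau> (c #> l)"] by simp
qed

definition transfer where
  "transfer \<tau> l = finprod (G\<lparr>carrier := A\<rparr>) (factor \<tau> l) C"

lemma transfer_closed: "\<lbrakk>transversal \<tau>; l \<in> L\<rbrakk> \<Longrightarrow> transfer \<tau> l \<in> A"
  unfolding transfer_def using GA.finprod_closed[of "factor \<tau> l" C] factor_mem by auto

lemma finprod_reindex_mult:
  assumes "l \<in> L" "f \<in> C \<rightarrow> A"
  shows "finprod (G\<lparr>carrier := A\<rparr>) (\<lambda>c. f (c #> l)) C = finprod (G\<lparr>carrier := A\<rparr>) f C"
  using GA.finprod_reindex[OF _ C_mult_inj[OF assms(1)], of f] assms(2)
  by (simp add: C_mult_image[OF assms(1)])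

text \<open>The factors satisfy a cocycle identity: the factor of \<open>l \<otimes> l'\<close> at
  \<open>c\<close> is that of \<open>l\<close> at \<open>c\<close> times that of \<open>l'\<close>
  at \<open>c #> l\<close>. The shift disappears in the product since \<open>l\<close> permutes
  \<open>C\<close>.\<close>

lemma transfer_mult:
  assumes \<tau>: "transversal \<tau>" and l: "l \<in> L" "l' \<in> L"
  shows "transfer \<tau> (l \<otimes> l') = transfer \<tau> l \<otimes> transfer \<tau> l'"
proof -
  have "transfer \<tau> (l \<otimes> l')
      = finprod (G\<lparr>carrier := A\<rparr>) (\<lambda>c. factor \<tau> l c \<otimes>\<^bsub>G\<lparr>carrier := A\<rparr>\<^esub> factor \<tau> l' (c #> l)) C"
    unfolding transfer_def
  proof (rule GA.finprod_cong')
    fix c assume c: "c \<in> C"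
    have cl: "c #> l \<in> C" "c #> l #> l' \<in> C" using C_mult_closed c l by auto
    have "c #> (l \<otimes> l') = c #> l #> l'"
      using c l A.subset by (auto simp: C_def coset_mult m_assoc)
    thus "factor \<tau> (l \<otimes> l') c = factor \<tau> l c \<otimes>\<^bsub>G\<lparr>carrier := A\<rparr>\<^esub> factor \<tau> l' (c #> l)"
      using transversalD[OF \<tau>] c cl l by (simp add: factor_def m_assoc)
  qed (use factor_mem[OF \<tau>] C_mult_closed l in auto)
  also have "\<dots> = transfer \<tau> l \<otimes> finprod (G\<lparr>carrier := A\<rparr>) (\<lambda>c. factor \<tau> l' (c #> l)) C"
    unfolding transfer_def
    using GA.finprod_multf[of "factor \<tau> l" C "\<lambda>c. factor \<tau> l' (c #> l)"]
      factor_mem[OF \<tau>] C_mult_closed l by auto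
  also have "finprod (G\<lparr>carrier := A\<rparr>) (\<lambda>c. factor \<tau> l' (c #> l)) C = transfer \<tau> l'"
    unfolding transfer_def using factor_mem[OF \<tau> l(2)] by (intro finprod_reindex_mult[OF l(1)]) auto
  finally show ?thesis .
qed

text \<open>Another choice of representatives changes the factor at \<open>c\<close> by the
  coboundary \<open>u c \<otimes> inv (u (c #> l))\<close>, whose product over \<open>C\<close> is
  trivial because \<open>l\<close> permutes \<open>C\<close>.\<close>

lemma transfer_independent:
  assumes \<tau>: "transversal \<tau>" and \<sigma>: "transversal \<sigma>" and l: "l \<in> L"
  shows "transfer \<sigma> l = transfer \<tau> l"
proof -
  let ?P = "finprod (G\<lparr>carrier := A\<rparr>)"
  define u where "u c = \<sigma> c \<otimes> inv (\<tau> c)" for c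
  have u: "u c \<in> A" if "c \<in> C" for c
    using transversalD[OF \<tau> that] transversalD[OF \<sigma> that] by (simp add: u_def flip: coset_eq_iff)
  have "transfer \<sigma> l = ?P (\<lambda>c. (u c \<otimes> inv (u (c #> l))) \<otimes>\<^bsub>G\<lparr>carrier := A\<rparr>\<^esub> factor \<tau> l c) C"
    unfolding transfer_def
  proof (rule GA.finprod_cong')
    fix c assume c: "c \<in> C"
    have cl: "c #> l \<in> C" using C_mult_closed c l by auto
    have ul: "inv (u (c #> l)) \<in> A" using u[OF cl] by simp
    have tc: "\<tau> c \<in> carrier G" "\<sigma> c \<in> carrier G" "\<tau> (c #> l) \<in> carrier G" "\<sigma> (c #> l) \<in> carrier G"
      using transversalD[OF \<tau>] transversalD[OF \<sigma>] c cl by auto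
    have "factor \<sigma> l c = u c \<otimes> (factor \<tau> l c \<otimes> inv (u (c #> l)))"
      using tc l by (simp add: factor_def u_def m_assoc inv_mult_group)
    also have "factor \<tau> l c \<otimes> inv (u (c #> l)) = inv (u (c #> l)) \<otimes> factor \<tau> l c"
      using central[OF ul, of "factor \<tau> l c"] factor_mem[OF \<tau> l c] by simp
    also have "u c \<otimes> \<dots> = u c \<otimes> inv (u (c #> l)) \<otimes> factor \<tau> l c"
      using u[OF c] ul factor_mem[OF \<tau> l c] by (simp add: m_assoc)
    finally show "factor \<sigma> l c = u c \<otimes> inv (u (c #> l)) \<otimes>\<^bsub>G\<lparr>carrier := A\<rparr>\<^esub> factor \<tau> l c" by simp
  qed (use factor_mem[OF \<tau> l] u C_mult_closed[OF _ l] in auto)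
  also have "\<dots> = ?P (\<lambda>c. u c \<otimes> inv (u (c #> l))) C \<otimes> transfer \<tau> l"
    unfolding transfer_def
    using GA.finprod_multf[of "\<lambda>c. u c \<otimes> inv (u (c #> l))" C "factor \<tau> l"]
      factor_mem[OF \<tau> l] u C_mult_closed[OF _ l] by auto
  also have "?P (\<lambda>c. u c \<otimes> inv (u (c #> l))) C = ?P u C \<otimes> ?P (\<lambda>c. inv (u (c #> l))) C"
    using GA.finprod_multf[of u C "\<lambda>c. inv (u (c #> l))"] u C_mult_closed[OF _ l] by auto
  also have "?P (\<lambda>c. inv (u (c #> l))) C = ?P (\<lambda>c. inv (u c)) C"
    using finprod_reindex_mult[OF l, of "\<lambda>c. inv (u c)"] u by auto
  also have "?P u C \<otimes> ?P (\<lambda>c. inv (u c)) C = ?P (\<lambda>c. u c \<otimes> inv (u c)) C"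
    using GA.finprod_multf[of u C "\<lambda>c. inv (u c)"] u by auto
  also have "\<dots> = ?P (\<lambda>c. \<one>\<^bsub>G\<lparr>carrier := A\<rparr>\<^esub>) C"
    using u by (intro GA.finprod_cong') auto
  also have "\<dots> = \<one>" using GA.finprod_one by simp
  finally show ?thesis using transfer_closed[OF \<tau> l] by simp
qed

text \<open>Conjugation by \<open>g\<close> permutes \<open>C\<close>, since \<open>A\<close> is
  central and \<open>L\<close> normal. It turns the factors of the conjugate of \<open>l\<close>
  into those of \<open>l\<close> for another transversal, and the choice of transversal is
  immaterial.\<close>

lemma transfer_conj:
  assumes \<tau>: "transversal \<tau>" and l: "l \<in> L" and g: "g \<in> carrier G"
  shows "transfer \<tau> (inv g \<otimes> l \<otimes> g) = transfer \<tau> l"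
proof -
  \<comment> \<open>\<open>\<kappa>\<close> is the permutation of \<open>C\<close> given by
    conjugation with \<open>g\<close>, and \<open>\<sigma>\<close> is the transversal transported
    back along it.\<close>
  define \<kappa> where "\<kappa> c = A #> (inv g \<otimes> \<tau> c \<otimes> g)" for c
  define \<sigma> where "\<sigma> c = g \<otimes> \<tau> (\<kappa> c) \<otimes> inv g" for c
  have conjA: "h \<otimes> a \<otimes> inv h \<in> A" if "a \<in> A" "h \<in> carrier G" for a h
    using that central[of a h, symmetric] by (simp add: m_assoc)
  have coset_conj: "A #> (h \<otimes> a \<otimes> inv h) = A #> (h \<otimes> b \<otimes> inv h) \<longleftrightarrow> A #> a = A #> b"
    if "a \<in> carrier G" "b \<in> carrier G" "h \<in> carrier G" for a b h
  proof -
    have "(h \<otimes> a \<otimes> inv h) \<otimes> inv (h \<otimes> b \<otimes> inv h) = h \<otimes> (a \<otimes> inv b) \<otimes> inv h"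
      using that by (simp add: m_assoc inv_mult_group)
    moreover have "h \<otimes> (a \<otimes> inv b) \<otimes> inv h \<in> A \<longleftrightarrow> a \<otimes> inv b \<in> A"
      using conjA[of "a \<otimes> inv b" h] conjA[of "h \<otimes> (a \<otimes> inv b) \<otimes> inv h" "inv h"] that
      by (auto simp: m_assoc)
    ultimately show ?thesis using that by (simp add: coset_eq_iff)
  qed
  have \<kappa>_eq: "\<kappa> (A #> y) = A #> (inv g \<otimes> y \<otimes> g)" if "y \<in> L" for y
  proof -
    have "A #> y \<in> C" using that by (auto simp: C_def)
    from transversalD[OF \<tau> this] show ?thesis
      unfolding \<kappa>_def using coset_conj[of "\<tau> (A #> y)" y "inv g"] that g by simp
  qed
  have \<kappa>_closed: "\<kappa> c \<in> C" if "c \<in> C" for c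
  proof -
    obtain y where y: "y \<in> L" "c = A #> y" using \<open>c \<in> C\<close> by (auto simp: C_def)
    show ?thesis using \<kappa>_eq[OF y(1)] y L.inv_op_closed1[OF g y(1)] by (auto simp: C_def)
  qed
  have \<kappa>_inj: "inj_on \<kappa> C"
  proof
    fix c d assume "c \<in> C" "d \<in> C" and eq: "\<kappa> c = \<kappa> d"
    then obtain y z where y: "y \<in> L" "c = A #> y" and z: "z \<in> L" "d = A #> z" by (auto simp: C_def)
    have "A #> (inv g \<otimes> y \<otimes> inv (inv g)) = A #> (inv g \<otimes> z \<otimes> inv (inv g))"
      using eq \<kappa>_eq y z g by simp
    thus "c = d" using coset_conj[of y z "inv g"] y z g by simp
  qed
  have \<kappa>_image: "\<kappa> ` C = C"
    using endo_inj_surj[OF finite_C _ \<kappa>_inj] \<kappa>_closed by blast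
  have \<sigma>: "transversal \<sigma>"
    unfolding transversal_def
  proof
    fix c assume c: "c \<in> C"
    then obtain y where y: "y \<in> L" "c = A #> y" by (auto simp: C_def)
    note t = transversalD[OF \<tau> \<kappa>_closed[OF c]]
    have "A #> \<tau> (\<kappa> c) = A #> (inv g \<otimes> y \<otimes> g)" using t y \<kappa>_eq by simp
    hence "A #> \<sigma> c = A #> (g \<otimes> (inv g \<otimes> y \<otimes> g) \<otimes> inv g)"
      unfolding \<sigma>_def using coset_conj[of "\<tau> (\<kappa> c)" "inv g \<otimes> y \<otimes> g" g] t y g by simp
    also have "\<dots> = c" using y g by (simp add: m_assoc)
    finally show "\<sigma> c \<in> carrier G \<and> A #> \<sigma> c = c" using t g by (simp add: \<sigma>_def)
  qed
  have "transfer \<tau> (inv g \<otimes> l \<otimes> g)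
      = finprod (G\<lparr>carrier := A\<rparr>) (\<lambda>c. factor \<tau> (inv g \<otimes> l \<otimes> g) (\<kappa> c)) C"
    unfolding transfer_def
    using GA.finprod_reindex[OF _ \<kappa>_inj, of "factor \<tau> (inv g \<otimes> l \<otimes> g)"]
      factor_mem[OF \<tau> L.inv_op_closed1[OF g l]] by (simp add: \<kappa>_image)
  also have "\<dots> = transfer \<sigma> l"
    unfolding transfer_def
  proof (rule GA.finprod_cong')
    fix c assume c: "c \<in> C"
    then obtain y where y: "y \<in> L" "c = A #> y" by (auto simp: C_def)
    have cl: "c #> l \<in> C" using c l C_mult_closed by blast
    have eq: "\<kappa> c #> (inv g \<otimes> l \<otimes> g) = \<kappa> (c #> l)"
      using y l g \<kappa>_eq[OF y(1)] \<kappa>_eq[of "y \<otimes> l"] by (simp add: coset_mult m_assoc)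
    have t: "\<tau> (\<kappa> c) \<in> carrier G" "\<tau> (\<kappa> (c #> l)) \<in> carrier G"
      using transversalD[OF \<tau>] \<kappa>_closed c cl by auto
    have "factor \<sigma> l c = g \<otimes> factor \<tau> (inv g \<otimes> l \<otimes> g) (\<kappa> c) \<otimes> inv g"
      unfolding factor_def eq \<sigma>_def using t g l by (simp add: m_assoc inv_mult_group)
    also have "\<dots> = factor \<tau> (inv g \<otimes> l \<otimes> g) (\<kappa> c)"
      using central[OF factor_mem[OF \<tau> L.inv_op_closed1[OF g l] \<kappa>_closed[OF c]] g, symmetric]
        factor_mem[OF \<tau> L.inv_op_closed1[OF g l] \<kappa>_closed[OF c]] g by (simp add: m_assoc)
    finally show "factor \<tau> (inv g \<otimes> l \<otimes> g) (\<kappa> c) = factor \<sigma> l c" ..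
  qed (use factor_mem[OF \<sigma> l] in auto)
  also have "\<dots> = transfer \<tau> l" by (rule transfer_independent[OF \<tau> \<sigma> l])
  finally show ?thesis .
qed

text \<open>A central \<open>z\<close> in \<open>A\<close> fixes every coset, so each of the
  \<open>card C\<close> factors equals \<open>z\<close>.\<close>

lemma transfer_central:
  assumes \<tau>: "transversal \<tau>" and z: "z \<in> L" "z \<in> A"
  shows "transfer \<tau> z = z [^] card C"
proof -
  have "transfer \<tau> z = finprod (G\<lparr>carrier := A\<rparr>) (\<lambda>c. z) C"
    unfolding transfer_def
  proof (rule GA.finprod_cong')
    fix c assume c: "c \<in> C"
    then obtain y where y: "y \<in> L" "c = A #> y" by (auto simp: C_def)
    have "y \<otimes> z \<otimes> inv y = z" using y z central[of z y, symmetric] by (simp add: m_assoc)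
    hence "c #> z = c" using y z by (simp add: coset_mult coset_eq_iff)
    thus "factor \<tau> z c = z"
      using transversalD[OF \<tau> c] z central[of z "\<tau> c", symmetric] by (simp add: factor_def m_assoc)
  qed (use z in auto)
  also have "\<dots> = z [^]\<^bsub>G\<lparr>carrier := A\<rparr>\<^esub> card C" using z by (intro GA.finprod_const) simp
  also have "\<dots> = z [^] card C" by (simp add: nat_pow_consistent[symmetric])
  finally show ?thesis .
qed

text \<open>The kernel of the transfer contains all commutators \<open>[l, g]\<close>. An element of
  the generated group that lies in \<open>A\<close> has trivial \<open>card C\<close>-th power,
  hence is trivial by torsion-freeness. So distinct elements lie in distinct cosets of
  \<open>A\<close>, of which finitely many meet \<open>L\<close>.\<close>

lemma finite_commutators:
  assumes tf: "\<And>a q. \<lbrakk>a \<in> A; (q::nat) > 0; a [^] q = \<one>\<rbrakk> \<Longrightarrow> a = \<one>"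
  shows "finite (generate G {commutator G l g | l g. l \<in> L \<and> g \<in> carrier G})"
proof -
  let ?K = "{commutator G l g | l g. l \<in> L \<and> g \<in> carrier G}"
  obtain \<tau> where \<tau>: "transversal \<tau>" using transversal_exists by blast
  have comm_eq: "commutator G l g = inv l \<otimes> (inv g \<otimes> l \<otimes> g)" if "l \<in> L" "g \<in> carrier G" for l g
    using that by (simp add: word_simps)
  have t1: "transfer \<tau> \<one> = \<one>"
    using transfer_mult[OF \<tau>, of \<one> \<one>] transfer_closed[OF \<tau>, of \<one>] by simp
  let ?N = "{l \<in> L. transfer \<tau> l = \<one>}"
  have tinv: "transfer \<tau> (inv l) = inv (transfer \<tau> l)" if "l \<in> L" for l
    using transfer_mult[OF \<tau>, of "inv l" l] transfer_closed[OF \<tau>] that t1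
    by (simp add: inv_equality)
  have N: "subgroup ?N G"
    by (rule subgroupI) (use t1 in \<open>auto simp: transfer_mult[OF \<tau>] tinv intro!: exI[of _ \<one>]\<close>)
  have "?K \<subseteq> ?N"
  proof safe
    fix l g assume lg: "l \<in> L" "g \<in> carrier G"
    note c = L.inv_op_closed1[OF lg(2,1)]
    show "commutator G l g \<in> L" using lg c by (simp add: comm_eq)
    show "transfer \<tau> (commutator G l g) = \<one>"
      using lg c transfer_closed[OF \<tau>] by (simp add: comm_eq transfer_mult[OF \<tau>] transfer_conj[OF \<tau>] tinv)
  qed
  hence sub: "generate G ?K \<subseteq> ?N" by (rule generate_subgroup_incl[OF _ N])
  have gen: "subgroup (generate G ?K) G" by (rule generate_is_subgroup) auto
  have "C \<noteq> {}" using L.one_closed unfolding C_def by blast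
  hence card: "card C > 0" using finite_C by (simp add: card_gt_0_iff)
  have triv: "z = \<one>" if "z \<in> generate G ?K" "z \<in> A" for z
    using that sub transfer_central[OF \<tau>, of z] tf[OF that(2) card] by auto
  have "inj_on (\<lambda>l. A #> l) (generate G ?K)"
  proof
    fix a b assume ab: "a \<in> generate G ?K" "b \<in> generate G ?K" "A #> a = A #> b"
    have c: "a \<in> carrier G" "b \<in> carrier G" using ab gen subgroup.subset by blast+
    have "a \<otimes> inv b \<in> generate G ?K"
      using ab subgroup.m_closed[OF gen] subgroup.m_inv_closed[OF gen] by blast
    moreover have "a \<otimes> inv b \<in> A" using ab c by (simp add: coset_eq_iff)
    ultimately have "a \<otimes> inv b = \<one>" by (rule triv)
    thus "a = b" using c by (metis inv_closed inv_equality inv_inv)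
  qed
  moreover have "finite ((\<lambda>l. A #> l) ` generate G ?K)"
    using sub by (intro finite_subset[OF _ finite_cosets]) auto
  ultimately show ?thesis using finite_imageD by blast
qed

end

section \<open>Subgroups of finite index\<close>

context group
begin

text \<open>Finitely many cosets of \<open>N\<close> cover \<open>L\<close>. This form also makes
  sense when \<open>N\<close> is not contained in \<open>L\<close>, as for a term of the series of
  \<open>G\<close> modulo a term of the series of \<open>N\<close>.\<close>

definition finite_mod :: "'a set \<Rightarrow> 'a set \<Rightarrow> bool" where
  "finite_mod L N \<longleftrightarrow>
     (\<exists>R. finite R \<and> R \<subseteq> carrier G \<and> (\<forall>l \<in> L. \<exists>n \<in> N. \<exists>r \<in> R. l = n \<otimes> r))"

text \<open>One representative from each fibre of \<open>f\<close> suffices. It is applied to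
  quotient maps and to a permutation action.\<close>

lemma finite_modI:
  assumes N: "subgroup N G" and L: "L \<subseteq> carrier G" and fin: "finite (f ` L)"
    and eq: "\<And>a b. \<lbrakk>a \<in> L; b \<in> L; f a = f b\<rbrakk> \<Longrightarrow> a \<otimes> inv b \<in> N"
  shows "finite_mod L N"
proof -
  obtain R where R: "R \<subseteq> L" "finite R" "f ` L = f ` R"
    using finite_subset_image[OF fin, of f L] by auto
  have "\<exists>n \<in> N. \<exists>r \<in> R. l = n \<otimes> r" if l: "l \<in> L" for l
  proof -
    have "f l \<in> f ` R" using l R(3) by blast
    then obtain r where r: "r \<in> R" "f l = f r" by blast
    hence "l \<otimes> inv r \<in> N" using eq l R(1) by blast
    moreover have "l = l \<otimes> inv r \<otimes> r" using l r R L by (simp add: m_assoc subset_iff)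
    ultimately show ?thesis using r(1) by blast
  qed
  thus ?thesis using R L unfolding finite_mod_def by blast
qed

lemma finite_mod_trans:
  assumes "finite_mod L N" "finite_mod N M" "M \<subseteq> carrier G"
  shows "finite_mod L M"
proof -
  obtain R where R: "finite R" "R \<subseteq> carrier G" "\<And>l. l \<in> L \<Longrightarrow> \<exists>n \<in> N. \<exists>r \<in> R. l = n \<otimes> r"
    using assms(1) unfolding finite_mod_def by blast
  obtain R' where R': "finite R'" "R' \<subseteq> carrier G" "\<And>l. l \<in> N \<Longrightarrow> \<exists>n \<in> M. \<exists>r \<in> R'. l = n \<otimes> r"
    using assms(2) unfolding finite_mod_def by blast
  let ?R = "(\<lambda>(r', r). r' \<otimes> r) ` (R' \<times> R)"
  have "\<exists>n \<in> M. \<exists>s \<in> ?R. l = n \<otimes> s" if l: "l \<in> L" for l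
  proof -
    obtain n r where n: "n \<in> N" "r \<in> R" "l = n \<otimes> r" using R(3)[OF l] by blast
    obtain m r' where m: "m \<in> M" "r' \<in> R'" "n = m \<otimes> r'" using R'(3)[OF n(1)] by blast
    have "l = m \<otimes> (r' \<otimes> r)" using n m R(2) R'(2) assms(3) by (simp add: m_assoc subset_iff)
    moreover have "r' \<otimes> r \<in> ?R" using n m by auto
    ultimately show ?thesis using m(1) by blast
  qed
  moreover have "?R \<subseteq> carrier G" "finite ?R" using R(1,2) R'(1,2) by auto
  ultimately show ?thesis unfolding finite_mod_def by (intro exI[of _ ?R] conjI ballI)
qed

lemma finite_mod_trivial:
  assumes "finite_mod L {\<one>}"
  shows "finite L"
proof -
  obtain R where R: "finite R" "R \<subseteq> carrier G" "\<forall>l \<in> L. \<exists>n \<in> {\<one>}. \<exists>r \<in> R. l = n \<otimes> r"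
    using assms unfolding finite_mod_def by blast
  have "L \<subseteq> R"
  proof
    fix l assume "l \<in> L"
    then obtain r where "r \<in> R" "l = \<one> \<otimes> r" using R(3) by blast
    thus "l \<in> R" using R(2) by auto
  qed
  thus ?thesis using R(1) finite_subset by blast
qed

text \<open>\<open>N\<close> is the kernel of the action by right multiplication on the cosets of
  \<open>H\<close>.\<close>

lemma finite_index_core:
  assumes H: "subgroup H G" and fin: "finite (rcosets H)"
  obtains N where "N \<lhd> G" "N \<subseteq> H" "finite_mod (carrier G) N"
proof -
  interpret H: subgroup H G by fact
  let ?X = "rcosets H"
  have closed: "c #> g \<in> ?X" if "c \<in> ?X" "g \<in> carrier G" for c g
    using that by (auto simp: RCOSETS_def coset_mult_assoc[OF H.subset])
  have assoc: "c #> g #> h = c #> (g \<otimes> h)" if "c \<in> ?X" "g \<in> carrier G" "h \<in> carrier G" for c g h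
    using that H.rcosets_carrier[OF is_group] by (intro coset_mult_assoc) auto
  have one: "c #> \<one> = c" if "c \<in> ?X" for c
    using that H.rcosets_carrier[OF is_group] by (intro coset_mult_one) auto
  have cancel: "c #> g #> inv g = c" "c #> inv g #> g = c" if "c \<in> ?X" "g \<in> carrier G" for c g
    using that by (simp_all add: assoc one)
  define N where "N = {g \<in> carrier G. \<forall>c \<in> ?X. c #> g = c}"
  have sub: "subgroup N G"
  proof (rule subgroupI)
    show "N \<subseteq> carrier G" by (auto simp: N_def)
    show "N \<noteq> {}" using one by (auto simp: N_def)
    show "inv a \<in> N" if "a \<in> N" for a
      using that cancel(1) by (fastforce simp: N_def)
    show "a \<otimes> b \<in> N" if "a \<in> N" "b \<in> N" for a b
      using that by (auto simp: N_def simp flip: assoc)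
  qed
  have "N \<lhd> G"
  proof (rule normal_conjI[OF sub])
    fix g n assume "g \<in> carrier G" "n \<in> N"
    thus "inv g \<otimes> n \<otimes> g \<in> N"
      using closed cancel(2) by (auto simp: N_def simp flip: assoc)
  qed
  moreover have "N \<subseteq> H"
  proof
    fix n assume "n \<in> N"
    moreover have "H \<in> ?X" by (rule H.subgroup_in_rcosets[OF is_group])
    ultimately show "n \<in> H" using coset_join1[OF _ _ H] by (auto simp: N_def)
  qed
  moreover have "finite_mod (carrier G) N"
  \<comment> \<open>Restricting the permutations to the coset space makes them members of a finite
    set of functions.\<close>
  proof (rule finite_modI[OF sub, where f = "\<lambda>g. restrict (\<lambda>c. c #> g) ?X"])
    have "(\<lambda>g. restrict (\<lambda>c. c #> g) ?X) ` carrier G \<subseteq> ?X \<rightarrow>\<^sub>E ?X" using closed by auto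
    thus "finite ((\<lambda>g. restrict (\<lambda>c. c #> g) ?X) ` carrier G)"
      using finite_PiE[of ?X "\<lambda>_. ?X"] fin finite_subset by blast
    fix a b assume ab: "a \<in> carrier G" "b \<in> carrier G"
      and eq: "restrict (\<lambda>c. c #> a) ?X = restrict (\<lambda>c. c #> b) ?X"
    have "c #> (a \<otimes> inv b) = c" if "c \<in> ?X" for c
    proof -
      have "c #> a = c #> b" using fun_cong[OF eq, of c] that by simp
      thus ?thesis using that ab cancel(1) by (simp flip: assoc)
    qed
    thus "a \<otimes> inv b \<in> N" using ab by (simp add: N_def)
  qed simp
  ultimately show ?thesis using that by blast
qed

text \<open>By the pigeonhole principle two powers of \<open>x\<close> share a coset representative,
  so their quotient lies in \<open>N\<close>.\<close>

lemma finite_index_pow_mem: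
  assumes N: "subgroup N G" and fin: "finite_mod (carrier G) N" and x: "x \<in> carrier G"
  obtains k :: nat where "k > 0" "x [^] k \<in> N"
proof -
  obtain R where R: "finite R" "R \<subseteq> carrier G" "\<And>l. l \<in> carrier G \<Longrightarrow> \<exists>n \<in> N. \<exists>r \<in> R. l = n \<otimes> r"
    using fin unfolding finite_mod_def by blast
  have "\<forall>i. \<exists>r. r \<in> R \<and> (\<exists>n \<in> N. x [^] (i::nat) = n \<otimes> r)" using R(3) x nat_pow_closed by blast
  then obtain f where f: "\<And>i. f i \<in> R" "\<And>i::nat. \<exists>n \<in> N. x [^] i = n \<otimes> f i" by metis
  have "range f \<subseteq> R" using f(1) by blast
  hence "finite (range f)" using R(1) finite_subset by blast
  hence "\<not> inj f" using finite_imageD infinite_UNIV_nat by blast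
  then obtain i j where ij: "i < j" "f i = f j" by (metis injI linorder_neqE_nat)
  obtain m n where mn: "m \<in> N" "n \<in> N" "x [^] i = m \<otimes> f i" "x [^] j = n \<otimes> f i"
    using f(2)[of i] f(2)[of j] ij(2) by metis
  have c: "m \<in> carrier G" "n \<in> carrier G" "f i \<in> carrier G"
    using mn subgroup.subset[OF N] R(2) f(1) by auto
  have "x [^] (j - i) \<otimes> x [^] i = x [^] j" using x ij(1) by (simp add: nat_pow_mult)
  hence "x [^] (j - i) = x [^] j \<otimes> inv (x [^] i)" using x by (metis inv_solve_right nat_pow_closed)
  also have "\<dots> = n \<otimes> inv m" using c mn by (simp add: m_assoc inv_mult_group)
  also have "\<dots> \<in> N" using mn subgroup.m_closed[OF N] subgroup.m_inv_closed[OF N] by blast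
  finally show ?thesis using that[of "j - i"] ij(1) by simp
qed

text \<open>Schreier's argument: with \<open>T\<close> the Schreier generators, the set
  \<open>U\<close> of products of \<open>generate G T\<close> with \<open>R\<close> absorbs all
  generators of \<open>G\<close> on the right, hence is the whole group.\<close>

lemma finite_index_fg:
  assumes N: "subgroup N G" and fin: "finite_mod (carrier G) N"
    and S: "finite S" "S \<subseteq> carrier G" "generate G S = carrier G"
  obtains T where "finite T" "T \<subseteq> N" "generate G T = N"
proof -
  interpret N: subgroup N G by fact
  obtain R where R: "finite R" "R \<subseteq> carrier G" "\<And>l. l \<in> carrier G \<Longrightarrow> \<exists>n \<in> N. \<exists>r \<in> R. l = n \<otimes> r"
    using fin unfolding finite_mod_def by blast
  have "\<forall>g \<in> carrier G. \<exists>r. r \<in> R \<and> g \<otimes> inv r \<in> N"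
  proof
    fix g assume "g \<in> carrier G"
    then obtain n r where "n \<in> N" "r \<in> R" "g = n \<otimes> r" using R(3) by blast
    thus "\<exists>r. r \<in> R \<and> g \<otimes> inv r \<in> N" using R(2) by (auto simp: m_assoc subset_iff intro!: exI[of _ r])
  qed
  from bchoice[OF this] obtain rep where
    rep: "\<And>g. g \<in> carrier G \<Longrightarrow> rep g \<in> R \<and> g \<otimes> inv (rep g) \<in> N" by blast
  define S' where "S' = S \<union> m_inv G ` S"
  have S': "finite S'" "S' \<subseteq> carrier G" using S by (auto simp: S'_def)
  \<comment> \<open>The representatives lying in \<open>N\<close> are added because
    \<open>\<one>\<close> need not be the one chosen for \<open>N\<close>. With them, an element
    \<open>t \<otimes> r\<close> of \<open>N\<close> has \<open>r\<close> in
    \<open>T\<close>.\<close>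
  define T where "T = (\<lambda>(r, s). r \<otimes> s \<otimes> inv (rep (r \<otimes> s))) ` (R \<times> S') \<union> (R \<inter> N)"
  have T: "finite T" "T \<subseteq> N" using R(1,2) S' rep by (auto simp: T_def subset_iff)
  have Tsub: "subgroup (generate G T) G"
    using T(2) N.subset by (intro generate_is_subgroup) auto
  interpret T: subgroup "generate G T" G by (rule Tsub)
  have TN: "generate G T \<subseteq> N" by (rule generate_subgroup_incl[OF T(2) N])
  define U where "U = {t \<otimes> r | t r. t \<in> generate G T \<and> r \<in> R}"
  have Uc: "U \<subseteq> carrier G" using R(2) by (auto simp: U_def)
  have step: "u \<otimes> s \<in> U" if uU: "u \<in> U" and s: "s \<in> S'" for u s
  proof -
    obtain t r where u: "t \<in> generate G T" "r \<in> R" "u = t \<otimes> r" using uU unfolding U_def by blast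
    have c: "s \<in> carrier G" "r \<in> carrier G" "rep (r \<otimes> s) \<in> carrier G"
      using u s S' R(2) rep[of "r \<otimes> s"] by auto
    have "u \<otimes> s = t \<otimes> (r \<otimes> s \<otimes> inv (rep (r \<otimes> s))) \<otimes> rep (r \<otimes> s)"
      using u c by (simp add: m_assoc)
    moreover have "r \<otimes> s \<otimes> inv (rep (r \<otimes> s)) \<in> T" using u s by (auto simp: T_def)
    ultimately show ?thesis
      using u(1) c rep[of "r \<otimes> s"] T.m_closed generate.incl[of _ T G] unfolding U_def by blast
  qed
  have "\<forall>u \<in> U. u \<otimes> g \<in> U" if "g \<in> generate G S" for g
    using that
  proof induction
    case one
    thus ?case using Uc by (simp add: subset_iff)
  next
    case (incl h) thus ?case using step by (simp add: S'_def)
  next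
    case (inv h) thus ?case using step by (simp add: S'_def)
  next
    case (eng h1 h2)
    have "h1 \<in> carrier G" "h2 \<in> carrier G" using eng.hyps S(3) by auto
    thus ?case using eng.IH Uc by (simp add: subset_iff flip: m_assoc)
  qed
  moreover have "\<one> \<in> U"
  proof -
    have r: "rep \<one> \<in> R" "inv (rep \<one>) \<in> N" "rep \<one> \<in> carrier G" using rep[of \<one>] R(2) by auto
    hence "rep \<one> \<in> N" using N.m_inv_closed[OF r(2)] by simp
    hence "rep \<one> \<in> generate G T" using r by (intro generate.incl) (simp add: T_def)
    hence "inv (rep \<one>) \<in> generate G T" by simp
    moreover have "\<one> = inv (rep \<one>) \<otimes> rep \<one>" using r by simp
    ultimately show ?thesis using r(1) unfolding U_def by blast
  qed
  ultimately have U: "g \<in> U" if "g \<in> carrier G" for g using that S(3) l_one by metis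
  have "N \<subseteq> generate G T"
  proof
    fix n assume n: "n \<in> N"
    hence "n \<in> U" using U by simp
    then obtain t r where tr: "t \<in> generate G T" "r \<in> R" "n = t \<otimes> r" unfolding U_def by blast
    have "r = inv t \<otimes> n" using tr R(2) by auto
    also have "\<dots> \<in> N" using tr(1) TN n by auto
    finally have "r \<in> generate G T" using tr(2) by (intro generate.incl) (simp add: T_def)
    thus "n \<in> generate G T" using tr by simp
  qed
  with TN T that show ?thesis by blast
qed

text \<open>Modulo the term after next, commutators are multiplicative in both arguments. So the
  commutators of generators of one factor with the generators \<open>S0\<close> of \<open>H\<close>
  generate the following factor.\<close>

lemma lcs_in_fg_mod_next:
  assumes H: "subgroup H G" and S0: "finite S0" "S0 \<subseteq> H" "generate G S0 = H"
  shows "\<exists>S. finite S \<and> S \<subseteq> lcs_in G H n \<and>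
    generate G (S \<union> lcs_in G H (Suc n)) = lcs_in G H n"
proof (induction n)
  case 0
  have "generate G (S0 \<union> lcs_in G H (Suc 0)) \<subseteq> H"
    using S0(2) lcs_in_subset[OF H, of "Suc 0"] by (intro generate_subgroup_incl[OF _ H]) auto
  moreover have "H \<subseteq> generate G (S0 \<union> lcs_in G H (Suc 0))"
    using mono_generate[of S0 "S0 \<union> lcs_in G H (Suc 0)"] S0(3) by auto
  ultimately show ?case using S0 by (intro exI[of _ S0]) auto
next
  case (Suc n)
  interpret H: subgroup H G by fact
  let ?L = "lcs_in G H"
  obtain S where S: "finite S" "S \<subseteq> ?L n" "generate G (S \<union> ?L (Suc n)) = ?L n" using Suc by blast
  define S' where "S' = (\<lambda>(s, t). commutator G s t) ` (S \<times> S0)"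
  have S': "finite S'" "S' \<subseteq> ?L (Suc n)"
    using S(1,2) S0(1,2) commutator_lcs_in by (auto simp: S'_def subset_iff simp del: lcs_in.simps)
  define W where "W = generate G (S' \<union> ?L (Suc (Suc n)))"
  have Wgen: "S' \<union> ?L (Suc (Suc n)) \<subseteq> ?L (Suc n)"
    using S'(2) lcs_in_Suc_subset[OF H] by blast
  have WL: "W \<subseteq> ?L (Suc n)"
    unfolding W_def by (rule generate_subgroup_incl[OF Wgen lcs_in_subgroup[OF H]])
  have Wsub: "subgroup W G"
    unfolding W_def using Wgen subgroup.subset[OF lcs_in_subgroup[OF H, of "Suc n"]]
    by (intro generate_is_subgroup) (rule subset_trans)
  interpret W: subgroup W G by (rule Wsub)
  have KW: "?L (Suc (Suc n)) \<subseteq> W" unfolding W_def using generate.incl by (metis UnCI subsetI)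
  have S'W: "S' \<subseteq> W" unfolding W_def using generate.incl by (metis UnCI subsetI)
  \<comment> \<open>\<open>W\<close> is invariant under \<open>H\<close>: the commutators
    \<open>[w, h]\<close> fall into the following term, which \<open>W\<close> contains.\<close>
  have conj: "inv h \<otimes> w \<otimes> h \<in> W" if "w \<in> W" "h \<in> H" for w h
  proof -
    have "commutator G w h \<in> W" using commutator_lcs_in[of w H "Suc n" h] that WL KW by blast
    thus ?thesis using that commutator_eq_conj[of w h] by simp
  qed
  have conj': "h \<otimes> w \<otimes> inv h \<in> W" if "w \<in> W" "h \<in> H" for w h
    using conj[of w "inv h"] that by simp
  \<comment> \<open>First the second argument is extended from \<open>S0\<close> to
    \<open>H\<close>: by the invariance of \<open>W\<close> the admissible \<open>y\<close> form a
    subgroup.\<close>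
  have 1: "commutator G s y \<in> W" if s: "s \<in> S" and y: "y \<in> H" for s y
  proof -
    have sc: "s \<in> carrier G" using s S(2) lcs_in_carrier_subset[OF H] by blast
    let ?Y = "{y \<in> H. commutator G s y \<in> W}"
    have "subgroup ?Y G"
    proof (rule subgroupI)
      show "?Y \<subseteq> carrier G" by auto
      have "\<one> \<in> ?Y" using sc by (simp add: commutator_def)
      thus "?Y \<noteq> {}" by blast
      fix a b assume a: "a \<in> ?Y" and b: "b \<in> ?Y"
      have "commutator G s (a \<otimes> b) = commutator G s b \<otimes> (inv b \<otimes> commutator G s a \<otimes> b)"
        using a b sc by (simp add: word_simps)
      thus "a \<otimes> b \<in> ?Y" using a b conj by simp
      have "commutator G s (inv a) = inv (a \<otimes> commutator G s a \<otimes> inv a)"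
        using a sc by (simp add: word_simps)
      moreover have "a \<otimes> commutator G s a \<otimes> inv a \<in> W" using a conj' by blast
      ultimately show "inv a \<in> ?Y" using a by auto
    qed
    moreover have "S0 \<subseteq> ?Y" using S0(2) s S'W by (auto simp: S'_def)
    ultimately have "generate G S0 \<subseteq> ?Y" by (intro generate_subgroup_incl)
    thus ?thesis using y S0(3) by blast
  qed
  \<comment> \<open>In the same way the first argument is extended from \<open>S\<close> together
    with the next term to the whole term.\<close>
  have 2: "commutator G x y \<in> W" if x: "x \<in> ?L n" and y: "y \<in> H" for x y
  proof -
    note Lsub = lcs_in_subgroup[OF H, of n]
    let ?X = "{x \<in> ?L n. \<forall>y \<in> H. commutator G x y \<in> W}"
    have "subgroup ?X G"
    proof (rule subgroupI)
      show "?X \<subseteq> carrier G" using subgroup.subset[OF Lsub] by blast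
      have "\<one> \<in> ?X" using subgroup.one_closed[OF Lsub] by (simp add: commutator_def)
      thus "?X \<noteq> {}" by blast
      fix a b assume a: "a \<in> ?X" and b: "b \<in> ?X"
      have c: "a \<in> carrier G" "b \<in> carrier G" "a \<in> H" "b \<in> H"
        using a b lcs_in_subset[OF H, of n] lcs_in_carrier_subset[OF H, of _ n] by blast+
      have "commutator G (a \<otimes> b) y \<in> W" if "y \<in> H" for y
      proof -
        have "commutator G (a \<otimes> b) y = (inv b \<otimes> commutator G a y \<otimes> b) \<otimes> commutator G b y"
          using c that by (simp add: word_simps)
        thus ?thesis using a b c that conj by simp
      qed
      thus "a \<otimes> b \<in> ?X" using a b subgroup.m_closed[OF Lsub] by simp
      have "commutator G (inv a) y \<in> W" if "y \<in> H" for y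
      proof -
        have "commutator G (inv a) y = inv (a \<otimes> commutator G a y \<otimes> inv a)"
          using c that by (simp add: word_simps)
        moreover have "a \<otimes> commutator G a y \<otimes> inv a \<in> W" using a c that conj' by blast
        ultimately show ?thesis by simp
      qed
      thus "inv a \<in> ?X" using a subgroup.m_inv_closed[OF Lsub] by simp
    qed
    moreover have "S \<union> ?L (Suc n) \<subseteq> ?X"
    proof
      fix s assume "s \<in> S \<union> ?L (Suc n)"
      thus "s \<in> ?X"
      proof
        assume "s \<in> S" thus ?thesis using 1 S(2) by blast
      next
        assume s: "s \<in> ?L (Suc n)"
        hence "commutator G s y \<in> W" if "y \<in> H" for y
          using commutator_lcs_in[of s H "Suc n" y] that KW by blast
        thus ?thesis using s lcs_in_Suc_subset[OF H] by blast
      qed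
    qed
    ultimately have "generate G (S \<union> ?L (Suc n)) \<subseteq> ?X" by (intro generate_subgroup_incl)
    thus ?thesis using x y unfolding S(3) by blast
  qed
  have "?L (Suc n) \<subseteq> W"
    unfolding lcs_in.simps(2)[of G H n] using 2 by (intro generate_subgroup_incl[OF _ Wsub]) blast
  thus ?case using S' WL unfolding W_def by (intro exI[of _ S']) blast
qed

end

section \<open>Finiteness of a term of the lower central series\<close>

declare lcs_in.simps(2) [simp del]

context group
begin

text \<open>A suitable power subgroup \<open>A1\<close> of \<open>A\<close> is torsion-free, and
  each \<open>x\<close> acts on it with finite order, so it is central. Finitely many cosets of
  \<open>A1\<close> cover \<open>lcs G n\<close>, and the transfer makes the next term
  finite.\<close>

lemma finite_lcs_of_finite_mod_abelian:
  assumes P: non_nilpotent_overgroups_normal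
    and A: "A \<lhd> G" and comm: "\<And>a b. \<lbrakk>a \<in> A; b \<in> A\<rbrakk> \<Longrightarrow> a \<otimes> b = b \<otimes> a"
    and S: "finite S" "S \<subseteq> carrier G" "generate G S = A"
    and cent: "\<And>x. x \<in> carrier G \<Longrightarrow>
      \<exists>k::nat > 0. \<forall>a \<in> A. x [^] k \<otimes> a = a \<otimes> x [^] k"
    and fin: "finite_mod (lcs G n) A"
  shows "\<exists>m. finite (lcs G m)"
proof -
  interpret A: normal A G by fact
  interpret GA: comm_group "G\<lparr>carrier := A\<rparr>"
    by (rule group.group_comm_groupI[OF A.subgroup_is_group[OF is_group]]) (simp add: comm)
  have SA: "S \<subseteq> A" using generate.incl[of _ S G] S(3) by blast
  have gS: "generate (G\<lparr>carrier := A\<rparr>) S = A"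
    using generate_consistent[OF SA A.subgroup_axioms] S(3) by simp
  have pow: "a [^]\<^bsub>G\<lparr>carrier := A\<rparr>\<^esub> (q::nat) = a [^] q" for a q
    by (simp add: nat_pow_consistent[symmetric])
  obtain t :: nat where t: "t > 0" "\<And>a q. \<lbrakk>a \<in> A; (q::nat) > 0; a [^] q = \<one>\<rbrakk> \<Longrightarrow> a [^] t = \<one>"
    using GA.fg_torsion_bounded[of S] S(1) SA unfolding gS pow by auto
  define A1 where "A1 = (\<lambda>a. a [^] t) ` A"
  interpret p: group_hom "G\<lparr>carrier := A\<rparr>" "G\<lparr>carrier := A\<rparr>" "\<lambda>a. a [^] t"
    by unfold_locales
      (auto intro!: homI subgroup_nat_pow_closed[OF A.subgroup_axioms] pow_mult_distrib comm)
  have A1A: "A1 \<subseteq> A" by (auto simp: A1_def subgroup_nat_pow_closed[OF A.subgroup_axioms])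
  have A1_sub: "subgroup A1 G"
    using p.img_is_subgroup incl_subgroup[OF A.subgroup_axioms] by (simp add: A1_def)
  have "A1 \<lhd> G"
  proof (rule normal_conjI[OF A1_sub])
    fix g h assume g: "g \<in> carrier G" and "h \<in> A1"
    then obtain a where a: "a \<in> A" "h = a [^] t" by (auto simp: A1_def)
    interpret c: group_hom G G "\<lambda>x. inv g \<otimes> x \<otimes> g" by (rule conj_hom[OF g])
    have "inv g \<otimes> h \<otimes> g = (inv g \<otimes> a \<otimes> g) [^] t" using a g c.hom_nat_pow by auto
    thus "inv g \<otimes> h \<otimes> g \<in> A1" using A.inv_op_closed1[OF g a(1)] by (auto simp: A1_def)
  qed
  moreover have comm1: "a \<otimes> b = b \<otimes> a" if "a \<in> A1" "b \<in> A1" for a b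
    using that comm A1A by blast
  \<comment> \<open>\<open>t\<close> kills all torsion of \<open>A\<close>, so a torsion element of
    the form \<open>b [^] t\<close> is already trivial.\<close>
  moreover have tf: "a = \<one>" if a: "a \<in> A1" and q: "(q::nat) > 0" "a [^] q = \<one>" for a q
  proof -
    obtain b where b: "b \<in> A" "a = b [^] t" using a by (auto simp: A1_def)
    have "b [^] (t * q) = \<one>" using q b by (simp add: nat_pow_pow)
    thus ?thesis using t(2)[of b "t * q"] t(1) b q(1) by simp
  qed
  moreover have gen: "generate G ((\<lambda>a. a [^] t) ` S) = A1"
  proof -
    have "generate (G\<lparr>carrier := A\<rparr>) ((\<lambda>a. a [^] t) ` S) = A1"
      using p.generate_img[of S] SA by (simp add: gS A1_def)
    moreover have "(\<lambda>a. a [^] t) ` S \<subseteq> A"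
      using SA A1A by (auto simp: A1_def)
    ultimately show ?thesis using generate_consistent[OF _ A.subgroup_axioms] by simp
  qed
  moreover have "(\<lambda>a. a [^] t) ` S \<subseteq> carrier G" using S(2) by auto
  ultimately have central: "a \<otimes> x = x \<otimes> a" if a: "a \<in> A1" and x: "x \<in> carrier G" for a x
  proof -
    obtain k :: nat where k: "k > 0" "\<And>a. a \<in> A \<Longrightarrow> x [^] k \<otimes> a = a \<otimes> x [^] k"
      using cent[OF x] by blast
    interpret act: finite_order_action G A1 x k
      by (intro finite_order_action.intro finite_order_action_axioms.intro is_group)
        (use \<open>A1 \<lhd> G\<close> tf comm1 A1A x k in auto)
    show ?thesis
      using act.fg_imp_centralizes[OF P _ _ gen a] S(1,2) by auto
  qed
  have L: "lcs G n \<lhd> G" using lcs_in_normal[OF normal_self, of n] by (simp add: lcs_in_carrier)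
  have "finite_mod A A1"
  proof -
    obtain R where R: "finite R" "R \<subseteq> A" "\<forall>a \<in> A. \<exists>b \<in> A. \<exists>r \<in> R. a = b [^] t \<otimes> r"
      using GA.fg_finite_mod_powers[of S t] S(1) SA t(1) unfolding gS pow by auto
    show ?thesis
      unfolding finite_mod_def
    proof (intro exI[of _ R] conjI ballI)
      show "R \<subseteq> carrier G" using R(2) A.subset by blast
      fix a assume "a \<in> A"
      then obtain b r where "b \<in> A" "r \<in> R" "a = b [^] t \<otimes> r" using R(3) by blast
      thus "\<exists>n\<in>A1. \<exists>r\<in>R. a = n \<otimes> r" by (auto simp: A1_def)
    qed (rule R(1))
  qed
  with fin have "finite_mod (lcs G n) A1"
    by (rule finite_mod_trans) (rule subgroup.subset[OF A1_sub])
  then obtain R where R: "finite R" "R \<subseteq> carrier G" "\<And>l. l \<in> lcs G n \<Longrightarrow> \<exists>a \<in> A1. \<exists>r \<in> R. l = a \<otimes> r"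
    unfolding finite_mod_def by blast
  have "(\<lambda>l. A1 #> l) ` lcs G n \<subseteq> (\<lambda>r. A1 #> r) ` R"
  proof
    fix c assume "c \<in> (\<lambda>l. A1 #> l) ` lcs G n"
    then obtain a r where ar: "a \<in> A1" "r \<in> R" "c = A1 #> (a \<otimes> r)" using R(3) by blast
    have "c = A1 #> a #> r"
      using ar R(2) A1A A.subset by (subst coset_mult_assoc[OF subgroup.subset[OF A1_sub]]) auto
    also have "A1 #> a = A1" using ar A1A A.subset by (intro coset_join2[OF _ A1_sub]) auto
    finally show "c \<in> (\<lambda>r. A1 #> r) ` R" using ar(2) by blast
  qed
  hence "finite ((\<lambda>l. A1 #> l) ` lcs G n)" using R(1) finite_subset by blast
  then interpret tr: central_transfer G A1 "lcs G n"
    by (intro central_transfer.intro central_transfer_axioms.intro is_group A1_sub L)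
      (use central in auto)
  have "finite (lcs G (Suc n))" using tr.finite_commutators[OF tf] by simp
  thus ?thesis by blast
qed

text \<open>Collects what an induction down the series of \<open>N\<close> needs about the factor of
  \<open>B i\<close> by \<open>B (Suc i)\<close>, seen inside the quotient of \<open>G\<close>: it
  is normal, finitely generated and centralized by the image of \<open>N\<close>.\<close>

lemma lcs_quotient:
  assumes N: "N \<lhd> G" and S0: "finite S0" "S0 \<subseteq> N" "generate G S0 = N"
  defines "B i \<equiv> lcs_in G N i"
  defines "Q i \<equiv> G Mod B (Suc i)" and "\<pi> i \<equiv> (\<lambda>x. B (Suc i) #> x)"
  shows "group_hom G (Q i) (\<pi> i)" (is ?hom)
    and "\<pi> i ` carrier G = carrier (Q i)" (is ?onto)
    and "\<pi> i ` B i \<lhd> Q i" (is ?normal)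
    and "\<And>a b. \<lbrakk>a \<in> B i; b \<in> N\<rbrakk> \<Longrightarrow> \<pi> i a \<otimes>\<^bsub>Q i\<^esub> \<pi> i b = \<pi> i b \<otimes>\<^bsub>Q i\<^esub> \<pi> i a"
    and "\<exists>S. finite S \<and> S \<subseteq> carrier (Q i) \<and> generate (Q i) S = \<pi> i ` B i"
    and "\<And>a b. \<lbrakk>a \<in> carrier G; b \<in> carrier G; \<pi> i a = \<pi> i b\<rbrakk> \<Longrightarrow> a \<otimes> inv b \<in> B (Suc i)"
proof -
  interpret N: normal N G by fact
  interpret B: normal "B (Suc i)" G unfolding B_def by (rule lcs_in_normal[OF N])
  show hom: ?hom
    unfolding Q_def \<pi>_def
    by (intro group_hom.intro B.factorgroup_is_group is_group group_hom_axioms.intro B.r_coset_hom_Mod)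
  interpret \<pi>: group_hom G "Q i" "\<pi> i" by (rule hom)
  show onto: ?onto by (simp add: Q_def \<pi>_def carrier_FactGroup)
  show ?normal
    using normal.surj_hom_normal_subgroup[OF lcs_in_normal[OF N] hom onto] by (simp add: B_def)
  have ker: "\<pi> i b = \<one>\<^bsub>Q i\<^esub>" if "b \<in> B (Suc i)" for b
    unfolding Q_def \<pi>_def using that coset_join2[OF _ B.subgroup_axioms] by simp
  show "\<pi> i a \<otimes>\<^bsub>Q i\<^esub> \<pi> i b = \<pi> i b \<otimes>\<^bsub>Q i\<^esub> \<pi> i a" if ab: "a \<in> B i" "b \<in> N" for a b
  proof -
    have c: "a \<in> carrier G" "b \<in> carrier G"
      using ab lcs_in_carrier_subset[OF N.subgroup_axioms] by (auto simp: B_def)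
    have "commutator G a b \<in> B (Suc i)" using ab commutator_lcs_in unfolding B_def by blast
    hence "commutator (Q i) (\<pi> i a) (\<pi> i b) = \<one>\<^bsub>Q i\<^esub>" using ker c by (simp flip: \<pi>.commutator_img)
    thus ?thesis using c by (simp add: \<pi>.H.commutator_eq_one_iff)
  qed
  obtain S where S: "finite S" "S \<subseteq> B i" "generate G (S \<union> B (Suc i)) = B i"
    using lcs_in_fg_mod_next[OF N.subgroup_axioms S0, of i] unfolding B_def by blast
  have Bc: "B i \<subseteq> carrier G" using lcs_in_carrier_subset[OF N.subgroup_axioms] by (auto simp: B_def)
  \<comment> \<open>The infinite part \<open>B (Suc i)\<close> of the generating set collapses to
    the neutral element.\<close>
  have "\<pi> i ` (S \<union> B (Suc i)) \<subseteq> insert \<one>\<^bsub>Q i\<^esub> (\<pi> i ` S)" using ker by auto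
  hence "finite (\<pi> i ` (S \<union> B (Suc i)))" using S(1) finite_subset by blast
  moreover have sub: "S \<union> B (Suc i) \<subseteq> carrier G" using S(2) Bc B.subset by blast
  moreover have "generate (Q i) (\<pi> i ` (S \<union> B (Suc i))) = \<pi> i ` B i"
    using \<pi>.generate_img[OF sub] S(3) by simp
  ultimately show "\<exists>S. finite S \<and> S \<subseteq> carrier (Q i) \<and> generate (Q i) S = \<pi> i ` B i"
    using onto by (intro exI[of _ "\<pi> i ` (S \<union> B (Suc i))"]) blast
  show "a \<otimes> inv b \<in> B (Suc i)" if "a \<in> carrier G" "b \<in> carrier G" "\<pi> i a = \<pi> i b" for a b
    using that B.rcos_module[OF is_group, of b a] rcos_self[OF that(1) B.subgroup_axioms]
    by (simp add: \<pi>_def)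
qed

text \<open>In the quotient by the next term, the current factor is abelian and centralized by
  \<open>N\<close>. Since a power of every \<open>x\<close> lies in \<open>N\<close>, the action of
  \<open>x\<close> on the factor has finite order and the abelian case applies.\<close>

lemma finite_mod_lcs_in:
  assumes P: non_nilpotent_overgroups_normal and N: "N \<lhd> G" "finite_mod (carrier G) N"
    and S0: "finite S0" "S0 \<subseteq> N" "generate G S0 = N"
  shows "\<exists>n. finite_mod (lcs G n) (lcs_in G N i)"
proof (induction i)
  case 0
  show ?case using N(2) by (intro exI[of _ 0]) simp
next
  case (Suc i)
  interpret N: normal N G by (rule N(1))
  let ?B = "lcs_in G N (Suc i)"
  let ?Q = "G Mod ?B" and ?\<pi> = "\<lambda>x. ?B #> x"
  note q = lcs_quotient[OF N(1) S0, where i = i]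
  have Nc: "lcs_in G N i \<subseteq> carrier G" "lcs_in G N i \<subseteq> N"
    using lcs_in_subset[OF N.subgroup_axioms] N.subset by blast+
  interpret \<pi>: group_hom G ?Q ?\<pi> by (rule q(1))
  obtain n where "finite_mod (lcs G n) (lcs_in G N i)" using Suc by blast
  then obtain R where R: "finite R" "R \<subseteq> carrier G"
    "\<And>l. l \<in> lcs G n \<Longrightarrow> \<exists>a \<in> lcs_in G N i. \<exists>r \<in> R. l = a \<otimes> r"
    unfolding finite_mod_def by blast
  have lcsQ: "lcs ?Q n = ?\<pi> ` lcs G n" for n
    using \<pi>.lcs_in_img[OF subgroup_self, of n] q(2) by (simp add: lcs_in_carrier)
  obtain S where S: "finite S" "S \<subseteq> carrier ?Q" "generate ?Q S = ?\<pi> ` lcs_in G N i" using q(5) by blast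
  have "\<exists>m. finite (lcs ?Q m)"
  proof (rule \<pi>.H.finite_lcs_of_finite_mod_abelian[OF _ q(3) _ S])
    show "\<pi>.H.non_nilpotent_overgroups_normal"
      by (rule \<pi>.overgroups_normal_img[OF q(2) P])
    show "a \<otimes>\<^bsub>?Q\<^esub> b = b \<otimes>\<^bsub>?Q\<^esub> a" if "a \<in> ?\<pi> ` lcs_in G N i" "b \<in> ?\<pi> ` lcs_in G N i" for a b
      using that q(4) Nc(2) by blast
    fix y assume "y \<in> carrier ?Q"
    then obtain x where x: "x \<in> carrier G" "y = ?\<pi> x" using q(2) by blast
    obtain k :: nat where k: "k > 0" "x [^] k \<in> N"
      using finite_index_pow_mem[OF N.subgroup_axioms N(2) x(1)] .
    have "y [^]\<^bsub>?Q\<^esub> k = ?\<pi> (x [^] k)" using x \<pi>.hom_nat_pow[of x k] by simp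
    hence "\<forall>a \<in> ?\<pi> ` lcs_in G N i. y [^]\<^bsub>?Q\<^esub> k \<otimes>\<^bsub>?Q\<^esub> a = a \<otimes>\<^bsub>?Q\<^esub> y [^]\<^bsub>?Q\<^esub> k"
      using q(4) k(2) by fastforce
    thus "\<exists>k::nat>0. \<forall>a\<in>?\<pi> ` lcs_in G N i. y [^]\<^bsub>?Q\<^esub> k \<otimes>\<^bsub>?Q\<^esub> a = a \<otimes>\<^bsub>?Q\<^esub> y [^]\<^bsub>?Q\<^esub> k"
      using k(1) by blast
  next
    show "\<pi>.H.finite_mod (lcs ?Q n) (?\<pi> ` lcs_in G N i)"
      unfolding \<pi>.H.finite_mod_def
    proof (intro exI[of _ "?\<pi> ` R"] conjI ballI)
      show "?\<pi> ` R \<subseteq> carrier ?Q" using R(2) q(2) by blast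
      fix l assume "l \<in> lcs ?Q n"
      then obtain l' where l': "l' \<in> lcs G n" "l = ?\<pi> l'" by (auto simp: lcsQ)
      then obtain a r where ar: "a \<in> lcs_in G N i" "r \<in> R" "l' = a \<otimes> r" using R(3) by blast
      have "l = ?\<pi> a \<otimes>\<^bsub>?Q\<^esub> ?\<pi> r"
        unfolding l'(2) ar(3) using ar(1,2) Nc(1) R(2) by (intro \<pi>.hom_mult) auto
      thus "\<exists>a\<in>?\<pi> ` lcs_in G N i. \<exists>r\<in>?\<pi> ` R. l = a \<otimes>\<^bsub>?Q\<^esub> r" using ar by blast
    qed (use R(1) in simp)
  qed
  then obtain m where m: "finite (?\<pi> ` lcs G m)" using lcsQ by auto
  \<comment> \<open>A finite image in the quotient means finiteness modulo its kernel
    \<open>?B\<close>.\<close>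
  have "finite_mod (lcs G m) ?B"
  proof (rule finite_modI[OF lcs_in_subgroup[OF N.subgroup_axioms] _ m])
    show sub: "lcs G m \<subseteq> carrier G" using lcs_in_carrier_subset[OF subgroup_self] by (auto simp: lcs_in_carrier)
    show "a \<otimes> inv b \<in> ?B" if "a \<in> lcs G m" "b \<in> lcs G m" "?\<pi> a = ?\<pi> b" for a b
      using that sub q(6) by blast
  qed
  thus ?case by blast
qed

text \<open>Each factor of the series is a finitely generated abelian torsion group, hence finite.
  The contrapositive later supplies an element of infinite order.\<close>

lemma nilpotent_torsion_finite:
  assumes N: "N \<lhd> G" and S0: "finite S0" "S0 \<subseteq> N" "generate G S0 = N"
    and nil: "lcs_in G N c \<subseteq> {\<one>}"
    and tors: "\<And>a. a \<in> N \<Longrightarrow> \<exists>q::nat > 0. a [^] q = \<one>"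
  shows "finite N"
proof -
  interpret N: normal N G by (rule N)
  have "finite_mod N (lcs_in G N i)" for i
  proof (induction i)
    case 0
    have "\<exists>n \<in> N. \<exists>r \<in> {\<one>}. l = n \<otimes> r" if "l \<in> N" for l using that by (intro bexI[of _ l "N"]) auto
    thus ?case unfolding finite_mod_def by (intro exI[of _ "{\<one>}"]) auto
  next
    case (Suc i)
    let ?B = "lcs_in G N (Suc i)"
    let ?Q = "G Mod ?B" and ?\<pi> = "\<lambda>x. ?B #> x"
    note q = lcs_quotient[OF N(1) S0, where i = i]
    have Nc: "lcs_in G N i \<subseteq> carrier G" "lcs_in G N i \<subseteq> N"
      using lcs_in_subset[OF N.subgroup_axioms] N.subset by blast+
    interpret \<pi>: group_hom G ?Q ?\<pi> by (rule q(1))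
    interpret A: normal "?\<pi> ` lcs_in G N i" ?Q by (rule q(3))
    let ?A = "?Q\<lparr>carrier := ?\<pi> ` lcs_in G N i\<rparr>"
    interpret A: comm_group ?A
    proof (rule group.group_comm_groupI[OF A.subgroup_is_group[OF \<pi>.H.is_group]])
      fix a b assume "a \<in> carrier ?A" "b \<in> carrier ?A"
      thus "a \<otimes>\<^bsub>?A\<^esub> b = b \<otimes>\<^bsub>?A\<^esub> a" using q(4) Nc(2) by auto
    qed
    obtain S where S: "finite S" "S \<subseteq> carrier ?Q" "generate ?Q S = ?\<pi> ` lcs_in G N i" using q(5) by blast
    have SA: "S \<subseteq> ?\<pi> ` lcs_in G N i" using generate.incl[of _ S ?Q] S(3) by blast
    have "finite (generate ?A S)"
    proof (rule A.fg_torsion_finite[OF S(1)])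
      show "S \<subseteq> carrier ?A" using SA by simp
      fix y assume "y \<in> S"
      then obtain a where a: "a \<in> lcs_in G N i" "y = ?\<pi> a" using SA by blast
      obtain k :: nat where k: "k > 0" "a [^] k = \<one>" using tors a Nc(2) by blast
      have "y [^]\<^bsub>?A\<^esub> k = ?\<pi> (a [^] k)"
        using a subsetD[OF Nc(1) a(1)] \<pi>.hom_nat_pow[of a k]
        by (simp add: \<pi>.H.nat_pow_consistent[symmetric])
      thus "\<exists>k::nat>0. y [^]\<^bsub>?A\<^esub> k = \<one>\<^bsub>?A\<^esub>" using k \<pi>.hom_one by auto
    qed
    hence "finite (?\<pi> ` lcs_in G N i)"
      using \<pi>.H.generate_consistent[OF SA A.subgroup_axioms] S(3) by simp
    hence "finite_mod (lcs_in G N i) ?B"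
      by (rule finite_modI[OF lcs_in_subgroup[OF N.subgroup_axioms] Nc(1)]) (use Nc(1) q(6) in blast)
    with Suc show ?case
      by (rule finite_mod_trans) (rule subgroup.subset[OF lcs_in_subgroup[OF N.subgroup_axioms]])
  qed
  moreover have "lcs_in G N c = {\<one>}"
    using nil subgroup.one_closed[OF lcs_in_subgroup[OF N.subgroup_axioms, of c]] by blast
  ultimately show ?thesis using finite_mod_trivial by metis
qed

end

section \<open>Schmidt's theorem\<close>

context group
begin

text \<open>The last term of the series of \<open>M\<close> that is not contained in
  \<open>D\<close> normalizes \<open>D\<close>, because its commutators with \<open>D\<close> fall
  into the next term, which lies in \<open>D\<close>. Such a term exists since \<open>M\<close>
  itself is not contained in \<open>D\<close>.\<close>

lemma nilpotent_normalizer_grows: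
  assumes M: "subgroup M G" "nilpotent_group (G\<lparr>carrier := M\<rparr>)" and D: "subgroup D G" "D \<subset> M"
  obtains y where "y \<in> M" "y \<notin> D" "y \<in> normalizing D"
proof -
  interpret D: subgroup D G by fact
  obtain c where "lcs_in G M c \<subseteq> {\<one>}" using M nilpotent_subgroup_iff by blast
  hence "lcs_in G M c \<subseteq> D" using D.one_closed by blast
  then obtain i where i: "lcs_in G M i \<subseteq> D" "\<And>j. j < i \<Longrightarrow> \<not> lcs_in G M j \<subseteq> D"
    using exists_least_iff[of "\<lambda>i. lcs_in G M i \<subseteq> D"] by blast
  have "i \<noteq> 0" using i(1) D(2) by (metis lcs_in.simps(1) psubset_imp_ex_mem DiffE subsetD)
  then obtain j where j: "i = Suc j" using not0_implies_Suc by blast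
  obtain y where y: "y \<in> lcs_in G M j" "y \<notin> D" using i(2)[of j] j by blast
  have conj: "inv z \<otimes> d \<otimes> z \<in> D" if z: "z \<in> lcs_in G M j" and d: "d \<in> D" for z d
  proof -
    have c: "z \<in> carrier G" using lcs_in_carrier_subset[OF M(1) z] .
    have "commutator G z (inv d) \<in> D"
      using commutator_lcs_in[OF z, of "inv d"] i(1) j d D(2) by (metis D.m_inv_closed psubsetD subsetD)
    hence "commutator G z (inv d) \<otimes> d \<in> D" using d by simp
    moreover have "commutator G z (inv d) \<otimes> d = inv z \<otimes> d \<otimes> z" using c d by (simp add: word_simps)
    ultimately show ?thesis by simp
  qed
  have y': "inv y \<in> lcs_in G M j" "y \<in> carrier G"
    using y subgroup.m_inv_closed[OF lcs_in_subgroup[OF M(1)]] lcs_in_carrier_subset[OF M(1)] by blast+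
  have "y \<in> normalizing D"
    using conj[OF y(1)] conj[OF y'(1)] y'(2) by (simp add: normalizing_def)
  thus ?thesis using that y lcs_in_subset[OF M(1)] by blast
qed

section \<open>Maximal subgroups and conjugation of subgroups\<close>

definition maximal_subgroup :: "'a set \<Rightarrow> bool" where
  "maximal_subgroup M \<longleftrightarrow> subgroup M G \<and> M \<noteq> carrier G \<and>
     (\<forall>K. subgroup K G \<and> M \<subseteq> K \<longrightarrow> K = M \<or> K = carrier G)"

lemma maximal_subgroupD:
  assumes "maximal_subgroup M"
  shows "subgroup M G" "M \<subseteq> carrier G" "M \<noteq> carrier G"
proof -
  show "subgroup M G" "M \<noteq> carrier G" using assms by (auto simp: maximal_subgroup_def)
  thus "M \<subseteq> carrier G" by (intro subgroup.subset)
qed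

lemma maximal_subgroup_eq:
  assumes "maximal_subgroup M" "maximal_subgroup K" "M \<subseteq> K"
  shows "M = K"
  using assms unfolding maximal_subgroup_def by blast

lemma maximal_subgroup_exists:
  assumes "finite (carrier G)" "subgroup H G" "H \<noteq> carrier G"
  obtains M where "maximal_subgroup M" "H \<subseteq> M"
proof -
  let ?X = "{K. subgroup K G \<and> K \<noteq> carrier G}"
  have "?X \<subseteq> Pow (carrier G)" using subgroup.subset by blast
  hence "finite ?X" using assms(1) by (meson finite_Pow_iff finite_subset)
  then obtain M where M: "M \<in> ?X" "H \<subseteq> M" "\<And>K. K \<in> ?X \<Longrightarrow> M \<subseteq> K \<Longrightarrow> M = K"
    using finite_has_maximal2[of ?X H] assms by auto
  hence "maximal_subgroup M" unfolding maximal_subgroup_def by blast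
  thus ?thesis using that M(2) by blast
qed

definition conj_set :: "'a \<Rightarrow> 'a set \<Rightarrow> 'a set" where
  "conj_set g M = (\<lambda>m. inv g \<otimes> m \<otimes> g) ` M"

lemma conj_set_subgroup:
  assumes "subgroup M G" "g \<in> carrier G"
  shows "subgroup (conj_set g M) G"
  unfolding conj_set_def
  by (rule group_hom.subgroup_img_is_subgroup[OF conj_hom[OF assms(2)] assms(1)])

lemma conj_set_mult:
  assumes "M \<subseteq> carrier G" "g \<in> carrier G" "h \<in> carrier G"
  shows "conj_set h (conj_set g M) = conj_set (g \<otimes> h) M"
  unfolding conj_set_def image_image
  using assms by (intro image_cong) (auto simp: m_assoc inv_mult_group subset_iff)

lemma conj_set_one: "M \<subseteq> carrier G \<Longrightarrow> conj_set \<one> M = M"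
  unfolding conj_set_def by (force simp: subset_iff)

lemma conj_set_inv:
  assumes "M \<subseteq> carrier G" "g \<in> carrier G"
  shows "conj_set (inv g) (conj_set g M) = M" "conj_set g (conj_set (inv g) M) = M"
  using assms by (simp_all add: conj_set_mult conj_set_one)

lemma conj_set_mono: "M \<subseteq> K \<Longrightarrow> conj_set g M \<subseteq> conj_set g K"
  unfolding conj_set_def by blast

lemma conj_set_carrier: "g \<in> carrier G \<Longrightarrow> conj_set g (carrier G) = carrier G"
proof
  assume g: "g \<in> carrier G"
  show "conj_set g (carrier G) \<subseteq> carrier G" using g by (auto simp: conj_set_def)
  have "conj_set (inv g) (carrier G) \<subseteq> carrier G" using g by (auto simp: conj_set_def)
  from conj_set_mono[OF this, of g] show "carrier G \<subseteq> conj_set g (carrier G)"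
    using g by (simp add: conj_set_inv)
qed

lemma conj_set_eq_imp_normalizing:
  assumes "M \<subseteq> carrier G" "g \<in> carrier G" "conj_set g M = M"
  shows "g \<in> normalizing M"
proof -
  have "conj_set (inv g) M = M" using conj_set_inv(1)[OF assms(1,2)] assms(3) by simp
  hence "inv (inv g) \<otimes> d \<otimes> inv g \<in> M" if "d \<in> M" for d using that unfolding conj_set_def by blast
  moreover have "inv g \<otimes> d \<otimes> g \<in> M" if "d \<in> M" for d using that assms(3) unfolding conj_set_def by blast
  ultimately show ?thesis using assms(2) by (simp add: normalizing_def)
qed

lemma card_conj_set:
  assumes "M \<subseteq> carrier G" "g \<in> carrier G"
  shows "card (conj_set g M) = card M"
  unfolding conj_set_def
proof (rule card_image, rule inj_onI)
  fix a b assume "a \<in> M" "b \<in> M" "inv g \<otimes> a \<otimes> g = inv g \<otimes> b \<otimes> g"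
  thus "a = b" using assms by (simp add: subset_iff)
qed

lemma conj_set_maximal:
  assumes M: "maximal_subgroup M" and g: "g \<in> carrier G"
  shows "maximal_subgroup (conj_set g M)"
  unfolding maximal_subgroup_def
proof (intro conjI allI impI)
  note sub = maximal_subgroupD[OF M]
  show "subgroup (conj_set g M) G" by (rule conj_set_subgroup[OF sub(1) g])
  show "conj_set g M \<noteq> carrier G"
    using conj_set_inv(1)[OF sub(2) g] conj_set_carrier[of "inv g"] g sub(3) by auto
  fix K assume K: "subgroup K G \<and> conj_set g M \<subseteq> K"
  hence Kc: "K \<subseteq> carrier G" using subgroup.subset by blast
  have "M \<subseteq> conj_set (inv g) K"
    using conj_set_mono[of "conj_set g M" K "inv g"] K conj_set_inv(1)[OF sub(2) g] by simp
  moreover have "subgroup (conj_set (inv g) K) G" using K g by (intro conj_set_subgroup) auto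
  ultimately have "conj_set (inv g) K = M \<or> conj_set (inv g) K = carrier G"
    using M unfolding maximal_subgroup_def by blast
  thus "K = conj_set g M \<or> K = carrier G"
    using conj_set_inv(2)[OF Kc g] conj_set_carrier[OF g] by auto
qed

end

text \<open>Schmidt's counting argument: in a finite simple group all of whose proper subgroups are
  nilpotent, distinct maximal subgroups meet trivially, so that the conjugates of one maximal
  subgroup cover at least half of the group, but not all of it.\<close>
locale schmidt_simple = group +
  assumes fin: "finite (carrier G)"
    and simple: "\<And>N. N \<lhd> G \<Longrightarrow> N = {\<one>} \<or> N = carrier G"
    and nonabelian: "\<exists>x \<in> carrier G. \<exists>y \<in> carrier G. x \<otimes> y \<noteq> y \<otimes> x"
    and proper_nilpotent:
      "\<And>H. \<lbrakk>subgroup H G; H \<noteq> carrier G\<rbrakk> \<Longrightarrow> nilpotent_group (G\<lparr>carrier := H\<rparr>)"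
begin

text \<open>Among distinct maximal subgroups with nontrivial intersection take a pair with largest
  intersection \<open>D\<close>. By simplicity the normalizer of \<open>D\<close> lies in a maximal
  \<open>M\<close>. Normalizers grow in nilpotent groups, so any maximal \<open>K\<close> properly
  above \<open>D\<close> meets \<open>M\<close> in more than \<open>D\<close> and must equal
  \<open>M\<close>; this applies to both members of the pair.\<close>

lemma maximal_inter_trivial:
  assumes "maximal_subgroup M1" "maximal_subgroup M2" "M1 \<noteq> M2"
  shows "M1 \<inter> M2 = {\<one>}"
proof (rule ccontr)
  assume ne: "M1 \<inter> M2 \<noteq> {\<one>}"
  let ?P = "\<lambda>(A, B). maximal_subgroup A \<and> maximal_subgroup B \<and> A \<noteq> B \<and> A \<inter> B \<noteq> {\<one>}"
  have bound: "card (fst p \<inter> snd p) < Suc (card (carrier G))" if "?P p" for p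
  proof -
    have "fst p \<inter> snd p \<subseteq> carrier G"
      using that maximal_subgroupD(2)[of "fst p"] by (auto simp: case_prod_beta)
    thus ?thesis using card_mono[OF fin] by (simp add: less_Suc_eq_le)
  qed
  have "?P (M1, M2)" using assms ne by simp
  from ex_has_greatest_nat[of ?P, OF this, of "\<lambda>p. card (fst p \<inter> snd p)" "Suc (card (carrier G))"] bound
  obtain p where p: "?P p" "\<And>q. ?P q \<Longrightarrow> card (fst q \<inter> snd q) \<le> card (fst p \<inter> snd p)" by blast
  obtain A B where pAB: "p = (A, B)" by (cases p)
  have AB: "maximal_subgroup A" "maximal_subgroup B" "A \<noteq> B" "A \<inter> B \<noteq> {\<one>}"
    using p(1) unfolding pAB by auto
  have greatest: "card (A' \<inter> B') \<le> card (A \<inter> B)"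
    if "maximal_subgroup A'" "maximal_subgroup B'" "A' \<noteq> B'" "A' \<inter> B' \<noteq> {\<one>}" for A' B'
    using p(2)[of "(A', B')"] that unfolding pAB by simp
  define D where "D = A \<inter> B"
  note sub = maximal_subgroupD[OF AB(1)] maximal_subgroupD[OF AB(2)]
  have D: "subgroup D G" unfolding D_def using sub by (intro subgroups_Inter_pair)
  have DA: "D \<subset> A" "D \<subset> B"
    using maximal_subgroup_eq[of A B] maximal_subgroup_eq[of B A] AB unfolding D_def by blast+
  have "normalizing D \<noteq> carrier G"
  proof
    assume "normalizing D = carrier G"
    from simple[OF normal_if_normalizing[OF D this]] show False
      using AB(4) DA(1) sub(2,3) unfolding D_def by blast
  qed
  then obtain M where M: "maximal_subgroup M" "normalizing D \<subseteq> M"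
    using maximal_subgroup_exists[OF fin normalizing_subgroup[OF subgroup.subset[OF D]]] by blast
  have "K = M" if K: "maximal_subgroup K" "D \<subset> K" for K
  proof (rule ccontr)
    assume "K \<noteq> M"
    note subK = maximal_subgroupD(1,3)[OF K(1)]
    obtain y where y: "y \<in> K" "y \<notin> D" "y \<in> normalizing D"
      using nilpotent_normalizer_grows[OF subK(1) proper_nilpotent[OF subK] D K(2)] .
    have "D \<subset> K \<inter> M" using y M(2) K(2) subset_normalizing[OF D] by blast
    moreover have "finite (K \<inter> M)" using fin subgroup.subset[OF subK(1)] finite_subset by blast
    ultimately have "card D < card (K \<inter> M)" by (simp add: psubset_card_mono)
    moreover have "K \<inter> M \<noteq> {\<one>}"
    proof
      assume "K \<inter> M = {\<one>}"
      hence "D \<subset> {\<one>}" using \<open>D \<subset> K \<inter> M\<close> by metis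
      thus False using subgroup.one_closed[OF D] by blast
    qed
    ultimately show False using greatest[OF K(1) M(1) \<open>K \<noteq> M\<close>] by (simp add: D_def)
  qed
  from this[OF AB(1) DA(1)] this[OF AB(2) DA(2)] AB(3) show False by simp
qed

section \<open>Counting the elements covered by the conjugates of a maximal subgroup\<close>

definition conjugates where "conjugates M = (\<lambda>g. conj_set g M) ` carrier G"

definition cover where "cover M = (\<Union>C \<in> conjugates M. C - {\<one>})"

text \<open>By maximality and simplicity \<open>M\<close> is its own normalizer, so two elements
  give the same conjugate exactly when they lie in the same right coset.\<close>

lemma card_conjugates:
  assumes M: "maximal_subgroup M" "M \<noteq> {\<one>}"
  shows "card (conjugates M) = card (rcosets M)"
proof -
  note sub = maximal_subgroupD(1,3)[OF M(1)]
  interpret M: subgroup M G by fact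
  have nz: "normalizing M = M"
  proof -
    have "normalizing M \<noteq> carrier G"
      using simple[OF normal_if_normalizing[OF sub(1)]] M(2) sub(2) by blast
    thus ?thesis
      using M(1) normalizing_subgroup[OF M.subset] subset_normalizing[OF sub(1)]
      unfolding maximal_subgroup_def by blast
  qed
  \<comment> \<open>\<open>F\<close> sends the coset of \<open>g\<close> to the conjugate by
    \<open>g\<close>; the equivalence \<open>eqI\<close> makes it independent of the chosen
    representative, and injective.\<close>
  define F where "F c = conj_set (SOME g. g \<in> carrier G \<and> c = M #> g) M" for c
  have eqI: "M #> g = M #> h \<longleftrightarrow> conj_set g M = conj_set h M" if g: "g \<in> carrier G" "h \<in> carrier G" for g h
  proof -
    have "M #> g = M #> h \<longleftrightarrow> g \<otimes> inv h \<in> M"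
      using g by (metis M.rcos_module is_group rcos_self repr_independence sub(1))
    also have "\<dots> \<longleftrightarrow> conj_set (g \<otimes> inv h) M = M"
    proof
      assume gh: "g \<otimes> inv h \<in> M"
      hence "inv (g \<otimes> inv h) \<in> M" by (rule M.m_inv_closed)
      have "conj_set k M \<subseteq> M" if "k \<in> M" for k using that by (auto simp: conj_set_def)
      from this[OF gh] conj_set_mono[OF this[OF \<open>inv (g \<otimes> inv h) \<in> M\<close>], of "g \<otimes> inv h"]
      show "conj_set (g \<otimes> inv h) M = M" using g conj_set_inv(2)[OF M.subset, of "g \<otimes> inv h"] by simp
    next
      assume "conj_set (g \<otimes> inv h) M = M"
      from conj_set_eq_imp_normalizing[OF M.subset _ this] show "g \<otimes> inv h \<in> M" using g nz by simp
    qed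
    also have "\<dots> \<longleftrightarrow> conj_set (inv h) (conj_set g M) = M" using g by (simp add: conj_set_mult M.subset)
    also have "\<dots> \<longleftrightarrow> conj_set g M = conj_set h M"
    proof
      assume "conj_set (inv h) (conj_set g M) = M"
      moreover have "conj_set g M \<subseteq> carrier G" by (rule subgroup.subset[OF conj_set_subgroup[OF sub(1) g(1)]])
      ultimately show "conj_set g M = conj_set h M" using conj_set_inv(2)[of "conj_set g M" h] g by simp
    next
      assume "conj_set g M = conj_set h M"
      thus "conj_set (inv h) (conj_set g M) = M" using conj_set_inv(1)[OF M.subset] g by simp
    qed
    finally show ?thesis .
  qed
  have F: "F (M #> g) = conj_set g M" if g: "g \<in> carrier G" for g
  proof -
    have "\<exists>h. h \<in> carrier G \<and> M #> g = M #> h" using g by blast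
    from someI_ex[OF this] show ?thesis unfolding F_def using eqI[OF g] by blast
  qed
  have "bij_betw F (rcosets M) (conjugates M)"
  proof (rule bij_betw_imageI)
    show "inj_on F (rcosets M)"
    proof (rule inj_onI)
      fix c d assume "c \<in> rcosets M" "d \<in> rcosets M" and eq: "F c = F d"
      then obtain g h where "g \<in> carrier G" "h \<in> carrier G" "c = M #> g" "d = M #> h"
        by (auto simp: RCOSETS_def)
      thus "c = d" using eq by (simp add: F eqI)
    qed
    show "F ` (rcosets M) = conjugates M"
      unfolding conjugates_def RCOSETS_def using F by auto
  qed
  thus ?thesis by (simp add: bij_betw_same_card)
qed

lemma conjugate_maximal: "maximal_subgroup M \<Longrightarrow> C \<in> conjugates M \<Longrightarrow> maximal_subgroup C"
  unfolding conjugates_def using conj_set_maximal by blast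

text \<open>With index \<open>n\<close> and order \<open>m\<close> of \<open>M\<close>, the
  conjugates contribute \<open>n\<close> disjoint sets of size \<open>m - 1\<close>, and
  \<open>n m\<close> is the order of the group. From \<open>m \<ge> 2\<close> follows
  \<open>m \<le> 2 (m - 1)\<close>, whence at least half of the group is covered.\<close>

lemma card_cover:
  assumes M: "maximal_subgroup M" "M \<noteq> {\<one>}"
  shows "card (cover M) + card (rcosets M) = card (carrier G)"
    and "card (rcosets M) \<ge> 2" "2 * card (cover M) \<ge> card (carrier G)"
proof -
  note sub = maximal_subgroupD(1,3)[OF M(1)]
  interpret M: subgroup M G by fact
  have finC: "finite (conjugates M)" unfolding conjugates_def using fin by simp
  have finM: "finite C" if "C \<in> conjugates M" for C
    using maximal_subgroupD(2)[OF conjugate_maximal[OF M(1) that]] fin finite_subset by blast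
  have card1: "card (C - {\<one>}) = card M - 1" if C: "C \<in> conjugates M" for C
  proof -
    have "\<one> \<in> C" by (rule subgroup.one_closed[OF maximal_subgroupD(1)[OF conjugate_maximal[OF M(1) C]]])
    moreover have "card C = card M" using C card_conj_set[OF M.subset] unfolding conjugates_def by blast
    ultimately show ?thesis using finM[OF C] by simp
  qed
  have "card (cover M) = (\<Sum>C \<in> conjugates M. card (C - {\<one>}))"
    unfolding cover_def
  proof (rule card_UN_disjoint[OF finC])
    show "\<forall>C \<in> conjugates M. finite (C - {\<one>})" using finM by blast
    show "\<forall>C \<in> conjugates M. \<forall>C' \<in> conjugates M. C \<noteq> C' \<longrightarrow> (C - {\<one>}) \<inter> (C' - {\<one>}) = {}"
      using maximal_inter_trivial conjugate_maximal[OF M(1)] by blast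
  qed
  hence cov: "card (cover M) = card (rcosets M) * (card M - 1)"
    using card1 card_conjugates[OF M] by simp
  have lag: "card (rcosets M) * card M = card (carrier G)"
    using lagrange_finite[OF fin sub(1)] by (simp add: order_def)
  have finM': "finite M" using fin M.subset finite_subset by blast
  have m2: "card M \<ge> 2"
  proof (rule ccontr)
    assume "\<not> card M \<ge> 2"
    moreover have "M \<noteq> {}" using M.one_closed by blast
    hence "card M > 0" using finM' by (simp add: card_gt_0_iff)
    ultimately have "card M = 1" by simp
    then obtain u where "M = {u}" by (rule card_1_singletonE)
    thus False using M(2) M.one_closed by blast
  qed
  show "card (cover M) + card (rcosets M) = card (carrier G)"
  proof -
    obtain j where "card M = Suc j" using m2 by (cases "card M") auto
    thus ?thesis using cov lag by simp
  qed
  have "carrier G \<noteq> {}" using one_closed by blast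
  hence "card (carrier G) > 0" using fin by (simp add: card_gt_0_iff)
  show "card (rcosets M) \<ge> 2"
  proof (rule ccontr)
    assume "\<not> card (rcosets M) \<ge> 2"
    moreover have "card (rcosets M) \<noteq> 0" using lag \<open>card (carrier G) > 0\<close> by (metis mult_0 less_numeral_extra(3))
    ultimately have "card (rcosets M) = 1" by simp
    hence "card M = card (carrier G)" using lag by simp
    thus False using card_subset_eq[OF fin M.subset] sub(2) by simp
  qed
  have "card M \<le> 2 * (card M - 1)" using m2 by simp
  hence "card (rcosets M) * card M \<le> card (rcosets M) * (2 * (card M - 1))" by (rule mult_le_mono2)
  thus "2 * card (cover M) \<ge> card (carrier G)" using cov lag by (simp add: mult.left_commute)
qed

lemma cover_subset: "maximal_subgroup M \<Longrightarrow> cover M \<subseteq> carrier G - {\<one>}"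
  unfolding cover_def using maximal_subgroupD(2)[OF conjugate_maximal] by blast

text \<open>A nonabelian group is not cyclic, so \<open>g\<close> generates a proper
  subgroup.\<close>

lemma mem_maximal_subgroup:
  assumes g: "g \<in> carrier G"
  obtains M where "maximal_subgroup M" "g \<in> M"
proof -
  have "generate G {g} \<noteq> carrier G"
  proof
    assume eq: "generate G {g} = carrier G"
    have "x \<otimes> y = y \<otimes> x" if xy: "x \<in> carrier G" "y \<in> carrier G" for x y
    proof -
      obtain i j :: int where "x = g [^] i" "y = g [^] j"
        using xy unfolding eq[symmetric] generate_pow[OF g] by blast
      thus ?thesis using g by (simp add: int_pow_mult[symmetric] add.commute)
    qed
    thus False using nonabelian by blast
  qed
  then obtain M where "maximal_subgroup M" "generate G {g} \<subseteq> M"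
    using maximal_subgroup_exists[OF fin generate_is_subgroup] g by (metis empty_subsetI insert_subset)
  thus ?thesis using that generate.incl[of g "{g}" G] by blast
qed

text \<open>As the index of \<open>M\<close> is at least 2, its conjugates miss some
  \<open>g\<close> other than \<open>\<one>\<close>. A maximal \<open>K\<close> through
  \<open>g\<close> is then not conjugate to \<open>M\<close>, so the two covers are disjoint sets of
  nontrivial elements; each has at least half the order of the group, which is too much.\<close>

lemma schmidt_simple_False: False
proof -
  obtain x where x: "x \<in> carrier G" "x \<noteq> \<one>" using nonabelian by force
  obtain M where M: "maximal_subgroup M" "x \<in> M" using mem_maximal_subgroup[OF x(1)] .
  have M1: "M \<noteq> {\<one>}" using M x by blast
  have c1: "card (carrier G - {\<one>}) = card (carrier G) - 1" using fin by simp
  have "card (cover M) < card (carrier G - {\<one>})"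
    using card_cover(1,2)[OF M(1) M1] c1 by linarith
  hence "cover M \<noteq> carrier G - {\<one>}" by (metis less_irrefl)
  then obtain g where g: "g \<in> carrier G" "g \<noteq> \<one>" "g \<notin> cover M"
    using cover_subset[OF M(1)] by blast
  obtain K where K: "maximal_subgroup K" "g \<in> K" using mem_maximal_subgroup[OF g(1)] .
  have K1: "K \<noteq> {\<one>}" using K g by blast
  note Kc = maximal_subgroupD(2)[OF K(1)] maximal_subgroupD(2)[OF M(1)]
  have "cover M \<inter> cover K = {}"
  proof (rule ccontr)
    assume "cover M \<inter> cover K \<noteq> {}"
    then obtain C C' y where C: "C \<in> conjugates M" "C' \<in> conjugates K" "y \<in> C" "y \<in> C'" "y \<noteq> \<one>"
      unfolding cover_def by blast
    have eq: "C = C'"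
      using maximal_inter_trivial[OF conjugate_maximal[OF M(1) C(1)] conjugate_maximal[OF K(1) C(2)]] C
      by blast
    obtain a b where ab: "a \<in> carrier G" "b \<in> carrier G" "C = conj_set a M" "C' = conj_set b K"
      using C(1,2) unfolding conjugates_def by blast
    have "K = conj_set (inv b) (conj_set a M)" using conj_set_inv(1)[OF Kc(1) ab(2)] ab eq by simp
    hence "K = conj_set (a \<otimes> inv b) M" using ab by (simp add: conj_set_mult[OF Kc(2)])
    hence "K \<in> conjugates M" using ab unfolding conjugates_def by blast
    thus False using K(2) g unfolding cover_def by blast
  qed
  hence "card (cover M) + card (cover K) = card (cover M \<union> cover K)"
    using cover_subset[OF M(1)] cover_subset[OF K(1)] fin
    by (intro card_Un_disjoint[symmetric]) (auto intro: finite_subset)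
  also have "\<dots> \<le> card (carrier G - {\<one>})"
    using cover_subset[OF M(1)] cover_subset[OF K(1)] fin by (intro card_mono) auto
  finally have "card (cover M) + card (cover K) \<le> card (carrier G) - 1" using c1 by simp
  moreover have "card (carrier G) > 0" using fin x by (auto simp: card_gt_0_iff)
  ultimately show False using card_cover(3)[OF M(1) M1] card_cover(3)[OF K(1) K1] by linarith
qed

end

section \<open>From the simple case to solubility\<close>

lemma (in group_hom) preimage_normal:
  assumes "N \<lhd> H"
  shows "{x \<in> carrier G. h x \<in> N} \<lhd> G"
proof (rule G.normal_conjI)
  interpret N: normal N H by fact
  show "subgroup {x \<in> carrier G. h x \<in> N} G" by (rule preimage_subgroup[OF N.subgroup_axioms])
  show "inv g \<otimes> k \<otimes> g \<in> {x \<in> carrier G. h x \<in> N}"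
    if "g \<in> carrier G" "k \<in> {x \<in> carrier G. h x \<in> N}" for g k
    using that N.inv_op_closed1[of "h g" "h k"] by simp
qed

context group
begin

text \<open>The quotient by a maximal proper normal subgroup is simple and inherits the nilpotency
  of proper subgroups; if the group were perfect, this quotient would be nonabelian, contrary to the
  counting argument.\<close>

lemma schmidt_not_perfect:
  assumes fin: "finite (carrier G)" and ne: "carrier G \<noteq> {\<one>}"
    and nil: "\<And>H. \<lbrakk>subgroup H G; H \<noteq> carrier G\<rbrakk> \<Longrightarrow> nilpotent_group (G\<lparr>carrier := H\<rparr>)"
  shows "derived G (carrier G) \<noteq> carrier G"
proof
  assume perfect: "derived G (carrier G) = carrier G"
  let ?X = "{N. N \<lhd> G \<and> N \<noteq> carrier G}"
  have "?X \<subseteq> Pow (carrier G)" using subgroup.subset normal_imp_subgroup by blast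
  hence "finite ?X" using fin by (meson finite_Pow_iff finite_subset)
  moreover have "{\<one>} \<in> ?X" using one_is_normal ne by blast
  ultimately obtain R where R: "R \<lhd> G" "R \<noteq> carrier G"
    and max: "\<And>N. \<lbrakk>N \<lhd> G; N \<noteq> carrier G; R \<subseteq> N\<rbrakk> \<Longrightarrow> R = N"
    using finite_has_maximal2[of ?X "{\<one>}"] by auto
  interpret R: normal R G by (rule R)
  let ?Q = "G Mod R" and ?\<pi> = "\<lambda>x. R #> x"
  interpret \<pi>: group_hom G ?Q ?\<pi>
    by (intro group_hom.intro R.factorgroup_is_group is_group group_hom_axioms.intro R.r_coset_hom_Mod)
  have onto: "?\<pi> ` carrier G = carrier ?Q" by (simp add: carrier_FactGroup)
  have ker: "?\<pi> r = \<one>\<^bsub>?Q\<^esub>" if "r \<in> R" for r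
    using that coset_join2[OF _ R.subgroup_axioms] by simp
  interpret schmidt_simple ?Q
  proof (intro schmidt_simple.intro schmidt_simple_axioms.intro \<pi>.H.is_group)
    show "finite (carrier ?Q)" using fin by (simp flip: onto)
    fix N assume N: "N \<lhd> ?Q"
    interpret N: normal N ?Q by (rule N)
    let ?p = "{x \<in> carrier G. R #> x \<in> N}"
    have img: "?\<pi> ` ?p = N" by (rule \<pi>.image_preimage[OF onto N.subgroup_axioms])
    have "R \<subseteq> ?p" using ker N.one_closed by auto
    hence "?p = carrier G \<or> R = ?p" using max[OF \<pi>.preimage_normal[OF N]] by blast
    thus "N = {\<one>\<^bsub>?Q\<^esub>} \<or> N = carrier ?Q"
    proof
      assume "?p = carrier G"
      thus ?thesis using img onto by auto
    next
      assume eq: "R = ?p"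
      have "N = ?\<pi> ` R" using img eq by simp
      hence "N \<subseteq> {\<one>\<^bsub>?Q\<^esub>}" using ker by blast
      thus ?thesis using N.one_closed by blast
    qed
  next
    show "\<exists>x\<in>carrier ?Q. \<exists>y\<in>carrier ?Q. x \<otimes>\<^bsub>?Q\<^esub> y \<noteq> y \<otimes>\<^bsub>?Q\<^esub> x"
    proof (rule ccontr)
      assume "\<not> ?thesis"
      hence "comm_group ?Q" by (intro \<pi>.H.group_comm_groupI) blast
      from derived_minimal[OF R(1) this] perfect R(2) R.subset show False by blast
    qed
  next
    fix H assume H: "subgroup H ?Q" "H \<noteq> carrier ?Q"
    let ?p = "{x \<in> carrier G. R #> x \<in> H}"
    have img: "?\<pi> ` ?p = H" by (rule \<pi>.image_preimage[OF onto H(1)])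
    have "?p \<noteq> carrier G" using img onto H(2) by metis
    from \<pi>.nilpotent_img[OF \<pi>.preimage_subgroup[OF H(1)] nil[OF \<pi>.preimage_subgroup[OF H(1)] this]]
    show "nilpotent_group (?Q\<lparr>carrier := H\<rparr>)" unfolding img .
  qed
  show False by (rule schmidt_simple_False)
qed

text \<open>The derived subgroup of a nontrivial \<open>E\<close> is proper, hence nilpotent, so its
  derived series terminates.\<close>

lemma schmidt_solvable:
  assumes E: "subgroup E G" "finite E"
    and nil: "\<And>H. \<lbrakk>subgroup H G; H \<subset> E\<rbrakk> \<Longrightarrow> nilpotent_group (G\<lparr>carrier := H\<rparr>)"
  shows "\<exists>n. (derived G ^^ n) E \<subseteq> {\<one>}"
proof (cases "E = {\<one>}")
  case True
  thus ?thesis by (intro exI[of _ 0]) simp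
next
  case False
  interpret E: group "G\<lparr>carrier := E\<rparr>" by (rule subgroup.subgroup_is_group[OF E(1) is_group])
  have "derived (G\<lparr>carrier := E\<rparr>) (carrier (G\<lparr>carrier := E\<rparr>)) \<noteq> carrier (G\<lparr>carrier := E\<rparr>)"
  proof (rule E.schmidt_not_perfect)
    fix H assume H: "subgroup H (G\<lparr>carrier := E\<rparr>)" "H \<noteq> carrier (G\<lparr>carrier := E\<rparr>)"
    have "subgroup H G" by (rule incl_subgroup[OF E(1) H(1)])
    moreover have "H \<subset> E" using subgroup.subset[OF H(1)] H(2) by auto
    ultimately show "nilpotent_group (G\<lparr>carrier := E, carrier := H\<rparr>)" using nil by simp
  qed (use E(2) False in auto)
  hence "derived G E \<noteq> E" using derived_consistent[OF subset_refl E(1)] by simp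
  hence "derived G E \<subset> E" using derived_incl[OF subset_refl E(1)] by blast
  moreover have sub: "subgroup (derived G E) G" by (rule derived_is_subgroup[OF subgroup.subset[OF E(1)]])
  ultimately obtain n where "(derived G ^^ n) (derived G E) \<subseteq> {\<one>}"
    using nilpotent_imp_derived_trivial[OF sub nil[OF sub]] by blast
  hence "(derived G ^^ Suc n) E \<subseteq> {\<one>}" by (simp add: funpow_swap1)
  thus ?thesis by blast
qed

end

section \<open>The insoluble case\<close>

context group
begin

text \<open>The powers of \<open>y\<close> induce only finitely many permutations of
  \<open>F\<close>. If \<open>i < j\<close> give the same one, then \<open>y [^] (j - i)\<close>
  centralizes \<open>F\<close>.\<close>

lemma infinite_order_centralizer:
  assumes F: "F \<lhd> G" "finite F" and y: "y \<in> carrier G" "\<And>q::nat. q > 0 \<Longrightarrow> y [^] q \<noteq> \<one>"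
  obtains z where "z \<in> carrier G" "\<And>q::nat. q > 0 \<Longrightarrow> z [^] q \<noteq> \<one>" "\<And>f. f \<in> F \<Longrightarrow> z \<otimes> f = f \<otimes> z"
proof -
  interpret F: normal F G by (rule F)
  define \<rho> where "\<rho> j = restrict (\<lambda>f. inv (y [^] (j::nat)) \<otimes> f \<otimes> y [^] j) F" for j
  have "range \<rho> \<subseteq> F \<rightarrow>\<^sub>E F" unfolding \<rho>_def using F.inv_op_closed1 y(1) by auto
  moreover have "finite (F \<rightarrow>\<^sub>E F)" using F(2) by (intro finite_PiE) auto
  ultimately have "finite (range \<rho>)" by (rule finite_subset)
  hence "\<not> inj \<rho>" using finite_imageD infinite_UNIV_nat by blast
  then obtain i j where ij: "i < j" "\<rho> i = \<rho> j" by (metis injI linorder_neqE_nat)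
  define z where "z = y [^] (j - i)"
  have zc: "z \<in> carrier G" using y(1) by (simp add: z_def)
  have zi: "y [^] j = z \<otimes> y [^] i" using y(1) ij(1) by (simp add: z_def nat_pow_mult)
  have "z \<otimes> f = f \<otimes> z" if f: "f \<in> F" for f
  proof -
    have "inv (y [^] i) \<otimes> f \<otimes> y [^] i = inv (y [^] j) \<otimes> f \<otimes> y [^] j"
      using fun_cong[OF ij(2), of f] f by (simp add: \<rho>_def)
    also have "\<dots> = inv (y [^] i) \<otimes> (inv z \<otimes> f \<otimes> z) \<otimes> y [^] i"
      unfolding zi using zc f y(1) by (simp add: m_assoc inv_mult_group)
    finally have "f = inv z \<otimes> f \<otimes> z" using zc f y(1) by simp
    hence "z \<otimes> f = z \<otimes> (inv z \<otimes> f \<otimes> z)" by simp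
    thus ?thesis using zc f by (simp add: m_assoc)
  qed
  moreover have "z [^] q \<noteq> \<one>" if "q > 0" for q :: nat
    using y(2)[of "(j - i) * q"] that ij(1) y(1) by (simp add: z_def nat_pow_pow)
  ultimately show ?thesis using that[OF zc] by blast
qed

text \<open>The powers of \<open>z [^] i\<close> stay in the finite \<open>F\<close>, so two of them
  coincide; for nonzero \<open>i\<close> this gives \<open>z\<close> finite order.\<close>

lemma finite_subgroup_int_pow:
  assumes F: "subgroup F G" "finite F" and z: "z \<in> carrier G" "\<And>q::nat. q > 0 \<Longrightarrow> z [^] q \<noteq> \<one>"
    and i: "z [^] (i::int) \<in> F"
  shows "i = 0"
proof (rule ccontr)
  assume "i \<noteq> 0"
  have "range (\<lambda>n::nat. (z [^] i) [^] n) \<subseteq> F" using subgroup_int_pow_closed[OF F(1) i]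
    by (auto simp flip: int_pow_int)
  hence "finite (range (\<lambda>n::nat. (z [^] i) [^] n))" using F(2) finite_subset by blast
  hence "\<not> inj (\<lambda>n::nat. (z [^] i) [^] n)" using finite_imageD infinite_UNIV_nat by blast
  then obtain m n :: nat where mn: "m < n" "(z [^] i) [^] m = (z [^] i) [^] n"
    by (metis injI linorder_neqE_nat)
  have eq: "z [^] (i * int m) = z [^] (i * int n)"
    using mn(2) z(1) by (simp add: int_pow_pow flip: int_pow_int)
  have "z [^] (i * int n - i * int m) = z [^] (i * int n) \<otimes> inv (z [^] (i * int m))"
    by (rule int_pow_diff[OF z(1)])
  also have "\<dots> = \<one>" using eq z(1) by simp
  finally have one: "z [^] (i * int n - i * int m) = \<one>" .
  define k where "k = i * int n - i * int m"
  have "k \<noteq> 0" using \<open>i \<noteq> 0\<close> mn(1) by (simp add: k_def)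
  have "z [^] nat \<bar>k\<bar> = \<one>"
  proof (cases "k \<ge> 0")
    case True
    thus ?thesis using one by (simp add: k_def flip: int_pow_int)
  next
    case False
    hence "z [^] int (nat \<bar>k\<bar>) = inv (z [^] k)" using z(1) by (simp add: int_pow_neg)
    thus ?thesis using one by (simp add: int_pow_int k_def)
  qed
  thus False using z(2)[of "nat \<bar>k\<bar>"] \<open>k \<noteq> 0\<close> by simp
qed

text \<open>The product of \<open>E\<close> with the powers of \<open>z\<close> is normal, having
  the product with the powers of \<open>z [^] 2\<close> as a proper non-nilpotent subgroup. Its
  intersection with the normal subgroup \<open>F\<close> is \<open>E\<close> again.\<close>

lemma non_nilpotent_subgroup_of_finite_normal:
  assumes P: non_nilpotent_overgroups_normal and F: "F \<lhd> G" "finite F"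
    and z: "z \<in> carrier G" "\<And>q::nat. q > 0 \<Longrightarrow> z [^] q \<noteq> \<one>" "\<And>f. f \<in> F \<Longrightarrow> z \<otimes> f = f \<otimes> z"
    and E: "subgroup E G" "E \<subseteq> F" "\<not> nilpotent_group (G\<lparr>carrier := E\<rparr>)"
  shows "E \<lhd> G"
proof -
  interpret F: normal F G by (rule F)
  interpret E: subgroup E G by (rule E)
  have zN: "z \<in> normalizing E"
  proof -
    have "inv z \<otimes> e \<otimes> z = e \<and> z \<otimes> e \<otimes> inv z = e" if "e \<in> E" for e
    proof -
      have ze: "z \<otimes> e = e \<otimes> z" using that E(2) z(3) by blast
      have "inv z \<otimes> e \<otimes> z = inv z \<otimes> (z \<otimes> e)" using ze that z(1) by (simp add: m_assoc)
      also have "\<dots> = e" using that z(1) by simp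
      finally show ?thesis using ze that z(1) by (simp add: m_assoc)
    qed
    thus ?thesis using z(1) by (simp add: normalizing_def)
  qed
  have z2N: "z [^] (2::int) \<in> normalizing E"
    by (rule subgroup_int_pow_closed[OF normalizing_subgroup[OF E.subset] zN])
  let ?H = "mult_powers E z" and ?K = "mult_powers E (z [^] (2::int))"
  have HK: "subgroup ?H G" "subgroup ?K G"
    using mult_powers_subgroup[OF E(1)] zN z2N by auto
  have EF: "inv e \<otimes> f \<in> F" if "e \<in> E" "f \<in> F" for e f using that E(2) by blast
  have "?K \<subset> ?H"
  proof
    show "?K \<subseteq> ?H" unfolding mult_powers_def using z(1) by (auto simp: int_pow_pow)
    \<comment> \<open>Otherwise the power of \<open>z\<close> with odd exponent
      \<open>1 - 2 * i\<close> would lie in the finite \<open>F\<close>, forcing that exponent to be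
      zero.\<close>
    have "z \<notin> ?K"
    proof
      assume "z \<in> ?K"
      then obtain e i where e: "e \<in> E" "z = e \<otimes> (z [^] (2::int)) [^] (i::int)"
        unfolding mult_powers_def by blast
      have "z [^] (1 - 2 * i) = z \<otimes> inv (z [^] (2 * i))"
        using int_pow_diff[OF z(1), of 1 "2 * i"] z(1) by (simp add: int_pow_1)
      also have "z \<otimes> inv (z [^] (2 * i)) = e \<otimes> z [^] (2 * i) \<otimes> inv (z [^] (2 * i))"
        using e(2) z(1) by (simp add: int_pow_pow)
      also have "\<dots> = e" using e(1) z(1) by (simp add: m_assoc)
      finally have "z [^] (1 - 2 * i) \<in> F" using e(1) E(2) by auto
      from finite_subgroup_int_pow[OF F.subgroup_axioms F(2) z(1) _ this] have "1 - 2 * i = 0"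
        using z(2) by blast
      thus False by presburger
    qed
    thus "?K \<noteq> ?H" using mem_mult_powers[OF E(1) z(1)] by blast
  qed
  moreover have "\<not> nilpotent_group (G\<lparr>carrier := ?K\<rparr>)"
    using nilpotent_subgroup_mono[OF E(1) HK(2) subset_mult_powers[OF E.subset]] E(3) by blast
  ultimately have "?H \<lhd> G"
    using P HK unfolding non_nilpotent_overgroups_normal_def by blast
  then interpret H: normal ?H G .
  show ?thesis
  proof (rule normal_conjI[OF E(1)])
    fix g e assume g: "g \<in> carrier G" and e: "e \<in> E"
    have "inv g \<otimes> e \<otimes> g \<in> ?H"
      using H.inv_op_closed1[OF g] e subset_mult_powers[OF E.subset] by blast
    then obtain e' i where e': "e' \<in> E" "inv g \<otimes> e \<otimes> g = e' \<otimes> z [^] (i::int)"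
      unfolding mult_powers_def by blast
    \<comment> \<open>The conjugate of \<open>e\<close> stays in \<open>F\<close>, so its
      \<open>z\<close>-component lies in \<open>F\<close> and is trivial.\<close>
    have "inv e' \<otimes> (inv g \<otimes> e \<otimes> g) \<in> F"
      using EF[OF e'(1)] F.inv_op_closed1[OF g] e E(2) by blast
    hence "z [^] i \<in> F" using e' z(1) by simp
    from finite_subgroup_int_pow[OF F.subgroup_axioms F(2) z(1) _ this] have "i = 0"
      using z(2) by blast
    thus "inv g \<otimes> e \<otimes> g \<in> E" using e' by simp
  qed
qed

section \<open>Commutators when all overgroups of a normal subgroup are normal\<close>

lemma centralizer_subgroup:
  assumes x: "x \<in> carrier G"
  shows "subgroup {c \<in> carrier G. x \<otimes> c = c \<otimes> x} G"
proof (rule subgroupI)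
  have "\<one> \<in> {c \<in> carrier G. x \<otimes> c = c \<otimes> x}" using x by simp
  thus "{c \<in> carrier G. x \<otimes> c = c \<otimes> x} \<noteq> {}" by blast
  fix a b assume "a \<in> {c \<in> carrier G. x \<otimes> c = c \<otimes> x}" "b \<in> {c \<in> carrier G. x \<otimes> c = c \<otimes> x}"
  hence a: "a \<in> carrier G" "x \<otimes> a = a \<otimes> x" and b: "b \<in> carrier G" "x \<otimes> b = b \<otimes> x" by auto
  have "x \<otimes> inv a = inv a \<otimes> (a \<otimes> x) \<otimes> inv a" using a x by simp
  also have "\<dots> = inv a \<otimes> x" unfolding a(2)[symmetric] using a(1) x by (simp add: m_assoc)
  finally show "inv a \<in> {c \<in> carrier G. x \<otimes> c = c \<otimes> x}" using a by simp
  have "x \<otimes> (a \<otimes> b) = x \<otimes> a \<otimes> b" using a(1) b(1) x by (simp add: m_assoc)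
  also have "\<dots> = a \<otimes> (x \<otimes> b)" unfolding a(2) using a(1) b(1) x by (simp add: m_assoc)
  also have "\<dots> = a \<otimes> b \<otimes> x" unfolding b(2) using a b x by (simp add: m_assoc)
  finally show "a \<otimes> b \<in> {c \<in> carrier G. x \<otimes> c = c \<otimes> x}" using a b by simp
qed blast

text \<open>On the powers of \<open>u\<close>, conjugation by \<open>a\<close> and by
  \<open>b\<close> acts as raising to the powers \<open>i\<close> and \<open>j\<close>. These two
  maps commute, so the commutator of \<open>a\<close> and \<open>b\<close> fixes
  \<open>u\<close>.\<close>

lemma conj_pow_imp_commute:
  assumes c: "u \<in> carrier G" "a \<in> carrier G" "b \<in> carrier G"
    and i: "inv a \<otimes> u \<otimes> a = u [^] (i::int)" and j: "inv b \<otimes> u \<otimes> b = u [^] (j::int)"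
  shows "u \<otimes> (a \<otimes> b \<otimes> inv a \<otimes> inv b) = a \<otimes> b \<otimes> inv a \<otimes> inv b \<otimes> u"
proof -
  interpret ca: group_hom G G "\<lambda>y. inv a \<otimes> y \<otimes> a" by (rule conj_hom[OF c(2)])
  interpret cb: group_hom G G "\<lambda>y. inv b \<otimes> y \<otimes> b" by (rule conj_hom[OF c(3)])
  have "inv b \<otimes> u [^] i \<otimes> b = u [^] (j * i)"
    using cb.hom_int_pow[OF c(1), of i] c(1) unfolding j by (simp add: int_pow_pow)
  also have "\<dots> = inv a \<otimes> u [^] j \<otimes> a"
    using ca.hom_int_pow[OF c(1), of j] c(1) unfolding i by (simp add: int_pow_pow mult.commute)
  finally have eq: "inv b \<otimes> (inv a \<otimes> u \<otimes> a) \<otimes> b = inv a \<otimes> (inv b \<otimes> u \<otimes> b) \<otimes> a"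
    unfolding i j .
  have "u \<otimes> (a \<otimes> b \<otimes> inv a \<otimes> inv b)
      = a \<otimes> b \<otimes> (inv b \<otimes> (inv a \<otimes> u \<otimes> a) \<otimes> b) \<otimes> inv a \<otimes> inv b"
    using c by (simp add: m_assoc)
  also have "\<dots> = a \<otimes> b \<otimes> inv a \<otimes> inv b \<otimes> u" unfolding eq using c by (simp add: m_assoc)
  finally show ?thesis .
qed

text \<open>Modulo \<open>E\<close> every cyclic subgroup of \<open>F\<close> is normal, and automorphisms of a cyclic group
  commute; so commutators of elements of \<open>F\<close> are central modulo \<open>E\<close>.\<close>
lemma derived2_subset_of_overgroups_normal:
  assumes E: "E \<lhd> G" "E \<subseteq> F" and F: "subgroup F G"
    and over: "\<And>H. \<lbrakk>subgroup H G; E \<subseteq> H; H \<subseteq> F\<rbrakk> \<Longrightarrow> H \<lhd> G"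
  shows "derived G (derived G F) \<subseteq> E"
proof -
  interpret E: normal E G by (rule E)
  interpret F: subgroup F G by (rule F)
  let ?Q = "G Mod E" and ?\<pi> = "\<lambda>x. E #> x"
  interpret \<pi>: group_hom G ?Q ?\<pi>
    by (intro group_hom.intro E.factorgroup_is_group is_group group_hom_axioms.intro E.r_coset_hom_Mod)
  have ker: "?\<pi> r = \<one>\<^bsub>?Q\<^esub>" if "r \<in> E" for r
    using that coset_join2[OF _ E.subgroup_axioms] by simp
  have ker': "r \<in> E" if "r \<in> carrier G" "?\<pi> r = \<one>\<^bsub>?Q\<^esub>" for r
    using that coset_join1[OF _ _ E.subgroup_axioms] by simp
  \<comment> \<open>The product of \<open>E\<close> with the powers of \<open>x\<close> lies between
    \<open>E\<close> and \<open>F\<close>, hence is normal; modulo \<open>E\<close> it is the cyclic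
    group generated by \<open>x\<close>.\<close>
  have conj_pow: "\<exists>i::int. inv\<^bsub>?Q\<^esub> ?\<pi> a \<otimes>\<^bsub>?Q\<^esub> ?\<pi> x \<otimes>\<^bsub>?Q\<^esub> ?\<pi> a = ?\<pi> x [^]\<^bsub>?Q\<^esub> i"
    if x: "x \<in> F" and a: "a \<in> F" for x a
  proof -
    have "x \<in> normalizing E" using x E.inv_op_closed1 E.inv_op_closed2 by (simp add: normalizing_def)
    hence sub: "subgroup (mult_powers E x) G" by (rule mult_powers_subgroup[OF E.subgroup_axioms])
    moreover have "mult_powers E x \<subseteq> F"
      unfolding mult_powers_def using E(2) subgroup_int_pow_closed[OF F x] by blast
    ultimately interpret H: normal "mult_powers E x" G
      using over[OF sub subset_mult_powers[OF E.subset]] by blast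
    have "inv a \<otimes> x \<otimes> a \<in> mult_powers E x"
      using a x by (intro H.inv_op_closed1 mem_mult_powers E.subgroup_axioms) auto
    then obtain e i where e: "e \<in> E" "inv a \<otimes> x \<otimes> a = e \<otimes> x [^] (i::int)"
      unfolding mult_powers_def by blast
    have "?\<pi> (inv a \<otimes> x \<otimes> a) = ?\<pi> e \<otimes>\<^bsub>?Q\<^esub> ?\<pi> (x [^] i)"
      unfolding e(2) using e(1) x by (intro \<pi>.hom_mult) auto
    also have "\<dots> = ?\<pi> (x [^] i)"
      unfolding ker[OF e(1)] using x by (intro \<pi>.H.l_one \<pi>.hom_closed) auto
    also have "\<dots> = ?\<pi> x [^]\<^bsub>?Q\<^esub> i" using x by (intro \<pi>.hom_int_pow) auto
    finally have "?\<pi> (inv a \<otimes> x \<otimes> a) = ?\<pi> x [^]\<^bsub>?Q\<^esub> i" .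
    moreover have "?\<pi> (inv a \<otimes> x \<otimes> a) = inv\<^bsub>?Q\<^esub> ?\<pi> a \<otimes>\<^bsub>?Q\<^esub> ?\<pi> x \<otimes>\<^bsub>?Q\<^esub> ?\<pi> a"
      using a x \<pi>.hom_mult[of "inv a \<otimes> x" a] \<pi>.hom_mult[of "inv a" x] \<pi>.hom_inv[of a] by simp
    ultimately show ?thesis by metis
  qed
  have central1: "?\<pi> x \<otimes>\<^bsub>?Q\<^esub> ?\<pi> c = ?\<pi> c \<otimes>\<^bsub>?Q\<^esub> ?\<pi> x"
    if x: "x \<in> F" and a: "a \<in> F" and b: "b \<in> F" and c: "c = a \<otimes> b \<otimes> inv a \<otimes> inv b" for x a b c
  proof -
    let ?u = "?\<pi> x" and ?a = "?\<pi> a" and ?b = "?\<pi> b"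
    have cl: "?u \<in> carrier ?Q" "?a \<in> carrier ?Q" "?b \<in> carrier ?Q"
      using x a b \<pi>.hom_closed F.mem_carrier by metis+
    have "?u \<otimes>\<^bsub>?Q\<^esub> (?a \<otimes>\<^bsub>?Q\<^esub> ?b \<otimes>\<^bsub>?Q\<^esub> inv\<^bsub>?Q\<^esub> ?a \<otimes>\<^bsub>?Q\<^esub> inv\<^bsub>?Q\<^esub> ?b)
        = (?a \<otimes>\<^bsub>?Q\<^esub> ?b \<otimes>\<^bsub>?Q\<^esub> inv\<^bsub>?Q\<^esub> ?a \<otimes>\<^bsub>?Q\<^esub> inv\<^bsub>?Q\<^esub> ?b) \<otimes>\<^bsub>?Q\<^esub> ?u"
      using conj_pow[OF x a] conj_pow[OF x b] \<pi>.H.conj_pow_imp_commute[OF cl] by blast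
    also have "?a \<otimes>\<^bsub>?Q\<^esub> ?b \<otimes>\<^bsub>?Q\<^esub> inv\<^bsub>?Q\<^esub> ?a \<otimes>\<^bsub>?Q\<^esub> inv\<^bsub>?Q\<^esub> ?b = ?\<pi> c"
      unfolding c using a b by (simp del: mult_FactGroup)
    finally show ?thesis .
  qed
  \<comment> \<open>The elements commuting with \<open>x\<close> modulo \<open>E\<close> form a
    subgroup, so centrality extends from single commutators to the derived subgroup.\<close>
  have central: "commutator G x c \<in> E" if x: "x \<in> F" and c: "c \<in> derived G F" for x c
  proof -
    let ?Z = "{c \<in> carrier ?Q. ?\<pi> x \<otimes>\<^bsub>?Q\<^esub> c = c \<otimes>\<^bsub>?Q\<^esub> ?\<pi> x}"
    let ?C = "{c \<in> carrier G. ?\<pi> c \<in> ?Z}"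
    have "subgroup ?C G"
      using x by (intro \<pi>.preimage_subgroup \<pi>.H.centralizer_subgroup \<pi>.hom_closed) auto
    moreover have "derived_set G F \<subseteq> ?C" using central1[OF x] by (auto simp del: mult_FactGroup)
    ultimately have "derived G F \<subseteq> ?C" unfolding derived_def by (intro generate_subgroup_incl)
    hence cC: "c \<in> carrier G" "?\<pi> x \<otimes>\<^bsub>?Q\<^esub> ?\<pi> c = ?\<pi> c \<otimes>\<^bsub>?Q\<^esub> ?\<pi> x" using c by auto
    have "commutator ?Q (?\<pi> x) (?\<pi> c) = \<one>\<^bsub>?Q\<^esub>"
      using cC x by (subst \<pi>.H.commutator_eq_one_iff) auto
    hence "?\<pi> (commutator G x c) = \<one>\<^bsub>?Q\<^esub>" using \<pi>.commutator_img[of x c] cC(1) x by simp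
    thus ?thesis using ker' cC(1) x by simp
  qed
  have dF: "derived G F \<subseteq> F" by (rule derived_incl[OF subset_refl F])
  have dsub: "subgroup (derived G F) G" by (rule derived_is_subgroup[OF F.subset])
  have "derived_set G (derived G F) \<subseteq> E"
  proof safe
    fix a b assume ab: "a \<in> derived G F" "b \<in> derived G F"
    have c: "a \<in> F" "b \<in> F" using ab dF by auto
    have "commutator G (inv a) (inv b) \<in> E"
      using c by (intro central subgroup.m_inv_closed[OF dsub ab(2)]) simp
    thus "a \<otimes> b \<otimes> inv a \<otimes> inv b \<in> E" using c by (simp add: commutator_def)
  qed
  thus ?thesis unfolding derived_def[of G "derived G F"] by (rule generate_subgroup_incl[OF _ E.subgroup_axioms])
qed

text \<open>A non-nilpotent \<open>E\<close> of least order in \<open>F\<close> has only nilpotent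
  proper subgroups, so Schmidt's theorem applies to it. All subgroups between \<open>E\<close> and
  \<open>F\<close> are non-nilpotent, hence normal, and two derived steps lead from \<open>F\<close>
  into \<open>E\<close>.\<close>

lemma finite_normal_solvable:
  assumes F: "F \<lhd> G" "finite F"
    and normal: "\<And>E. \<lbrakk>subgroup E G; E \<subseteq> F; \<not> nilpotent_group (G\<lparr>carrier := E\<rparr>)\<rbrakk> \<Longrightarrow> E \<lhd> G"
  shows "\<exists>n. (derived G ^^ n) F \<subseteq> {\<one>}"
proof (cases "nilpotent_group (G\<lparr>carrier := F\<rparr>)")
  case True
  thus ?thesis using nilpotent_imp_derived_trivial[OF normal_imp_subgroup[OF F(1)]] by blast
next
  case False
  let ?P = "\<lambda>E. subgroup E G \<and> E \<subseteq> F \<and> \<not> nilpotent_group (G\<lparr>carrier := E\<rparr>)"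
  have PF: "?P F" using False normal_imp_subgroup[OF F(1)] by blast
  obtain E where E: "?P E" and least: "\<And>K. ?P K \<Longrightarrow> card E \<le> card K"
    using ex_has_least_nat[of ?P F card, OF PF] by blast
  have Efin: "finite E" using E F(2) finite_subset by blast
  have "\<exists>n. (derived G ^^ n) E \<subseteq> {\<one>}"
  proof (rule schmidt_solvable)
    fix H assume H: "subgroup H G" "H \<subset> E"
    have "card H < card E" using H(2) Efin by (simp add: psubset_card_mono)
    thus "nilpotent_group (G\<lparr>carrier := H\<rparr>)" using least[of H] H E by force
  qed (use E Efin in auto)
  then obtain n where n: "(derived G ^^ n) E \<subseteq> {\<one>}" by blast
  have "derived G (derived G F) \<subseteq> E"
  proof (rule derived2_subset_of_overgroups_normal)
    show "E \<lhd> G" "E \<subseteq> F" "subgroup F G" using E normal normal_imp_subgroup[OF F(1)] by blast+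
    fix H assume H: "subgroup H G" "E \<subseteq> H" "H \<subseteq> F"
    have "\<not> nilpotent_group (G\<lparr>carrier := H\<rparr>)" using nilpotent_subgroup_mono[OF _ H(1,2)] E by blast
    thus "H \<lhd> G" using normal H by blast
  qed
  hence "(derived G ^^ n) (derived G (derived G F)) \<subseteq> {\<one>}"
    using mono_exp_of_derived n by blast
  hence "(derived G ^^ Suc (Suc n)) F \<subseteq> {\<one>}" by (simp add: funpow_swap1)
  thus ?thesis by blast
qed

end

section \<open>Finiteness of a lower central term, and solubility of infinite groups\<close>

theorem mainTheorem12:
  fixes G :: "('a, 'b) monoid_scheme"
  assumes "group G"
    and "finitely_generated_group G"
    and "para_Nil_Hamiltonian G"
    and "\<exists>H. subgroup H G \<and> nilpotent_group (G\<lparr>carrier := H\<rparr>) \<and> finite (rcosets\<^bsub>G\<^esub> H)"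
  shows "(\<exists>n::nat. n > 0 \<and> finite (gamma G n)) \<and> (\<not> solvable G \<longrightarrow> finite (carrier G))"
proof -
  interpret group G by fact
  have P: non_nilpotent_overgroups_normal
    by (rule para_Nil_Hamiltonian_imp_overgroups_normal) fact
  obtain H where H: "subgroup H G" "nilpotent_group (G\<lparr>carrier := H\<rparr>)" "finite (rcosets\<^bsub>G\<^esub> H)"
    using assms(4) by blast
  obtain N where N: "N \<lhd> G" "N \<subseteq> H" "finite_mod (carrier G) N"
    using finite_index_core[OF H(1,3)] .
  interpret N: normal N G by (rule N)
  obtain S where "finite S" "S \<subseteq> carrier G" "generate G S = carrier G"
    using assms(2) unfolding finitely_generated_group_def by blast
  then obtain T where T: "finite T" "T \<subseteq> N" "generate G T = N"
    using finite_index_fg[OF N.subgroup_axioms N(3)] by blast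
  have "nilpotent_group (G\<lparr>carrier := N\<rparr>)"
    by (rule nilpotent_subgroup_mono[OF N.subgroup_axioms H(1) N(2) H(2)])
  then obtain c where c: "lcs_in G N c \<subseteq> {\<one>\<^bsub>G\<^esub>}"
    using nilpotent_subgroup_iff[OF N.subgroup_axioms] by blast
  hence c1: "lcs_in G N c = {\<one>\<^bsub>G\<^esub>}"
    using subgroup.one_closed[OF lcs_in_subgroup[OF N.subgroup_axioms, of c]] by blast
  \<comment> \<open>The descent along the series of \<open>N\<close> ends at its trivial
    term.\<close>
  obtain n where "finite_mod (lcs G n) {\<one>\<^bsub>G\<^esub>}"
    using finite_mod_lcs_in[OF P N(1,3) T, of c] unfolding c1 by blast
  hence F: "finite (lcs G n)" by (rule finite_mod_trivial)
  \<comment> \<open>\<open>gamma\<close> counts from 1 and \<open>lcs\<close> from 0.\<close>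
  hence "finite (gamma G (Suc n))" by (simp add: gamma_def)
  moreover have "solvable G" if inf: "infinite (carrier G)"
  proof -
    have "infinite N"
    proof
      assume "finite N"
      obtain R where R: "finite R" "\<forall>l \<in> carrier G. \<exists>n \<in> N. \<exists>r \<in> R. l = n \<otimes>\<^bsub>G\<^esub> r"
        using N(3) unfolding finite_mod_def by blast
      hence "carrier G \<subseteq> (\<lambda>(n, r). n \<otimes>\<^bsub>G\<^esub> r) ` (N \<times> R)" by force
      thus False using inf \<open>finite N\<close> R(1) finite_subset by blast
    qed
    \<comment> \<open>An infinite finitely generated nilpotent group is not a torsion group.\<close>
    then obtain y where "y \<in> N" and y: "\<And>q::nat. q > 0 \<Longrightarrow> y [^]\<^bsub>G\<^esub> q \<noteq> \<one>\<^bsub>G\<^esub>"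
      using nilpotent_torsion_finite[OF N(1) T c] by blast
    have nF: "lcs G n \<lhd> G" using lcs_in_normal[OF normal_self, of n] by (simp add: lcs_in_carrier)
    obtain z where z: "z \<in> carrier G" "\<And>q::nat. q > 0 \<Longrightarrow> z [^]\<^bsub>G\<^esub> q \<noteq> \<one>\<^bsub>G\<^esub>"
      "\<And>f. f \<in> lcs G n \<Longrightarrow> z \<otimes>\<^bsub>G\<^esub> f = f \<otimes>\<^bsub>G\<^esub> z"
      using infinite_order_centralizer[OF nF F N.mem_carrier[OF \<open>y \<in> N\<close>] y] by blast
    obtain m where m: "(derived G ^^ m) (lcs G n) \<subseteq> {\<one>\<^bsub>G\<^esub>}"
      using finite_normal_solvable[OF nF F non_nilpotent_subgroup_of_finite_normal[OF P nF F z]] by blast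
    \<comment> \<open>After \<open>n\<close> derived steps the series is inside the finite term
      \<open>lcs G n\<close>, and \<open>m\<close> further steps make it trivial.\<close>
    have "(derived G ^^ n) (carrier G) \<subseteq> lcs G n"
      using derived_subset_lcs_in[OF subgroup_self, of n] by (simp add: lcs_in_carrier)
    from mono_exp_of_derived[OF this, of m] m
    have "(derived G ^^ (m + n)) (carrier G) \<subseteq> {\<one>\<^bsub>G\<^esub>}" by (simp add: funpow_add)
    moreover have "\<one>\<^bsub>G\<^esub> \<in> (derived G ^^ (m + n)) (carrier G)"
      by (rule subgroup.one_closed[OF exp_of_derived_is_subgroup[OF subgroup_self]])
    ultimately have "(derived G ^^ (m + n)) (carrier G) = {\<one>\<^bsub>G\<^esub>}" by blast
    thus ?thesis
      unfolding solvable_def by (rule trivial_derived_seq_imp_solvable[OF subgroup_self])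
  qed
  ultimately show ?thesis by blast
qed

end
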